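(* Suppose $(p_{XY},p_{Z|XY})$ is computable with asymptotic security. Then \[R_S=\min_{p_{U|XYZ}} I(Z;U|Y),\] where the minimum is over all conditional p.m.f.'s $p_{U|XYZ}$ (with $(U,X,Y,Z)\sim p_{XY}p_{Z|XY}p_{U|XYZ}$) such that $U-X-Y$, $Z-(U,Y)-X$ and $U-(Y,Z)-X$ are Markov chains, and where the alphabet $\mathcal{U}$ of $U$ may be taken to satisfy $|\mathcal{U}|\le|\mathcal{X}|\cdot|\mathcal{Y}|\cdot|\mathcal{Z}|+2$.
   Context: Setup: $\mathcal{X},\mathcal{Y},\mathcal{Z}$ finite; Alice observes $X^n$, Bob observes $Y^n$, where $(X_i,Y_i)$ are i.i.d. according to $p_{XY}$; Bob wants an output distributed according to $p_{Z^n|X^nY^n}(z^n|x^n,y^n)=\prod_{i=1}^n p_{Z|XY}(z_i|x_i,y_i)$, and $p_{X^nY^nZ^n}$ denotes the resulting joint p.m.f. An $(n,2^{nR})$-code is a pair of stochastic maps $(p_{M|X^n},p_{\hat Z^n|MY^n})$ with $M\in\{1,\dots,2^{nR}\}$ (Alice sends $M$, Bob outputs $\hat Z^n$); it induces $p_{X^nY^nM\hat Z^n}=p_{X^nY^n}p_{M|X^n}p_{\hat Z^n|MY^n}$. Total variation distance: $\|p-q\|_1=\frac12\sum_u|p(u)-q(u)|$. A rate $R$ is achievable if there is a sequence of codes of rate $R$ such that for every $\epsilon>0$ there is a large enough $n$ with $\|p_{X^nY^n\hat Z^n}-p_{X^nY^nZ^n}\|_1\le\epsilon$ and $I(M;X^n|Y^n,\hat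 Z^n)\le n\epsilon$. $R_S$ is the infimum of achievable rates ($R_S=\infty$ if none); $(p_{XY},p_{Z|XY})$ is computable with asymptotic security if $R_S<\infty$. *)

theory Defs
  imports "HOL-Probability.Probability"
begin

fun seq_pmf :: "'a pmf list \<Rightarrow> 'a list pmf" where
  "seq_pmf [] = return_pmf []"
| "seq_pmf (p # ps) = bind_pmf p (\<lambda>a. bind_pmf (seq_pmf ps) (\<lambda>as. return_pmf (a # as)))"

definition tv_dist :: "'a pmf \<Rightarrow> 'a pmf \<Rightarrow> real" where
  "tv_dist p q = (1/2) * infsum (\<lambda>u. \<bar>pmf p u - pmf q u\<bar>) UNIV"

text \<open>Conditional mutual information I(F;G|H) (in bits) of random variables F, G, H
  defined on a discrete (finitely supported) probability space P.\<close>
definition cmi :: "'s pmf \<Rightarrow> ('s \<Rightarrow> 'a) \<Rightarrow> ('s \<Rightarrow> 'b) \<Rightarrow> ('s \<Rightarrow> 'c) \<Rightarrow> real" where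
  "cmi P f g h =
    (\<Sum>(a,b,c) \<in> set_pmf (map_pmf (\<lambda>s. (f s, g s, h s)) P).
        pmf (map_pmf (\<lambda>s. (f s, g s, h s)) P) (a,b,c) *
        log 2 (pmf (map_pmf (\<lambda>s. (f s, g s, h s)) P) (a,b,c) * pmf (map_pmf h P) c /
               (pmf (map_pmf (\<lambda>s. (f s, h s)) P) (a,c) * pmf (map_pmf (\<lambda>s. (g s, h s)) P) (b,c))))"

definition markov :: "'s pmf \<Rightarrow> ('s \<Rightarrow> 'a) \<Rightarrow> ('s \<Rightarrow> 'b) \<Rightarrow> ('s \<Rightarrow> 'c) \<Rightarrow> bool" where
  "markov P f g h \<longleftrightarrow> (\<forall>a b c.
     pmf (map_pmf (\<lambda>s. (f s, g s, h s)) P) (a,b,c) * pmf (map_pmf g P) b =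
     pmf (map_pmf (\<lambda>s. (f s, g s)) P) (a,b) * pmf (map_pmf (\<lambda>s. (g s, h s)) P) (b,c))"

definition src_pmf :: "('x \<times> 'y) pmf \<Rightarrow> ('x \<Rightarrow> 'y \<Rightarrow> 'z pmf) \<Rightarrow> nat \<Rightarrow> ('x list \<times> 'y list \<times> 'z list) pmf" where
  "src_pmf pXY pZ n =
     bind_pmf (seq_pmf (replicate n pXY)) (\<lambda>xys.
     bind_pmf (seq_pmf (map (\<lambda>(x,y). pZ x y) xys)) (\<lambda>zs.
     return_pmf (map fst xys, map snd xys, zs)))"

definition code_pmf :: "('x \<times> 'y) pmf \<Rightarrow> nat \<Rightarrow> ('x list \<Rightarrow> nat pmf) \<Rightarrow> (nat \<Rightarrow> 'y list \<Rightarrow> 'z list pmf)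
     \<Rightarrow> ('x list \<times> 'y list \<times> nat \<times> 'z list) pmf" where
  "code_pmf pXY n enc dec =
     bind_pmf (seq_pmf (replicate n pXY)) (\<lambda>xys.
     bind_pmf (enc (map fst xys)) (\<lambda>m.
     bind_pmf (dec m (map snd xys)) (\<lambda>zs.
     return_pmf (map fst xys, map snd xys, m, zs))))"

definition msg_size :: "nat \<Rightarrow> real \<Rightarrow> nat" where
  "msg_size n R = nat \<lceil>2 powr (real n * R)\<rceil>"

definition achievable :: "('x \<times> 'y) pmf \<Rightarrow> ('x \<Rightarrow> 'y \<Rightarrow> 'z pmf) \<Rightarrow> real \<Rightarrow> bool" where
  "achievable pXY pZ R \<longleftrightarrow> R \<ge> 0 \<and>
    (\<exists>(enc :: nat \<Rightarrow> 'x list \<Rightarrow> nat pmf) (dec :: nat \<Rightarrow> nat \<Rightarrow> 'y list \<Rightarrow> 'z list pmf).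
       (\<forall>n xs. set_pmf (enc n xs) \<subseteq> {1..msg_size n R}) \<and>
       (\<forall>n m ys. set_pmf (dec n m ys) \<subseteq> {zs. length zs = n}) \<and>
       (\<forall>\<epsilon>>0. eventually (\<lambda>n.
          tv_dist (map_pmf (\<lambda>(xs,ys,m,zs). (xs,ys,zs)) (code_pmf pXY n (enc n) (dec n)))
                  (src_pmf pXY pZ n) \<le> \<epsilon> \<and>
          cmi (code_pmf pXY n (enc n) (dec n))
              (\<lambda>(xs,ys,m,zs). m) (\<lambda>(xs,ys,m,zs). xs) (\<lambda>(xs,ys,m,zs). (ys,zs)) \<le> real n * \<epsilon>)
        sequentially))"

definition secure_rate :: "('x \<times> 'y) pmf \<Rightarrow> ('x \<Rightarrow> 'y \<Rightarrow> 'z pmf) \<Rightarrow> real" where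
  "secure_rate pXY pZ = Inf {R. achievable pXY pZ R}"

definition computable_asym_secure :: "('x \<times> 'y) pmf \<Rightarrow> ('x \<Rightarrow> 'y \<Rightarrow> 'z pmf) \<Rightarrow> bool" where
  "computable_asym_secure pXY pZ \<longleftrightarrow> (\<exists>R. achievable pXY pZ R)"

definition joint_U :: "('x \<times> 'y) pmf \<Rightarrow> ('x \<Rightarrow> 'y \<Rightarrow> 'z pmf) \<Rightarrow> ('x \<Rightarrow> 'y \<Rightarrow> 'z \<Rightarrow> 'u pmf)
     \<Rightarrow> ('u \<times> 'x \<times> 'y \<times> 'z) pmf" where
  "joint_U pXY pZ pU =
     bind_pmf pXY (\<lambda>(x,y). bind_pmf (pZ x y) (\<lambda>z. bind_pmf (pU x y z) (\<lambda>u. return_pmf (u,x,y,z))))"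

definition admissible_U :: "('x \<times> 'y) pmf \<Rightarrow> ('x \<Rightarrow> 'y \<Rightarrow> 'z pmf) \<Rightarrow> ('x \<Rightarrow> 'y \<Rightarrow> 'z \<Rightarrow> 'u pmf) \<Rightarrow> bool" where
  "admissible_U pXY pZ pU \<longleftrightarrow>
     (let Q = joint_U pXY pZ pU in
       markov Q (\<lambda>(u,x,y,z). u) (\<lambda>(u,x,y,z). x) (\<lambda>(u,x,y,z). y) \<and>
       markov Q (\<lambda>(u,x,y,z). z) (\<lambda>(u,x,y,z). (u,y)) (\<lambda>(u,x,y,z). x) \<and>
       markov Q (\<lambda>(u,x,y,z). u) (\<lambda>(u,x,y,z). (y,z)) (\<lambda>(u,x,y,z). x))"

definition info_ZU_Y :: "('x \<times> 'y) pmf \<Rightarrow> ('x \<Rightarrow> 'y \<Rightarrow> 'z pmf) \<Rightarrow> ('x \<Rightarrow> 'y \<Rightarrow> 'z \<Rightarrow> 'u pmf) \<Rightarrow> real" where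
  "info_ZU_Y pXY pZ pU =
     cmi (joint_U pXY pZ pU) (\<lambda>(u,x,y,z). z) (\<lambda>(u,x,y,z). u) (\<lambda>(u,x,y,z). y)"

end

theory Submission
  imports Defs
begin

text \<open>
  Achievability. Draw codewords \<open>u\<^sup>n(m, k)\<close> independently from the law of \<open>U\<close>, with \<open>m\<close> ranging over
  \<open>2\<^bsup>nR\<^esup>\<close> and \<open>k\<close> over about \<open>2\<^bsup>nI(U;Y)\<^esup>\<close> values. If the total rate exceeds \<open>I(U;XYZ)\<close>, a uniformly chosen
  codeword sent through the channel \<open>p(xyz|u)\<close> produces nearly i.i.d. triples (soft covering), and the posterior of
  \<open>(m, k)\<close> given \<open>x\<^sup>n\<close> serves as the encoder; Bob recovers \<open>k\<close> from \<open>m\<close> and \<open>y\<^sup>n\<close> (packing). Because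
  \<open>U - (Y,Z) - X\<close>, this needs exactly \<open>R > I(U;XYZ) - I(U;Y) = I(Z;U|Y)\<close>. The leakage is first computed for the
  ideal codebook distribution and transferred to the code by a Fannes-type continuity bound.

  Converse. For each letter \<open>i\<close> and each value of \<open>(M, Y\<^sup>n without Y\<^sub>i)\<close>, the conditional law \<open>r\<close> of
  \<open>(X\<^sub>i, Y\<^sub>i, Z\<^sub>i)\<close> lies in a fixed compact set of laws satisfying the first two Markov conditions exactly.
  Averaging the points \<open>(r, H\<^sub>r(X|YZ), H\<^sub>r(Z|Y))\<close> gives a point of a compact convex hull, which approaches
  one with first coordinate \<open>p\<^sub>X\<^sub>Y\<^sub>Z\<close>. Caratheodory's theorem in a space of affine dimension
  \<open>|X||Y||Z| + 1\<close> turns it back into an auxiliary variable with \<open>|X||Y||Z| + 2\<close> values.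
\<close>

subsection \<open>Finite expectations\<close>

text \<open>The three Markov conditions act differently. \<open>U - X - Y\<close> and
  \<open>Z - (U,Y) - X\<close> restrict each conditional law p(xyz|u) on its own, and a code
  satisfies them exactly, letter by letter; they say that the joint law is p(u) p(x|u) p(y|x)
  p(z|u,y), which an encoder and a decoder can simulate. \<open>U - (Y,Z) - X\<close> ties different
  values of U together and holds for codes only up to the leakage. It is therefore carried as the
  inequality H(X|UYZ) \<ge> H(X|YZ): since I(U;X|YZ) = H(X|YZ) - H(X|UYZ) is nonnegative, the
  inequality is the condition, and it survives limits. Conditional entropies given U are averages
  over u, hence linear in the mixture. H(X|UYZ) carries the third condition and H(Z|UY) the
  objective I(Z;U|Y) = H(Z|Y) - H(Z|UY); these are the two coordinates added to the law. In
  achievability one codebook must serve covering, decoding and leakage at once. Leakage needs only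
  that H(X|YZ) given the codeword letters, averaged over the codebook, is close to its mean, so it
  enters as a third expectation in the same averaging argument.\<close>

abbreviation fins :: "'a pmf \<Rightarrow> bool" where "fins p \<equiv> finite (set_pmf p)"

text \<open>A plain sum over the support: linearity and monotonicity need no integrability. On an
  infinite support the sum is 0, so facts that use total mass, such as \<open>pex_const\<close>,
  assume finite support.\<close>

definition pex :: "'a pmf \<Rightarrow> ('a \<Rightarrow> real) \<Rightarrow> real" where
  "pex p f = (\<Sum>a\<in>set_pmf p. pmf p a * f a)"

lemma pex_superset:
  assumes "finite A" "set_pmf p \<subseteq> A"
  shows "pex p f = (\<Sum>a\<in>A. pmf p a * f a)"
  unfolding pex_def by (rule sum.mono_neutral_left) (use assms in \<open>auto simp: set_pmf_iff\<close>)

lemma pex_eq_expectation: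
  assumes "fins p"
  shows "pex p f = measure_pmf.expectation p f"
  unfolding pex_def using assms by (subst integral_measure_pmf[of "set_pmf p"]) auto

lemma pex_bind:
  assumes "fins p" "\<And>a. a \<in> set_pmf p \<Longrightarrow> fins (q a)"
  shows "pex (bind_pmf p q) f = pex p (\<lambda>a. pex (q a) f)"
proof -
  have "pex (bind_pmf p q) f = measure_pmf.expectation (bind_pmf p q) f"
    using assms by (intro pex_eq_expectation) auto
  also have "\<dots> = (\<Sum>a\<in>set_pmf p. pmf p a *\<^sub>R measure_pmf.expectation (q a) f)"
    using assms by (intro pmf_expectation_bind) auto
  also have "\<dots> = pex p (\<lambda>a. pex (q a) f)"
    unfolding pex_def[of p] by (intro sum.cong) (simp_all add: pex_eq_expectation assms)
  finally show ?thesis .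
qed

lemma pex_return [simp]: "pex (return_pmf a) f = f a"
  by (simp add: pex_def)

lemma pex_map:
  assumes "fins p"
  shows "pex (map_pmf g p) f = pex p (\<lambda>a. f (g a))"
  using assms by (simp add: map_pmf_def pex_bind)

lemma pex_add: "pex p (\<lambda>a. f a + g a) = pex p f + pex p g"
  by (simp add: pex_def sum.distrib distrib_left)

lemma pex_diff: "pex p (\<lambda>a. f a - g a) = pex p f - pex p g"
  by (simp add: pex_def sum_subtractf right_diff_distrib)

lemma pex_uminus: "pex p (\<lambda>a. - f a) = - pex p f"
  by (simp add: pex_def sum_negf)

lemma pex_cmult: "pex p (\<lambda>a. c * f a) = c * pex p f"
  by (simp add: pex_def sum_distrib_left mult_ac)

lemma pex_divide: "pex p (\<lambda>a. f a / c) = pex p f / c"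
  by (simp add: pex_def sum_divide_distrib)

lemma pex_sum: "pex p (\<lambda>a. \<Sum>i\<in>I. f i a) = (\<Sum>i\<in>I. pex p (f i))"
  unfolding pex_def sum_distrib_left by (rule sum.swap)

lemma pex_swap: "pex p (\<lambda>a. pex q (f a)) = pex q (\<lambda>b. pex p (\<lambda>a. f a b))"
  unfolding pex_def sum_distrib_left by (subst sum.swap) (simp add: mult_ac)

lemma pex_const: "fins p \<Longrightarrow> pex p (\<lambda>_. c) = c"
  by (simp add: pex_def sum_distrib_right[symmetric] sum_pmf_eq_1)

lemma pex_mono: "(\<And>a. a \<in> set_pmf p \<Longrightarrow> f a \<le> g a) \<Longrightarrow> pex p f \<le> pex p g"
  unfolding pex_def by (intro sum_mono mult_left_mono) auto

lemma pex_cong: "(\<And>a. a \<in> set_pmf p \<Longrightarrow> f a = g a) \<Longrightarrow> pex p f = pex p g"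
  unfolding pex_def by (intro sum.cong) auto

lemma pex_nonneg: "(\<And>a. a \<in> set_pmf p \<Longrightarrow> 0 \<le> f a) \<Longrightarrow> 0 \<le> pex p f"
  unfolding pex_def by (intro sum_nonneg) auto

text \<open>If every value on the support exceeded \<open>B\<close>, so would the mean. This turns a
  bound for random codebooks into the existence of one good codebook.\<close>

lemma pex_exists_le:
  assumes "fins p" "pex p f \<le> B"
  shows "\<exists>a\<in>set_pmf p. f a \<le> B"
proof (rule ccontr)
  assume "\<not> ?thesis"
  then have "\<And>a. a \<in> set_pmf p \<Longrightarrow> B < f a" by auto
  then have "(\<Sum>a\<in>set_pmf p. pmf p a * B) < (\<Sum>a\<in>set_pmf p. pmf p a * f a)"
    using assms set_pmf_not_empty[of p]
    by (intro sum_strict_mono) (auto simp: pmf_positive_iff)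
  moreover have "(\<Sum>a\<in>set_pmf p. pmf p a * B) = B"
    using pex_const[OF assms(1), of B] by (simp add: pex_def)
  ultimately show False using assms by (simp add: pex_def)
qed

lemma pmf_bind_pex:
  assumes "fins p"
  shows "pmf (bind_pmf p q) b = pex p (\<lambda>a. pmf (q a) b)"
  by (simp add: pmf_bind pex_eq_expectation assms)

lemma pmf_map_pex:
  assumes "fins p"
  shows "pmf (map_pmf f p) b = pex p (\<lambda>a. of_bool (f a = b))"
  using assms by (simp add: map_pmf_def pmf_bind_pex indicator_def of_bool_def eq_commute)

lemma pex_of_bool_eq:
  assumes "fins p"
  shows "pex p (\<lambda>a. of_bool (a = b) * f a) = pmf p b * f b"
proof -
  have "pex p (\<lambda>a. of_bool (a = b) * f a) = (\<Sum>a\<in>insert b (set_pmf p). pmf p a * (of_bool (a = b) * f a))"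
    using assms by (intro pex_superset) auto
  also have "\<dots> = (\<Sum>a\<in>insert b (set_pmf p). if a = b then pmf p b * f b else 0)"
    by (intro sum.cong) auto
  also have "\<dots> = pmf p b * f b" using assms by simp
  finally show ?thesis .
qed

lemma pmf_bind_Pair:
  assumes "fins p"
  shows "pmf (bind_pmf p (\<lambda>i. map_pmf (Pair i) (V i))) (i, a) = pmf p i * pmf (V i) a"
proof -
  have "pmf (bind_pmf p (\<lambda>i. map_pmf (Pair i) (V i))) (i, a) = pex p (\<lambda>j. pmf (map_pmf (Pair j) (V j)) (i, a))"
    using assms by (simp add: pmf_bind_pex)
  also have "\<dots> = pex p (\<lambda>j. of_bool (j = i) * pmf (V j) a)"
  proof (rule pex_cong)
    fix j
    show "pmf (map_pmf (Pair j) (V j)) (i, a) = of_bool (j = i) * pmf (V j) a"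
      by (cases "j = i") (auto simp: pmf_map_inj' inj_on_def intro!: pmf_map_outside)
  qed
  also have "\<dots> = pmf p i * pmf (V i) a" using assms by (simp add: pex_of_bool_eq)
  finally show ?thesis .
qed

lemma pmf_map_cong_iff:
  assumes "\<And>s. f s = a \<longleftrightarrow> g s = b"
  shows "pmf (map_pmf f P) a = pmf (map_pmf g P) b"
  unfolding pmf_map using assms by (intro arg_cong[where f = "measure _"]) auto

lemma pex_pmf_of_set:
  assumes "finite S" "S \<noteq> {}"
  shows "pex (pmf_of_set S) f = (\<Sum>s\<in>S. f s) / card S"
  using assms by (simp add: pex_def sum_divide_distrib)

text \<open>Here \<open>k\<close> enumerates the fibre of \<open>f\<close> over \<open>b\<close>, up
  to points of probability zero.\<close>

lemma pmf_map_sum: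
  assumes "finite A" "inj_on k A" "\<And>s. s \<in> set_pmf p \<Longrightarrow> f s = b \<Longrightarrow> s \<in> k ` A" "\<And>a. a \<in> A \<Longrightarrow> f (k a) = b"
  shows "pmf (map_pmf f p) b = (\<Sum>a\<in>A. pmf p (k a))"
proof -
  have "pmf (map_pmf f p) b = measure (measure_pmf p) (k ` A)"
    unfolding pmf_map
    by (rule measure_prob_cong_0) (use assms in \<open>auto simp: pmf_eq_0_set_pmf\<close>)
  also have "\<dots> = (\<Sum>s\<in>k ` A. pmf p s)"
    using assms by (intro measure_measure_pmf_finite) auto
  also have "\<dots> = (\<Sum>a\<in>A. pmf p (k a))"
    using assms by (subst sum.reindex) auto
  finally show ?thesis .
qed

lemma pmf_map_snd_pair:
  assumes "finite A" "set_pmf p \<subseteq> A \<times> UNIV"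
  shows "pmf (map_pmf snd p) b = (\<Sum>a\<in>A. pmf p (a, b))"
  by (rule pmf_map_sum) (use assms in \<open>auto simp: inj_on_def\<close>)

subsection \<open>Total variation distance\<close>

lemma tv_dist_sum:
  assumes "finite A" "set_pmf p \<subseteq> A" "set_pmf q \<subseteq> A"
  shows "tv_dist p q = (\<Sum>a\<in>A. \<bar>pmf p a - pmf q a\<bar>) / 2"
proof -
  have "infsum (\<lambda>u. \<bar>pmf p u - pmf q u\<bar>) UNIV = infsum (\<lambda>u. \<bar>pmf p u - pmf q u\<bar>) A"
    proof (rule infsum_cong_neutral)
    fix x assume "x \<in> UNIV - A"
    then have "x \<notin> set_pmf p" "x \<notin> set_pmf q" using assms by auto
    then show "\<bar>pmf p x - pmf q x\<bar> = 0" by (simp add: set_pmf_iff)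
  qed auto
  also have "\<dots> = (\<Sum>a\<in>A. \<bar>pmf p a - pmf q a\<bar>)" using assms by simp
  finally show ?thesis by (simp add: tv_dist_def)
qed

lemma tv_dist_sum':
  assumes "fins p" "fins q"
  shows "tv_dist p q = (\<Sum>a\<in>set_pmf p \<union> set_pmf q. \<bar>pmf p a - pmf q a\<bar>) / 2"
  by (rule tv_dist_sum) (use assms in auto)

lemma tv_dist_sym: "tv_dist p q = tv_dist q p"
  by (simp add: tv_dist_def abs_minus_commute)

lemma tv_dist_nonneg: "fins p \<Longrightarrow> fins q \<Longrightarrow> 0 \<le> tv_dist p q"
  by (simp add: tv_dist_sum' sum_nonneg)

lemma tv_dist_self [simp]: "tv_dist p p = 0"
  by (simp add: tv_dist_def)

lemma tv_dist_triangle: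
  assumes "fins p" "fins q" "fins r"
  shows "tv_dist p r \<le> tv_dist p q + tv_dist q r"
proof -
  define A where "A = set_pmf p \<union> set_pmf q \<union> set_pmf r"
  have *: "finite A" "set_pmf p \<subseteq> A" "set_pmf q \<subseteq> A" "set_pmf r \<subseteq> A" using assms by (auto simp: A_def)
  have "(\<Sum>a\<in>A. \<bar>pmf p a - pmf r a\<bar>) \<le> (\<Sum>a\<in>A. \<bar>pmf p a - pmf q a\<bar> + \<bar>pmf q a - pmf r a\<bar>)"
    by (intro sum_mono) auto
  then show ?thesis using * by (simp add: tv_dist_sum[of A] sum.distrib)
qed

lemma tv_dist_le_1:
  assumes "fins p" "fins q"
  shows "tv_dist p q \<le> 1"
proof -
  define A where "A = set_pmf p \<union> set_pmf q"
  have *: "finite A" "set_pmf p \<subseteq> A" "set_pmf q \<subseteq> A" using assms by (auto simp: A_def)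
  have "(\<Sum>a\<in>A. \<bar>pmf p a - pmf q a\<bar>) \<le> (\<Sum>a\<in>A. pmf p a + pmf q a)"
    by (intro sum_mono) (auto simp: abs_le_iff intro: add_increasing add_increasing2)
  also have "\<dots> = 2" using * by (simp add: sum.distrib sum_pmf_eq_1)
  finally show ?thesis using * by (simp add: tv_dist_sum[of A])
qed

lemma pmf_diff_le_tv_dist:
  assumes "fins p" "fins q"
  shows "\<bar>pmf p a - pmf q a\<bar> \<le> 2 * tv_dist p q"
proof -
  define A where "A = insert a (set_pmf p \<union> set_pmf q)"
  have *: "finite A" "set_pmf p \<subseteq> A" "set_pmf q \<subseteq> A" "a \<in> A" using assms by (auto simp: A_def)
  have "\<bar>pmf p a - pmf q a\<bar> \<le> (\<Sum>a\<in>A. \<bar>pmf p a - pmf q a\<bar>)"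
    using * by (intro member_le_sum) auto
  then show ?thesis using * by (simp add: tv_dist_sum[of A])
qed

text \<open>Data processing: the triangle inequality inside the sum, and each \<open>f a\<close> has
  mass 1.\<close>

lemma tv_dist_bind_le:
  assumes "fins p" "fins q" "\<And>a. a \<in> set_pmf p \<union> set_pmf q \<Longrightarrow> fins (f a)"
  shows "tv_dist (bind_pmf p f) (bind_pmf q f) \<le> tv_dist p q"
proof -
  define A where "A = set_pmf p \<union> set_pmf q"
  define B where "B = (\<Union>a\<in>A. set_pmf (f a))"
  have *: "finite A" "set_pmf p \<subseteq> A" "set_pmf q \<subseteq> A" using assms by (auto simp: A_def)
  have B: "finite B" "set_pmf (bind_pmf p f) \<subseteq> B" "set_pmf (bind_pmf q f) \<subseteq> B"
    using assms * by (auto simp: B_def A_def)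
  have e: "pmf (bind_pmf p f) b - pmf (bind_pmf q f) b = (\<Sum>a\<in>A. (pmf p a - pmf q a) * pmf (f a) b)" for b
    using assms by (simp add: pmf_bind_pex pex_superset[OF *(1,2)] pex_superset[OF *(1,3)] sum_subtractf left_diff_distrib)
  have "(\<Sum>b\<in>B. \<bar>pmf (bind_pmf p f) b - pmf (bind_pmf q f) b\<bar>)
      \<le> (\<Sum>b\<in>B. \<Sum>a\<in>A. \<bar>pmf p a - pmf q a\<bar> * pmf (f a) b)"
    unfolding e by (intro sum_mono order_trans[OF sum_abs]) (simp add: abs_mult)
  also have "\<dots> = (\<Sum>a\<in>A. \<bar>pmf p a - pmf q a\<bar> * (\<Sum>b\<in>B. pmf (f a) b))"
    by (subst sum.swap) (simp add: sum_distrib_left)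
  also have "\<dots> = (\<Sum>a\<in>A. \<bar>pmf p a - pmf q a\<bar>)"
    by (intro sum.cong refl) (subst sum_pmf_eq_1, use B in \<open>auto simp: B_def\<close>)
  finally show ?thesis by (simp add: tv_dist_sum[OF *] tv_dist_sum[OF B])
qed

lemma tv_dist_map_le:
  assumes "fins p" "fins q"
  shows "tv_dist (map_pmf f p) (map_pmf f q) \<le> tv_dist p q"
  unfolding map_pmf_def by (rule tv_dist_bind_le) (use assms in auto)

text \<open>Only inputs on which the two kernels disagree contribute, each at most its probability
  because a distance never exceeds 1. With decoding as second stage the bound is an error
  probability.\<close>

lemma tv_dist_bind_same:
  assumes "fins r" "\<And>a. a \<in> set_pmf r \<Longrightarrow> fins (f a)" "\<And>a. a \<in> set_pmf r \<Longrightarrow> fins (g a)"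
  shows "tv_dist (bind_pmf r f) (bind_pmf r g) \<le> pex r (\<lambda>a. of_bool (f a \<noteq> g a))"
proof -
  define A where "A = set_pmf r"
  define B where "B = (\<Union>a\<in>A. set_pmf (f a) \<union> set_pmf (g a))"
  have B: "finite B" "set_pmf (bind_pmf r f) \<subseteq> B" "set_pmf (bind_pmf r g) \<subseteq> B"
    using assms by (auto simp: B_def A_def)
  have e: "pmf (bind_pmf r f) b - pmf (bind_pmf r g) b = (\<Sum>a\<in>A. pmf r a * (pmf (f a) b - pmf (g a) b))" for b
    using assms by (simp add: pmf_bind_pex pex_def A_def sum_subtractf right_diff_distrib)
  have "(\<Sum>b\<in>B. \<bar>pmf (bind_pmf r f) b - pmf (bind_pmf r g) b\<bar>)
      \<le> (\<Sum>b\<in>B. \<Sum>a\<in>A. pmf r a * \<bar>pmf (f a) b - pmf (g a) b\<bar>)"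
    unfolding e by (intro sum_mono order_trans[OF sum_abs]) (simp add: abs_mult)
  also have "\<dots> = (\<Sum>a\<in>A. pmf r a * (\<Sum>b\<in>B. \<bar>pmf (f a) b - pmf (g a) b\<bar>))"
    by (subst sum.swap) (simp add: sum_distrib_left)
  also have "\<dots> \<le> (\<Sum>a\<in>A. pmf r a * (2 * of_bool (f a \<noteq> g a)))"
  proof (intro sum_mono mult_left_mono)
    fix a assume a: "a \<in> A"
    have "(\<Sum>b\<in>B. \<bar>pmf (f a) b - pmf (g a) b\<bar>) = 2 * tv_dist (f a) (g a)"
      using a B by (subst tv_dist_sum[of B]) (auto simp: B_def)
    also have "\<dots> \<le> 2 * of_bool (f a \<noteq> g a)"
      using tv_dist_le_1[of "f a" "g a"] assms a by (cases "f a = g a") (auto simp: A_def)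
    finally show "(\<Sum>b\<in>B. \<bar>pmf (f a) b - pmf (g a) b\<bar>) \<le> 2 * of_bool (f a \<noteq> g a)" .
  qed auto
  also have "\<dots> = 2 * pex r (\<lambda>a. of_bool (f a \<noteq> g a))"
    by (simp add: pex_def A_def sum_distrib_left mult_ac)
  finally show ?thesis by (simp add: tv_dist_sum[OF B])
qed

subsection \<open>Entropy\<close>

definition eta :: "real \<Rightarrow> real" where "eta t = - (t * log 2 t)"

definition ent :: "'a pmf \<Rightarrow> real" where "ent p = (\<Sum>a\<in>set_pmf p. eta (pmf p a))"

definition entf :: "'s pmf \<Rightarrow> ('s \<Rightarrow> 'a) \<Rightarrow> real" where "entf P f = ent (map_pmf f P)"

lemma eta_0 [simp]: "eta 0 = 0" by (simp add: eta_def)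

lemma eta_1 [simp]: "eta 1 = 0" by (simp add: eta_def)

lemma ent_superset:
  assumes "finite A" "set_pmf p \<subseteq> A"
  shows "ent p = (\<Sum>a\<in>A. eta (pmf p a))"
  unfolding ent_def by (rule sum.mono_neutral_left) (use assms in \<open>auto simp: set_pmf_iff\<close>)

lemma ent_pex: "ent p = pex p (\<lambda>a. - log 2 (pmf p a))"
  by (simp add: ent_def pex_def eta_def)

lemma entf_pex:
  assumes "fins P"
  shows "entf P f = pex P (\<lambda>s. - log 2 (pmf (map_pmf f P) (f s)))"
  using assms by (simp add: entf_def ent_pex pex_map)

lemma ent_map_inj:
  assumes "inj_on f (set_pmf p)"
  shows "ent (map_pmf f p) = ent p"
  unfolding ent_def using assms by (simp add: sum.reindex pmf_map_inj)

text \<open>Entropy sees only the partition of the support into level sets. Most rearrangements of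
  tuples inside entropies go through this lemma.\<close>

lemma entf_cong_iff:
  assumes "\<And>s t. s \<in> set_pmf P \<Longrightarrow> t \<in> set_pmf P \<Longrightarrow> f s = f t \<longleftrightarrow> g s = g t"
  shows "entf P f = entf P g"
proof -
  \<comment> \<open>\<open>k\<close> sends a value of \<open>f\<close> to the value of
    \<open>g\<close> on the same level set.\<close>
  define k where "k a = g (SOME s. s \<in> set_pmf P \<and> f s = a)" for a
  have k: "k (f s) = g s" if "s \<in> set_pmf P" for s
  proof -
    have "(SOME t. t \<in> set_pmf P \<and> f t = f s) \<in> set_pmf P \<and> f (SOME t. t \<in> set_pmf P \<and> f t = f s) = f s"
      by (rule someI[of _ s]) (use that in auto)
    then show ?thesis using assms that unfolding k_def by blast
  qed
  have "map_pmf g P = map_pmf k (map_pmf f P)"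
    unfolding map_pmf_comp by (rule map_pmf_cong) (auto simp: k)
  moreover have "inj_on k (set_pmf (map_pmf f P))"
    using assms k by (auto simp: inj_on_def)
  ultimately show ?thesis unfolding entf_def by (simp add: ent_map_inj)
qed

section \<open>Gibbs' inequality and conditional mutual information\<close>

text \<open>This is ln t \<le> t - 1 at t = q / p, where equality forces t = 1. Keeping the
  difference \<open>p - q\<close> allows total masses other than 1.\<close>

lemma gibbs_aux:
  fixes p q :: real
  assumes "0 \<le> p" "0 \<le> q" "0 < p \<Longrightarrow> 0 < q"
  shows "p - q \<le> p * ln (p / q)" "p * ln (p / q) = p - q \<Longrightarrow> p = q"
proof -
  have *: "p - q \<le> p * ln (p / q) \<and> (p * ln (p / q) = p - q \<longrightarrow> p = q)"
  proof (cases "p = 0")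
    case False
    then have p: "0 < p" "0 < q" using assms by auto
    have l: "ln (p / q) = - ln (q / p)" using p by (simp add: ln_div)
    have "ln (q / p) \<le> q / p - 1" using p by (intro ln_le_minus_one) auto
    then have "p * ln (q / p) \<le> p * (q / p - 1)" using p by (intro mult_left_mono) auto
    moreover have e: "p * (q / p - 1) = q - p" using p by (simp add: field_simps)
    ultimately have 1: "p - q \<le> p * ln (p / q)" using l by simp
    have "p = q" if "p * ln (p / q) = p - q"
    proof -
      have "p * ln (q / p) = p * (q / p - 1)" using that l e by simp
      then have "ln (q / p) = q / p - 1" using p by auto
      then have "q / p = 1" using p by (intro ln_eq_minus_one) auto
      then show ?thesis using p by simp
    qed
    then show ?thesis using 1 by auto
  qed (use assms in auto)
  then show "p - q \<le> p * ln (p / q)" "p * ln (p / q) = p - q \<Longrightarrow> p = q" by auto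
qed

text \<open>Stated for weights rather than probabilities because \<open>fannes\<close> compares
  excess mass with a uniform weight of the same mass.\<close>

lemma gibbs:
  fixes p q :: "'a \<Rightarrow> real"
  assumes "finite S" "\<And>a. a \<in> S \<Longrightarrow> 0 \<le> p a" "\<And>a. a \<in> S \<Longrightarrow> 0 \<le> q a"
    "\<And>a. a \<in> S \<Longrightarrow> 0 < p a \<Longrightarrow> 0 < q a" "sum q S \<le> sum p S"
  shows "0 \<le> (\<Sum>a\<in>S. p a * log 2 (p a / q a))"
    and "(\<Sum>a\<in>S. p a * log 2 (p a / q a)) \<le> 0 \<Longrightarrow> a \<in> S \<Longrightarrow> p a = q a"
proof -
  have e: "(\<Sum>a\<in>S. p a * log 2 (p a / q a)) = (\<Sum>a\<in>S. p a * ln (p a / q a)) / ln 2"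
    by (simp add: log_def sum_divide_distrib)
  have "(\<Sum>a\<in>S. p a - q a) \<le> (\<Sum>a\<in>S. p a * ln (p a / q a))"
    using assms by (intro sum_mono gibbs_aux) auto
  then have "0 \<le> (\<Sum>a\<in>S. p a * ln (p a / q a))" using assms by (simp add: sum_subtractf)
  then show "0 \<le> (\<Sum>a\<in>S. p a * log 2 (p a / q a))" unfolding e by simp
  assume le: "(\<Sum>a\<in>S. p a * log 2 (p a / q a)) \<le> 0" and a: "a \<in> S"
  then have le': "(\<Sum>a\<in>S. p a * ln (p a / q a)) \<le> 0" unfolding e by (simp add: divide_le_0_iff del: sum_nonneg_eq_0_iff)
  \<comment> \<open>Every slack is nonnegative and their sum is at most 0, so each one vanishes and
    the equality case of \<open>gibbs_aux\<close> applies.\<close>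
  have n: "\<And>a. a \<in> S \<Longrightarrow> 0 \<le> p a * ln (p a / q a) - (p a - q a)"
    using assms gibbs_aux(1) by (simp add: algebra_simps)
  have "(\<Sum>a\<in>S. p a * ln (p a / q a) - (p a - q a)) \<le> 0"
    using le' assms by (simp add: sum_subtractf)
  then have "(\<Sum>a\<in>S. p a * ln (p a / q a) - (p a - q a)) = 0"
    using n by (intro antisym sum_nonneg) auto
  then have "p a * ln (p a / q a) - (p a - q a) = 0"
    using sum_nonneg_eq_0_iff[OF assms(1), of "\<lambda>a. p a * ln (p a / q a) - (p a - q a)"] n a by simp
  then show "p a = q a" using assms a gibbs_aux(2)[of "p a" "q a"] by auto
qed

lemma ent_le_log_card:
  assumes "finite A" "set_pmf p \<subseteq> A"
  shows "ent p \<le> log 2 (card A)"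
proof -
  have A: "A \<noteq> {}" using assms set_pmf_not_empty[of p] by auto
  then have c: "0 < card A" using assms by (simp add: card_gt_0_iff)
  have "0 \<le> (\<Sum>a\<in>A. pmf p a * log 2 (pmf p a / (1 / card A)))"
    by (rule gibbs(1)) (use assms c in \<open>auto simp: sum_pmf_eq_1\<close>)
  also have "\<dots> = (\<Sum>a\<in>A. pmf p a * log 2 (card A) - eta (pmf p a))"
  proof (rule sum.cong[OF refl])
    fix a
    show "pmf p a * log 2 (pmf p a / (1 / card A)) = pmf p a * log 2 (card A) - eta (pmf p a)"
      using c by (cases "pmf p a = 0") (auto simp: eta_def log_mult algebra_simps)
  qed
  also have "\<dots> = log 2 (card A) - ent p"
    using assms by (simp add: sum_subtractf ent_superset sum_distrib_right[symmetric] sum_pmf_eq_1)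
  finally show ?thesis by simp
qed

text \<open>The chain rule H(I,A) = H(I) + H(A|I).\<close>

lemma ent_bind_Pair:
  assumes "fins p" "\<And>i. i \<in> set_pmf p \<Longrightarrow> fins (V i)"
  shows "ent (bind_pmf p (\<lambda>i. map_pmf (Pair i) (V i))) = ent p + pex p (\<lambda>i. ent (V i))"
proof -
  let ?Q = "bind_pmf p (\<lambda>i. map_pmf (Pair i) (V i))"
  have pm: "pmf ?Q (i, a) = pmf p i * pmf (V i) a" for i a
    by (rule pmf_bind_Pair[OF assms(1)])
  have "ent ?Q = pex p (\<lambda>i. pex (V i) (\<lambda>a. - log 2 (pmf p i * pmf (V i) a)))"
    unfolding ent_pex using assms by (simp add: pex_bind pex_map pm cong: pex_cong)
  also have "\<dots> = pex p (\<lambda>i. pex (V i) (\<lambda>a. - log 2 (pmf p i) + - log 2 (pmf (V i) a)))"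
  proof (intro pex_cong)
    fix i a assume "i \<in> set_pmf p" "a \<in> set_pmf (V i)"
    then have "pmf p i > 0" "pmf (V i) a > 0" by (auto simp: pmf_positive)
    then show "- log 2 (pmf p i * pmf (V i) a) = - log 2 (pmf p i) + - log 2 (pmf (V i) a)"
      by (simp add: log_mult)
  qed
  also have "\<dots> = pex p (\<lambda>i. - log 2 (pmf p i) + ent (V i))"
    by (rule pex_cong) (simp only: pex_add pex_const[OF assms(2)] ent_pex)
  finally show ?thesis by (simp only: pex_add ent_pex)
qed

lemma cmi_eq_entf:
  assumes "fins P"
  shows "cmi P f g h = entf P (\<lambda>s. (f s, h s)) + entf P (\<lambda>s. (g s, h s))
      - entf P (\<lambda>s. (f s, g s, h s)) - entf P h"
proof -
  have "cmi P f g h = pex (map_pmf (\<lambda>s. (f s, g s, h s)) P) (\<lambda>(a,b,c).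
      log 2 (pmf (map_pmf (\<lambda>s. (f s, g s, h s)) P) (a,b,c) * pmf (map_pmf h P) c /
               (pmf (map_pmf (\<lambda>s. (f s, h s)) P) (a,c) * pmf (map_pmf (\<lambda>s. (g s, h s)) P) (b,c))))"
    unfolding cmi_def pex_def by (intro sum.cong) auto
  also have "\<dots> = pex P (\<lambda>s. (- log 2 (pmf (map_pmf (\<lambda>s. (f s, h s)) P) (f s,h s)))
     + (- log 2 (pmf (map_pmf (\<lambda>s. (g s, h s)) P) (g s,h s)))
     - (- log 2 (pmf (map_pmf (\<lambda>s. (f s, g s, h s)) P) (f s,g s,h s)))
     - (- log 2 (pmf (map_pmf h P) (h s))))"
    unfolding pex_map[OF assms]
  proof (rule pex_cong)
    fix s assume s: "s \<in> set_pmf P"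
    have "0 < pmf (map_pmf (\<lambda>s. (f s, h s)) P) (f s,h s)" "0 < pmf (map_pmf (\<lambda>s. (g s, h s)) P) (g s,h s)"
      "0 < pmf (map_pmf (\<lambda>s. (f s, g s, h s)) P) (f s,g s,h s)" "0 < pmf (map_pmf h P) (h s)"
      using s by (auto intro!: pmf_positive)
    then show "(case (f s, g s, h s) of (a,b,c) \<Rightarrow> log 2 (pmf (map_pmf (\<lambda>s. (f s, g s, h s)) P) (a,b,c) * pmf (map_pmf h P) c /
               (pmf (map_pmf (\<lambda>s. (f s, h s)) P) (a,c) * pmf (map_pmf (\<lambda>s. (g s, h s)) P) (b,c)))) =
       (- log 2 (pmf (map_pmf (\<lambda>s. (f s, h s)) P) (f s,h s)))
     + (- log 2 (pmf (map_pmf (\<lambda>s. (g s, h s)) P) (g s,h s)))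
     - (- log 2 (pmf (map_pmf (\<lambda>s. (f s, g s, h s)) P) (f s,g s,h s)))
     - (- log 2 (pmf (map_pmf h P) (h s)))"
      by (simp add: log_mult log_divide)
  qed
  also have "\<dots> = entf P (\<lambda>s. (f s, h s)) + entf P (\<lambda>s. (g s, h s))
      - entf P (\<lambda>s. (f s, g s, h s)) - entf P h"
    by (simp only: pex_add pex_diff entf_pex[OF assms])
  finally show ?thesis .
qed

text \<open>Conditional mutual information is the divergence of p(a,b,c) from p(a,c) p(b,c) / p(c).
  Gibbs' inequality gives its sign; the equality case gives the product form, which is the Markov
  condition with \<open>h\<close> in the middle.\<close>

lemma cmi_gibbs:
  assumes "fins P"
  shows cmi_nonneg: "0 \<le> cmi P f g h"
    and markov_if_cmi_le_0: "cmi P f g h \<le> 0 \<Longrightarrow> markov P f h g"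
proof -
  define A B C where "A = f ` set_pmf P" and "B = g ` set_pmf P" and "C = h ` set_pmf P"
  have fin: "finite A" "finite B" "finite C" using assms by (auto simp: A_def B_def C_def)
  define p where "p = pmf (map_pmf (\<lambda>s. (f s, g s, h s)) P)"
  define pac where "pac = pmf (map_pmf (\<lambda>s. (f s, h s)) P)"
  define pbc where "pbc = pmf (map_pmf (\<lambda>s. (g s, h s)) P)"
  define pc where "pc = pmf (map_pmf h P)"
  define q where "q = (\<lambda>(a,b,c). pac (a,c) * pbc (b,c) / pc c)"
  have dom: "p (a,b,c) \<noteq> 0 \<Longrightarrow> pac (a,c) \<noteq> 0 \<and> pbc (b,c) \<noteq> 0 \<and> pc c \<noteq> 0"
     "pac (a,c) \<noteq> 0 \<Longrightarrow> pc c \<noteq> 0 \<and> a \<in> A \<and> c \<in> C" "pbc (b,c) \<noteq> 0 \<Longrightarrow> pc c \<noteq> 0 \<and> b \<in> B \<and> c \<in> C" 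
     "p (a,b,c) \<noteq> 0 \<Longrightarrow> a \<in> A \<and> b \<in> B \<and> c \<in> C" "pc c \<noteq> 0 \<Longrightarrow> c \<in> C" for a b c
    by (auto simp: p_def pac_def pbc_def pc_def A_def B_def C_def simp flip: set_pmf_iff)
  have mac: "(\<Sum>a\<in>A. pac (a,c)) = pc c" for c
  proof -
    have "pc c = pmf (map_pmf snd (map_pmf (\<lambda>s. (f s, h s)) P)) c" by (simp add: pc_def map_pmf_comp)
    also have "\<dots> = (\<Sum>a\<in>A. pac (a,c))" unfolding pac_def
      by (rule pmf_map_snd_pair) (use fin in \<open>auto simp: A_def\<close>)
    finally show ?thesis ..
  qed
  have mbc: "(\<Sum>b\<in>B. pbc (b,c)) = pc c" for c
  proof -
    have "pc c = pmf (map_pmf snd (map_pmf (\<lambda>s. (g s, h s)) P)) c" by (simp add: pc_def map_pmf_comp)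
    also have "\<dots> = (\<Sum>b\<in>B. pbc (b,c))" unfolding pbc_def
      by (rule pmf_map_snd_pair) (use fin in \<open>auto simp: B_def\<close>)
    finally show ?thesis ..
  qed
  have pC: "sum pc C = 1" unfolding pc_def by (rule sum_pmf_eq_1) (use fin in \<open>auto simp: C_def\<close>)
  have p1: "sum p (A \<times> B \<times> C) = 1" unfolding p_def
    by (rule sum_pmf_eq_1) (use fin in \<open>auto simp: A_def B_def C_def\<close>)
  have "sum q (A \<times> B \<times> C) = (\<Sum>a\<in>A. \<Sum>b\<in>B. \<Sum>c\<in>C. pac (a,c) * pbc (b,c) / pc c)"
    unfolding q_def by (simp add: sum.cartesian_product)
  also have "\<dots> = (\<Sum>c\<in>C. \<Sum>a\<in>A. \<Sum>b\<in>B. pac (a,c) * pbc (b,c) / pc c)"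
    by (subst (2) sum.swap, subst sum.swap, rule refl)
  also have "\<dots> = (\<Sum>c\<in>C. (\<Sum>a\<in>A. pac (a,c)) * (\<Sum>b\<in>B. pbc (b,c)) / pc c)"
    by (simp add: sum_product sum_divide_distrib)
  also have "\<dots> = 1" by (simp add: mac mbc pC)
  finally have q1: "sum q (A \<times> B \<times> C) = 1" .
  have nn: "0 \<le> pac s" "0 \<le> pbc t" "0 \<le> pc c" for s t c by (auto simp: pac_def pbc_def pc_def)
  have g: "finite (A \<times> B \<times> C)" "\<And>a. a \<in> A \<times> B \<times> C \<Longrightarrow> 0 \<le> p a" "\<And>a. a \<in> A \<times> B \<times> C \<Longrightarrow> 0 \<le> q a"
    "\<And>a. a \<in> A \<times> B \<times> C \<Longrightarrow> 0 < p a \<Longrightarrow> 0 < q a" "sum q (A \<times> B \<times> C) \<le> sum p (A \<times> B \<times> C)"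
  proof -
    show "finite (A \<times> B \<times> C)" using fin by auto
    show "\<And>a. a \<in> A \<times> B \<times> C \<Longrightarrow> 0 \<le> p a" by (simp add: p_def)
    show "\<And>a. a \<in> A \<times> B \<times> C \<Longrightarrow> 0 \<le> q a" using nn by (auto simp: q_def)
    show "0 < q s" if "0 < p s" for s
      using that dom(1) nn by (cases s) (fastforce simp: q_def less_le)
  qed (simp add: p1 q1)
  have c: "cmi P f g h = (\<Sum>a\<in>A \<times> B \<times> C. p a * log 2 (p a / q a))"
  proof -
    have "cmi P f g h = (\<Sum>a\<in>set_pmf (map_pmf (\<lambda>s. (f s, g s, h s)) P). p a * log 2 (p a / q a))"
      unfolding cmi_def p_def q_def pac_def pbc_def pc_def by (intro sum.cong) auto
    also have "\<dots> = (\<Sum>a\<in>A \<times> B \<times> C. p a * log 2 (p a / q a))"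
      by (rule sum.mono_neutral_left) (use fin in \<open>auto simp: p_def A_def B_def C_def pmf_eq_0_set_pmf\<close>)
    finally show ?thesis .
  qed
  show "0 \<le> cmi P f g h" unfolding c by (rule gibbs(1)[OF g])
  assume le: "cmi P f g h \<le> 0"
  \<comment> \<open>\<open>gibbs\<close> compares the weights only on the finite box; outside it
    both sides are 0.\<close>
  have eq: "p (a,b,c) = q (a,b,c)" for a b c
  proof (cases "(a,b,c) \<in> A \<times> B \<times> C")
    case True
    then show ?thesis using gibbs(2)[OF g] le c by auto
  next
    case False
    then have "p (a,b,c) = 0" "pac (a,c) = 0 \<or> pbc (b,c) = 0" using dom(2)[of a c] dom(3)[of b c] dom(4)[of a b c] by auto
    then show ?thesis by (auto simp: q_def)
  qed
  show "markov P f h g" unfolding markov_def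
  proof (intro allI)
    fix a c b
    have 1: "pmf (map_pmf (\<lambda>s. (f s, h s, g s)) P) (a, c, b) = p (a,b,c)"
      unfolding p_def by (rule pmf_map_cong_iff) auto
    have 2: "pmf (map_pmf (\<lambda>s. (h s, g s)) P) (c, b) = pbc (b,c)"
      unfolding pbc_def by (rule pmf_map_cong_iff) auto
    have "p (a,b,c) * pc c = pac (a,c) * pbc (b,c)"
      using eq[of a b c] dom(2)[of a c] by (auto simp: q_def)
    then show "pmf (map_pmf (\<lambda>s. (f s, h s, g s)) P) (a, c, b) * pmf (map_pmf h P) c =
       pmf (map_pmf (\<lambda>s. (f s, h s)) P) (a, c) * pmf (map_pmf (\<lambda>s. (h s, g s)) P) (c, b)"
      unfolding 1 2 by (simp add: pc_def pac_def)
  qed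
qed

text \<open>Under the Markov condition each ratio in \<open>cmi\<close> has equal numerator and
  denominator, so each logarithm is 0.\<close>

lemma cmi_eq_0_if_markov:
  assumes "markov P f h g"
  shows "cmi P f g h = 0"
proof -
  have "pmf (map_pmf (\<lambda>s. (f s, g s, h s)) P) (a,b,c) * pmf (map_pmf h P) c =
               (pmf (map_pmf (\<lambda>s. (f s, h s)) P) (a,c) * pmf (map_pmf (\<lambda>s. (g s, h s)) P) (b,c))" for a b c
  proof -
    have 1: "pmf (map_pmf (\<lambda>s. (f s, h s, g s)) P) (a, c, b) = pmf (map_pmf (\<lambda>s. (f s, g s, h s)) P) (a,b,c)"
      by (rule pmf_map_cong_iff) auto
    have 2: "pmf (map_pmf (\<lambda>s. (h s, g s)) P) (c, b) = pmf (map_pmf (\<lambda>s. (g s, h s)) P) (b,c)"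
      by (rule pmf_map_cong_iff) auto
    show ?thesis using assms unfolding markov_def 1[symmetric] 2[symmetric] by blast
  qed
  then show ?thesis unfolding cmi_def
    by (intro sum.neutral) (auto simp: log_def)
qed

text \<open>Strong subadditivity: \<open>cmi_nonneg\<close> written in entropies. It is the form in
  which "conditioning reduces entropy" is used later.\<close>

lemma entf_ssa:
  assumes "fins P"
  shows "entf P (\<lambda>s. (f s, g s, h s)) + entf P h \<le> entf P (\<lambda>s. (f s, h s)) + entf P (\<lambda>s. (g s, h s))"
  using cmi_nonneg[OF assms, of f g h] unfolding cmi_eq_entf[OF assms] by simp

text \<open>Strong subadditivity given a constant variable.\<close>

lemma entf_subadd:
  assumes "fins P"
  shows "entf P (\<lambda>s. (f s, g s)) \<le> entf P f + entf P g"
proof -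
  have "entf P (\<lambda>s. (f s, g s, ())) = entf P (\<lambda>s. (f s, g s))" "entf P (\<lambda>s. (f s, ())) = entf P f"
    "entf P (\<lambda>s. (g s, ())) = entf P g" by (rule entf_cong_iff; auto)+
  moreover have "entf P (\<lambda>s. ()) = 0" by (simp add: entf_def ent_def)
  ultimately show ?thesis using entf_ssa[OF assms, of f g "\<lambda>_. ()"] by simp
qed

lemma entf_mono:
  assumes "fins P" "\<And>s t. s \<in> set_pmf P \<Longrightarrow> t \<in> set_pmf P \<Longrightarrow> g s = g t \<Longrightarrow> f s = f t"
  shows "entf P f \<le> entf P g"
  unfolding entf_pex[OF assms(1)]
proof (rule pex_mono)
  fix s assume s: "s \<in> set_pmf P"
  have "pmf (map_pmf g P) (g s) \<le> pmf (map_pmf f P) (f s)"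
    unfolding pmf_map_pex[OF assms(1)]
  proof (rule pex_mono)
    fix t assume "t \<in> set_pmf P"
    then show "of_bool (g t = g s) \<le> (of_bool (f t = f s) :: real)"
      using assms(2)[of t s] s by (cases "g t = g s") simp_all
  qed
  moreover have "0 < pmf (map_pmf g P) (g s)" using s by (intro pmf_positive) auto
  ultimately show "- log 2 (pmf (map_pmf f P) (f s)) \<le> - log 2 (pmf (map_pmf g P) (g s))"
    by simp
qed

section \<open>Continuity of entropy in total variation\<close>

lemma eta_add_le:
  assumes "0 \<le> a" "0 \<le> b"
  shows "eta (a + b) \<le> eta a + eta b"
proof (cases "a = 0 \<or> b = 0")
  case False
  then have "0 < a" "0 < b" using assms by auto
  then have "a * log 2 a \<le> a * log 2 (a + b)" "b * log 2 b \<le> b * log 2 (a + b)"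
    by (auto intro!: mult_left_mono)
  then show ?thesis by (simp add: eta_def algebra_simps)
qed auto

text \<open>On (0,1] the slope of \<open>eta\<close> is at least - 1 / ln 2, so adding
  \<open>a\<close> lowers \<open>eta\<close> by at most \<open>a / ln 2\<close>.\<close>

lemma eta_diff_le:
  assumes "0 \<le> m" "0 \<le> a" "m + a \<le> 1"
  shows "eta m - eta (m + a) \<le> a / ln 2"
proof (cases "m = 0")
  case True
  show ?thesis
  proof (cases "a = 0")
    case False
    then have "log 2 a \<le> 0" using assms True by (simp)
    then have "a * log 2 a \<le> 0" using assms by (simp add: mult_nonneg_nonpos)
    also have "0 \<le> a / ln 2" using assms by simp
    finally show ?thesis using True by (simp add: eta_def)
  qed (use True in auto)
next
  case False
  then have m: "0 < m" using assms by auto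
  have "ln ((m + a) / m) \<le> (m + a) / m - 1" using m assms by (intro ln_le_minus_one) auto
  then have "m * ln ((m + a) / m) \<le> m * ((m + a) / m - 1)" using m by (intro mult_left_mono) auto
  also have "\<dots> = a" using m by (simp add: field_simps)
  finally have 1: "m * (ln (m + a) - ln m) \<le> a" using m assms by (simp add: ln_div)
  have "ln (m + a) \<le> 0" using m assms by (simp)
  then have "a * ln (m + a) \<le> 0" using assms by (simp add: mult_nonneg_nonpos)
  then have "(m + a) * ln (m + a) - m * ln m \<le> a" using 1 by (simp add: algebra_simps)
  then have "((m + a) * ln (m + a) - m * ln m) / ln 2 \<le> a / ln 2" by (intro divide_right_mono) auto
  then show ?thesis by (simp add: eta_def log_def diff_divide_distrib add_divide_distrib)
qed

text \<open>Both laws are the common part \<open>m\<close> plus excesses \<open>d\<close> and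
  \<open>b\<close> of mass T. Subadditivity of \<open>eta\<close> splits off \<open>b\<close>;
  passing from \<open>m\<close> back to \<open>p\<close> costs T / ln 2; Gibbs' inequality against a
  uniform weight of mass T bounds the contribution of \<open>b\<close>. The additive constant is
  independent of \<open>A\<close>, so it disappears after division by the block length.\<close>

lemma fannes:
  assumes "finite A" "set_pmf p \<subseteq> A" "set_pmf q \<subseteq> A"
  shows "ent q \<le> ent p + tv_dist p q * log 2 (card A) + 2"
proof -
  define T where "T = tv_dist p q"
  define N where "N = real (card A)"
  define m where "m a = min (pmf p a) (pmf q a)" for a
  define b where "b a = pmf q a - m a" for a
  define d where "d a = pmf p a - m a" for a
  have "A \<noteq> {}" using assms set_pmf_not_empty[of p] by auto
  then have N: "1 \<le> N" using assms by (simp add: N_def Suc_le_eq card_gt_0_iff)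
  have nn: "0 \<le> m a" "0 \<le> b a" "0 \<le> d a" for a by (auto simp: m_def b_def d_def)
  have T01: "0 \<le> T" "T \<le> 1" unfolding T_def using assms
    by (auto intro!: tv_dist_nonneg tv_dist_le_1 intro: finite_subset)
  have "(\<Sum>a\<in>A. b a + d a) = (\<Sum>a\<in>A. \<bar>pmf p a - pmf q a\<bar>)"
    by (intro sum.cong) (auto simp: b_def d_def m_def)
  also have "\<dots> = 2 * T" unfolding T_def using assms by (simp add: tv_dist_sum)
  finally have s1: "sum b A + sum d A = 2 * T" by (simp add: sum.distrib)
  have s2: "sum b A - sum d A = 0"
    using assms by (simp add: b_def d_def sum_subtractf sum_pmf_eq_1)
  have sb: "sum b A = T" and sd: "sum d A = T" using s1 s2 by auto
  have "ent q = (\<Sum>a\<in>A. eta (m a + b a))" using assms by (simp add: ent_superset b_def)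
  also have "\<dots> \<le> (\<Sum>a\<in>A. eta (m a) + eta (b a))" by (intro sum_mono eta_add_le nn)
  also have "\<dots> = (\<Sum>a\<in>A. eta (m a)) + (\<Sum>a\<in>A. eta (b a))" by (rule sum.distrib)
  also have "(\<Sum>a\<in>A. eta (m a)) \<le> (\<Sum>a\<in>A. eta (pmf p a) + d a / ln 2)"
  proof (rule sum_mono)
    fix a
    have "eta (m a) - eta (m a + d a) \<le> d a / ln 2"
      by (rule eta_diff_le) (use nn in \<open>auto simp: d_def pmf_le_1\<close>)
    then show "eta (m a) \<le> eta (pmf p a) + d a / ln 2" by (simp add: d_def)
  qed
  also have "\<dots> = ent p + T / ln 2"
    using assms by (simp add: sum.distrib ent_superset sum_divide_distrib[symmetric] sd)
  also have "(\<Sum>a\<in>A. eta (b a)) \<le> T * log 2 N + (1 - T) / ln 2"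
  proof (cases "T = 0")
    case True
    then have "b a = 0" if "a \<in> A" for a using that sum_nonneg_eq_0_iff[of A b] sb nn assms by auto
    then show ?thesis using True by simp
  next
    case False
    then have T: "0 < T" using T01 by auto
    have "0 \<le> (\<Sum>a\<in>A. b a * log 2 (b a / (T / N)))"
      by (rule gibbs(1)) (use assms N T nn in \<open>auto simp: sb N_def\<close>)
    also have "\<dots> = (\<Sum>a\<in>A. b a * (log 2 N - log 2 T) - eta (b a))"
    proof (rule sum.cong[OF refl])
      fix a
      show "b a * log 2 (b a / (T / N)) = b a * (log 2 N - log 2 T) - eta (b a)"
        using N T nn[of a] by (cases "b a = 0") (auto simp: eta_def log_mult log_divide algebra_simps)
    qed
    also have "\<dots> = T * (log 2 N - log 2 T) - (\<Sum>a\<in>A. eta (b a))"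
      by (simp add: sum_subtractf sum_distrib_right[symmetric] sb)
    finally have "(\<Sum>a\<in>A. eta (b a)) \<le> T * log 2 N - T * log 2 T" by (simp add: algebra_simps)
    moreover have "- (T * log 2 T) \<le> (1 - T) / ln 2"
    proof -
      have "ln (1 / T) \<le> 1 / T - 1" using T by (intro ln_le_minus_one) auto
      then have "T * ln (1 / T) \<le> T * (1 / T - 1)" using T by (intro mult_left_mono) auto
      then have "- (T * ln T) \<le> 1 - T" using T by (simp add: ln_div algebra_simps)
      then have "- (T * ln T) / ln 2 \<le> (1 - T) / ln 2" by (intro divide_right_mono) auto
      then show ?thesis by (simp add: log_def)
    qed
    ultimately show ?thesis by simp
  qed
  finally have "ent q \<le> ent p + T * log 2 N + (T / ln 2 + (1 - T) / ln 2)" by simp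
  also have "T / ln 2 + (1 - T) / ln 2 = 1 / ln 2" by (simp add: field_simps)
  \<comment> \<open>The terms free of \<open>A\<close> add up to 1 / ln 2, rounded up to 2.\<close>
  also have "1 / ln (2::real) \<le> 2" using ln2_ge_two_thirds by (simp add: field_simps)
  finally show ?thesis by (simp add: T_def N_def)
qed

text \<open>The image of \<open>A\<close> under \<open>f\<close> has at most as many points as
  \<open>A\<close>, so one alphabet bound serves every function of the variables.\<close>

lemma entf_fannes:
  assumes "finite A" "set_pmf p \<subseteq> A" "set_pmf q \<subseteq> A" "tv_dist p q \<le> t" "0 \<le> t"
  shows "entf q f \<le> entf p f + t * log 2 (card A) + 2"
proof -
  have fin: "fins p" "fins q" using assms finite_subset by auto
  have "A \<noteq> {}" using assms set_pmf_not_empty[of p] by auto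
  then have c: "0 < card (f ` A)" using assms by (auto simp: card_gt_0_iff)
  have "entf q f \<le> entf p f + tv_dist (map_pmf f p) (map_pmf f q) * log 2 (card (f ` A)) + 2"
    unfolding entf_def by (rule fannes) (use assms in auto)
  also have "tv_dist (map_pmf f p) (map_pmf f q) * log 2 (card (f ` A)) \<le> t * log 2 (card A)"
    using assms c card_image_le[of A f] tv_dist_map_le[of p q f] fin by (intro mult_mono) auto
  finally show ?thesis by simp
qed

subsection \<open>Product distributions\<close>

lemma seq_pmf_Cons_map: "seq_pmf (p # ps) = map_pmf (\<lambda>(a, as). a # as) (pair_pmf p (seq_pmf ps))"
  by (simp add: pair_pmf_def map_bind_pmf)

lemma set_seq_pmf: "set_pmf (seq_pmf ps) = {as. list_all2 (\<lambda>a p. a \<in> set_pmf p) as ps}"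
  by (induction ps) (auto simp: list_all2_Cons2)

lemma length_seq_pmf: "as \<in> set_pmf (seq_pmf ps) \<Longrightarrow> length as = length ps"
  by (auto simp: set_seq_pmf dest: list_all2_lengthD)

lemma fins_seq_pmf: "(\<And>p. p \<in> set ps \<Longrightarrow> fins p) \<Longrightarrow> fins (seq_pmf ps)"
  by (induction ps) auto

abbreviation iid :: "nat \<Rightarrow> 'a pmf \<Rightarrow> 'a list pmf" where
  "iid n p \<equiv> seq_pmf (replicate n p)"

lemma fins_seq_replicate: "fins p \<Longrightarrow> fins (iid n p)"
  by (rule fins_seq_pmf) auto

lemma set_seq_replicate: "as \<in> set_pmf (iid n p) \<Longrightarrow> a \<in> set as \<Longrightarrow> a \<in> set_pmf p"
  by (auto simp: set_seq_pmf list_all2_conv_all_nth in_set_conv_nth)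

lemma seq_pmf_map: "seq_pmf (map (\<lambda>u. map_pmf h (f u)) us) = map_pmf (map h) (seq_pmf (map f us))"
  by (induction us) (simp_all add: map_bind_pmf bind_map_pmf)

lemma pmf_seq_pmf_Cons: "pmf (seq_pmf (p # ps)) (a # as) = pmf p a * pmf (seq_pmf ps) as"
proof -
  have "pmf (seq_pmf (p # ps)) (a # as) = pmf (map_pmf (\<lambda>(a, as). a # as) (pair_pmf p (seq_pmf ps))) ((\<lambda>(a, as). a # as) (a, as))"
    unfolding seq_pmf_Cons_map by simp
  also have "\<dots> = pmf p a * pmf (seq_pmf ps) as"
    by (subst pmf_map_inj') (auto simp: inj_def pmf_pair)
  finally show ?thesis .
qed

lemma ent_pair_pmf:
  assumes "fins p" "fins q"
  shows "ent (pair_pmf p q) = ent p + ent q"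
  using ent_bind_Pair[of p "\<lambda>_. q"] assms by (simp add: pair_pmf_def map_pmf_def pex_const)

lemma ent_seq_pmf:
  "(\<And>p. p \<in> set ps \<Longrightarrow> fins p) \<Longrightarrow> ent (seq_pmf ps) = sum_list (map ent ps)"
proof (induction ps)
  case (Cons p ps)
  have "ent (seq_pmf (p # ps)) = ent (pair_pmf p (seq_pmf ps))"
    unfolding seq_pmf_Cons_map by (rule ent_map_inj) (auto simp: inj_on_def)
  then show ?case using Cons fins_seq_pmf[of ps] by (simp add: ent_pair_pmf)
qed (simp add: ent_def)

text \<open>Redrawing one coordinate of an i.i.d. list keeps its law. This isolates a letter: it
  yields the marginals of one and two coordinates, and the single-letter form of a code in
  \<open>letter_code_pmf\<close>.\<close>

lemma seq_pmf_resample: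
  assumes "i < n"
  shows "iid n p = bind_pmf (iid n p) (\<lambda>as. map_pmf (\<lambda>a. as[i := a]) p)"
  using assms
proof (induction n arbitrary: i)
  case (Suc n)
  show ?case
  proof (cases i)
    case 0
    show ?thesis unfolding 0
      by (simp add: bind_assoc_pmf bind_return_pmf map_pmf_def) (subst bind_commute_pmf, rule refl)
  next
    case (Suc j)
    have *: "bind_pmf (iid n p) (\<lambda>as. return_pmf (a # as))
       = bind_pmf (iid n p) (\<lambda>as. bind_pmf p (\<lambda>b. return_pmf (a # as[j := b])))" for a
      by (subst Suc.IH[of j]) (use Suc Suc.prems in \<open>simp_all add: bind_assoc_pmf bind_return_pmf map_pmf_def\<close>)
    show ?thesis unfolding Suc using *
      by (simp add: bind_assoc_pmf bind_return_pmf map_pmf_def)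
  qed
qed simp

lemma map_nth_seq_pmf:
  assumes "i < n"
  shows "map_pmf (\<lambda>as. as ! i) (iid n p) = p"
proof -
  have "map_pmf (\<lambda>as. as ! i) (iid n p)
    = bind_pmf (iid n p) (\<lambda>as. map_pmf (\<lambda>a. as[i := a] ! i) p)"
    by (subst seq_pmf_resample[OF assms]) (simp add: map_bind_pmf map_pmf_comp)
  also have "\<dots> = bind_pmf (iid n p) (\<lambda>as. p)"
    by (intro bind_pmf_cong refl map_pmf_idI) (use assms length_seq_pmf in fastforce)
  finally show ?thesis by simp
qed

lemma map_nth2_seq_pmf:
  assumes "i < n" "j < n" "i \<noteq> j"
  shows "map_pmf (\<lambda>as. (as ! i, as ! j)) (iid n p) = pair_pmf p p"
proof -
  have "map_pmf (\<lambda>as. (as ! i, as ! j)) (iid n p)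
    = bind_pmf (iid n p) (\<lambda>as. map_pmf (\<lambda>a. (as[i := a] ! i, as[i := a] ! j)) p)"
    by (subst seq_pmf_resample[OF assms(1)]) (simp add: map_bind_pmf map_pmf_comp)
  also have "\<dots> = bind_pmf (iid n p) (\<lambda>as. map_pmf (\<lambda>a. (a, as ! j)) p)"
    by (intro bind_pmf_cong refl map_pmf_cong) (use assms length_seq_pmf in fastforce)
  also have "\<dots> = bind_pmf (map_pmf (\<lambda>as. as ! j) (iid n p)) (\<lambda>b. map_pmf (\<lambda>a. (a, b)) p)"
    by (simp add: bind_map_pmf)
  also have "\<dots> = pair_pmf p p"
    unfolding map_nth_seq_pmf[OF assms(2)] by (simp only: pair_pmf_def map_pmf_def) (rule bind_commute_pmf)
  finally show ?thesis .
qed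

lemma pex_seq_pmf_Cons:
  assumes "fins p" "fins (seq_pmf ps)"
  shows "pex (seq_pmf (p # ps)) f = pex p (\<lambda>a. pex (seq_pmf ps) (\<lambda>as. f (a # as)))"
  using assms by (simp add: pex_bind)

lemma pex_sum_list_seq:
  assumes "fins p"
  shows "pex (iid n p) (\<lambda>as. sum_list (map f as)) = n * pex p f"
proof (induction n)
  case (Suc n)
  have "pex (iid (Suc n) p) (\<lambda>as. sum_list (map f as))
     = pex p (\<lambda>a. pex (iid n p) (\<lambda>as. f a + sum_list (map f as)))"
    unfolding replicate_Suc using assms by (subst pex_seq_pmf_Cons) (simp_all add: fins_seq_replicate)
  also have "\<dots> = pex p f + n * pex p f"
    using assms by (simp add: pex_add Suc pex_const fins_seq_replicate)
  finally show ?case by (simp add: algebra_simps)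
qed simp

text \<open>The cross terms vanish because the summands are independent and centred.\<close>

lemma pex_sum_list_sq_seq:
  assumes "fins p" "pex p f = 0"
  shows "pex (iid n p) (\<lambda>as. (sum_list (map f as))\<^sup>2) = n * pex p (\<lambda>a. (f a)\<^sup>2)"
proof (induction n)
  case (Suc n)
  let ?S = "iid n p" and ?F = "\<lambda>as. sum_list (map f as)"
  have "pex (iid (Suc n) p) (\<lambda>as. (?F as)\<^sup>2)
     = pex p (\<lambda>a. pex ?S (\<lambda>as. (f a)\<^sup>2 + 2 * f a * ?F as + (?F as)\<^sup>2))"
    unfolding replicate_Suc using assms
    by (subst pex_seq_pmf_Cons) (simp_all add: fins_seq_replicate power2_sum algebra_simps)
  also have "\<dots> = pex p (\<lambda>a. (f a)\<^sup>2) + n * pex p (\<lambda>a. (f a)\<^sup>2)"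
    using assms by (simp add: pex_add pex_cmult Suc pex_const fins_seq_replicate pex_sum_list_seq)
  finally show ?case by (simp add: algebra_simps)
qed simp

section \<open>A weak law of large numbers in mean\<close>

text \<open>With \<open>t\<close> left free, this bounds a first moment by a second moment without
  Cauchy-Schwarz.\<close>

lemma abs_le_young:
  fixes x t :: real
  assumes "0 < t"
  shows "\<bar>x\<bar> \<le> (x\<^sup>2 / t + t) / 2"
proof -
  have "0 \<le> (\<bar>x\<bar> - t)\<^sup>2" by simp
  then have "2 * t * \<bar>x\<bar> \<le> x\<^sup>2 + t * t" by (simp add: power2_eq_square algebra_simps)
  then show ?thesis using assms by (simp add: field_simps power2_eq_square)
qed

lemma pex_abs_sum_list_le:
  assumes "fins p" "pex p f = 0" "0 < t"
  shows "pex (iid n p) (\<lambda>as. \<bar>sum_list (map f as)\<bar>) \<le> (n * pex p (\<lambda>a. (f a)\<^sup>2) / t + t) / 2"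
proof -
  have "pex (iid n p) (\<lambda>as. \<bar>sum_list (map f as)\<bar>)
     \<le> pex (iid n p) (\<lambda>as. ((sum_list (map f as))\<^sup>2 / t + t) / 2)"
    by (intro pex_mono abs_le_young assms)
  also have "\<dots> = (n * pex p (\<lambda>a. (f a)\<^sup>2) / t + t) / 2"
    using assms by (simp add: pex_divide pex_add pex_const fins_seq_replicate pex_sum_list_sq_seq)
  finally show ?thesis .
qed

lemma lln_L1:
  fixes eps :: real
  assumes "fins p" "0 < eps"
  shows "eventually (\<lambda>n. pex (iid n p) (\<lambda>as. \<bar>sum_list (map f as) - n * pex p f\<bar>) \<le> n * eps) sequentially"
proof -
  define g where "g a = f a - pex p f" for a
  define v where "v = pex p (\<lambda>a. (g a)\<^sup>2)"
  have g0: "pex p g = 0" unfolding g_def pex_diff using assms by (simp add: pex_const)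
  have "eventually (\<lambda>n. v / eps\<^sup>2 \<le> real n) sequentially"
    by (rule eventually_sequentiallyI[of "nat \<lceil>v / eps\<^sup>2\<rceil>"]) linarith
  then show ?thesis using eventually_gt_at_top[of 0]
  proof eventually_elim
    case (elim n)
    have "pex (iid n p) (\<lambda>as. \<bar>sum_list (map f as) - n * pex p f\<bar>)
      = pex (iid n p) (\<lambda>as. \<bar>sum_list (map g as)\<bar>)"
    proof (rule pex_cong)
      fix as assume "as \<in> set_pmf (iid n p)"
      then have "length as = n" using length_seq_pmf by fastforce
      then show "\<bar>sum_list (map f as) - n * pex p f\<bar> = \<bar>sum_list (map g as)\<bar>"
        unfolding g_def by (simp add: sum_list_subtractf sum_list_triv)
    qed
    \<comment> \<open>The free parameter is \<open>n * eps\<close>; the first term falls below the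
      second once n \<ge> v / eps^2.\<close>
    also have "\<dots> \<le> (n * v / (n * eps) + n * eps) / 2"
      unfolding v_def by (rule pex_abs_sum_list_le) (use assms elim g0 in auto)
    also have "n * v / (n * eps) \<le> n * eps"
      using elim assms by (simp add: field_simps power2_eq_square)
    finally show ?case by (simp add: mult.commute)
  qed
qed

lemma pex_markov_ineq:
  assumes "0 < t" "\<And>a. a \<in> set_pmf p \<Longrightarrow> 0 \<le> f a"
  shows "pex p (\<lambda>a. of_bool (t \<le> f a)) \<le> pex p f / t"
  unfolding pex_divide[symmetric]
  by (rule pex_mono) (use assms in \<open>auto simp: of_bool_def\<close>)

lemma lln_prob:
  fixes eps dlt :: real
  assumes "fins p" "0 < eps" "0 < dlt"
  shows "eventually (\<lambda>n. pex (iid n p) (\<lambda>as. of_bool (n * dlt \<le> \<bar>sum_list (map f as) - n * pex p f\<bar>)) \<le> eps) sequentially"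
proof -
  have "0 < eps * dlt" using assms by simp
  from lln_L1[OF assms(1) this, of f] eventually_gt_at_top[of 0] show ?thesis
  proof eventually_elim
    case (elim n)
    have "pex (iid n p) (\<lambda>as. of_bool (n * dlt \<le> \<bar>sum_list (map f as) - n * pex p f\<bar>))
      \<le> pex (iid n p) (\<lambda>as. \<bar>sum_list (map f as) - n * pex p f\<bar>) / (n * dlt)"
      by (rule pex_markov_ineq) (use elim assms in auto)
    also have "\<dots> \<le> n * (eps * dlt) / (n * dlt)"
      by (rule divide_right_mono) (use elim assms in auto)
    also have "\<dots> = eps" using elim assms by simp
    finally show ?case .
  qed
qed

subsection \<open>Random codebooks\<close>

lemma pex_nth_seq:
  assumes "fins p" "i < n"
  shows "pex (iid n p) (\<lambda>as. f (as ! i)) = pex p f"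
  using pex_map[OF fins_seq_replicate[OF assms(1), of n], of "\<lambda>as. as ! i" f] map_nth_seq_pmf[OF assms(2), of p]
  by simp

lemma pex_nth2_seq:
  assumes "fins p" "i < n" "j < n" "i \<noteq> j"
  shows "pex (iid n p) (\<lambda>as. f (as ! i) (as ! j)) = pex p (\<lambda>a. pex p (\<lambda>b. f a b))"
proof -
  have "pex (iid n p) (\<lambda>as. f (as ! i) (as ! j)) = pex (pair_pmf p p) (\<lambda>(a,b). f a b)"
    using pex_map[OF fins_seq_replicate[OF assms(1), of n], of "\<lambda>as. (as ! i, as ! j)" "\<lambda>(a,b). f a b"]
      map_nth2_seq_pmf[OF assms(2-4), of p] by simp
  also have "\<dots> = pex p (\<lambda>a. pex p (\<lambda>b. f a b))"
    using assms by (simp add: pair_pmf_def pex_bind)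
  finally show ?thesis .
qed

text \<open>Each \<open>V u\<close> is split at likelihood ratio \<open>thr\<close>. The truncated
  part has second moment at most thr * P(w)^2, so averaging L independent codewords leaves a
  deviation of order sqrt (thr / L) * P(w). The remaining mass is counted twice, in the codebook
  average and in \<open>P\<close>, which cancels the factor 1/2 of the distance.\<close>

lemma soft_covering:
  fixes pu :: "'u pmf" and V :: "'u \<Rightarrow> 'w pmf"
  assumes "fins pu" "\<And>u. u \<in> set_pmf pu \<Longrightarrow> fins (V u)" "0 < thr" "0 < L"
  defines "P \<equiv> bind_pmf pu V"
  shows "pex (iid L pu) (\<lambda>C. tv_dist (bind_pmf (pmf_of_set {..<L}) (\<lambda>i. V (C ! i))) P)
     \<le> sqrt (thr / L) / 2 + pex pu (\<lambda>u. pex (V u) (\<lambda>w. of_bool (thr * pmf P w < pmf (V u) w)))"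
proof -
  define W where "W = set_pmf P"
  let ?S = "iid L pu"
  have finS: "fins ?S" using assms by (simp add: fins_seq_replicate)
  have W: "finite W" "\<And>u. u \<in> set_pmf pu \<Longrightarrow> set_pmf (V u) \<subseteq> W"
    using assms by (auto simp: W_def P_def)
  \<comment> \<open>Truncating the likelihood ratio at \<open>thr\<close> bounds the variance of the typical part.\<close>
  define V1 where "V1 u w = (if pmf (V u) w \<le> thr * pmf P w then pmf (V u) w else 0)" for u w
  define V2 where "V2 u w = (if pmf (V u) w \<le> thr * pmf P w then 0 else pmf (V u) w)" for u w
  define m1 where "m1 w = pex pu (\<lambda>u. V1 u w)" for w
  define m2 where "m2 w = pex pu (\<lambda>u. V2 u w)" for w
  let ?S1 = "\<lambda>w C. sum_list (map (\<lambda>u. V1 u w - m1 w) C)" and ?S2 = "\<lambda>w C. sum_list (map (\<lambda>u. V2 u w) C)"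
  let ?M = "\<lambda>C. bind_pmf (pmf_of_set {..<L}) (\<lambda>i. V (C ! i))"
  have V12: "pmf (V u) w = V1 u w + V2 u w" for u w by (simp add: V1_def V2_def)
  have nn: "0 \<le> V1 u w" "0 \<le> V2 u w" for u w by (auto simp: V1_def V2_def)
  have m12: "pmf P w = m1 w + m2 w" for w
    unfolding P_def m1_def m2_def using assms by (simp add: pmf_bind_pex V12 pex_add)
  have mnn: "0 \<le> m1 w" "0 \<le> m2 w" for w unfolding m1_def m2_def by (auto intro!: pex_nonneg nn)
  have L: "0 < real L" using assms by simp
  have tv: "tv_dist (?M C) P
     \<le> (\<Sum>w\<in>W. \<bar>?S1 w C\<bar> / L + ?S2 w C / L + m2 w) / 2"
    if C: "C \<in> set_pmf ?S" for C
  proof -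
    have len: "length C = L" using C length_seq_pmf by fastforce
    have Cs: "C ! i \<in> set_pmf pu" if "i < L" for i using set_seq_replicate[OF C, of "C!i"] that len by simp
    have s: "(\<Sum>i<L. f (C ! i)) = sum_list (map f C)" for f :: "'u \<Rightarrow> real"
      by (simp add: sum_list_sum_nth len atLeast0LessThan)
    have "tv_dist (?M C) P
      = (\<Sum>w\<in>W. \<bar>pmf (?M C) w - pmf P w\<bar>) / 2"
      by (rule tv_dist_sum) (use W Cs assms in \<open>auto simp: W_def lessThan_empty_iff\<close>)
    also have "\<dots> \<le> (\<Sum>w\<in>W. \<bar>?S1 w C\<bar> / L + ?S2 w C / L + m2 w) / 2"
    proof (intro divide_right_mono sum_mono)
      fix w
      have "pmf (?M C) w = sum_list (map (\<lambda>u. pmf (V u) w) C) / L"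
        using assms by (subst pmf_bind_pex) (auto simp: pex_pmf_of_set lessThan_empty_iff s[of "\<lambda>u. pmf (V u) w"])
      also have "\<dots> = ?S1 w C / L + m1 w + ?S2 w C / L"
        using L by (simp add: V12 sum_list_addf sum_list_subtractf sum_list_triv len field_simps)
      finally have e: "pmf (?M C) w - pmf P w
        = ?S1 w C / L + ?S2 w C / L - m2 w"
        by (simp add: m12)
      have "0 \<le> ?S2 w C / L" using sum_list_nonneg[of "map (\<lambda>u. V2 u w) C"] nn(2) L by fastforce
      moreover have "\<bar>?S1 w C / L\<bar> = \<bar>?S1 w C\<bar> / L" by simp
      ultimately show "\<bar>pmf (?M C) w - pmf P w\<bar>
        \<le> \<bar>?S1 w C\<bar> / L + ?S2 w C / L + m2 w"
        unfolding e using mnn(2)[of w] by linarith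
    qed simp
    finally show ?thesis .
  qed
  have E1: "pex ?S (\<lambda>C. \<bar>?S1 w C\<bar>) \<le> sqrt (L * thr) * pmf P w" if w: "w \<in> W" for w
  proof -
    have Pw: "0 < pmf P w" using w by (simp add: W_def pmf_positive)
    \<comment> \<open>This value balances the two terms of \<open>pex_abs_sum_list_le\<close> once
      the variance is replaced by its bound.\<close>
    define t where "t = sqrt (L * thr) * pmf P w"
    have t: "0 < t" using Pw L assms by (simp add: t_def)
    have "pex pu (\<lambda>u. (V1 u w - m1 w)\<^sup>2) = pex pu (\<lambda>u. (V1 u w)\<^sup>2 + (- 2 * m1 w) * V1 u w + (m1 w)\<^sup>2)"
      by (simp add: power2_diff algebra_simps)
    also have "\<dots> = pex pu (\<lambda>u. (V1 u w)\<^sup>2) - (m1 w)\<^sup>2"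
      unfolding pex_add pex_cmult m1_def[symmetric] using assms by (simp add: pex_const power2_eq_square)
    also have "\<dots> \<le> pex pu (\<lambda>u. (V1 u w)\<^sup>2)" by simp
    also have "\<dots> \<le> pex pu (\<lambda>u. thr * pmf P w * V1 u w)"
      unfolding power2_eq_square by (intro pex_mono mult_right_mono nn) (use assms in \<open>auto simp: V1_def\<close>)
    also have "\<dots> = thr * pmf P w * m1 w" by (simp add: pex_cmult m1_def)
    also have "\<dots> \<le> thr * pmf P w * pmf P w" using assms(3) mnn by (intro mult_left_mono) (auto simp: m12[of w])
    finally have v: "pex pu (\<lambda>u. (V1 u w - m1 w)\<^sup>2) \<le> thr * pmf P w * pmf P w" .
    have "pex ?S (\<lambda>C. \<bar>?S1 w C\<bar>) \<le> (L * pex pu (\<lambda>u. (V1 u w - m1 w)\<^sup>2) / t + t) / 2"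
      by (rule pex_abs_sum_list_le) (use assms t in \<open>auto simp: pex_diff m1_def pex_const\<close>)
    also have "\<dots> \<le> (L * (thr * pmf P w * pmf P w) / t + t) / 2"
      using v t L by (intro divide_right_mono add_right_mono mult_left_mono) auto
    also have "L * (thr * pmf P w * pmf P w) = t * t" using L assms by (simp add: t_def)
    also have "t * t / t = t" using t by simp
    finally show ?thesis by (simp add: t_def mult.commute)
  qed
  have E2: "pex ?S (\<lambda>C. ?S2 w C) = L * m2 w" for w
    using assms by (simp add: pex_sum_list_seq m2_def)
  have "pex ?S (\<lambda>C. tv_dist (?M C) P)
    \<le> pex ?S (\<lambda>C. (\<Sum>w\<in>W. \<bar>?S1 w C\<bar> / L + ?S2 w C / L + m2 w) / 2)"
    by (rule pex_mono) (rule tv)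
  also have "\<dots> = (\<Sum>w\<in>W. pex ?S (\<lambda>C. \<bar>?S1 w C\<bar>) / L + 2 * m2 w) / 2"
    using finS L by (simp add: pex_divide pex_sum pex_add E2 pex_const add_ac)
  also have "\<dots> \<le> (\<Sum>w\<in>W. sqrt (L * thr) * pmf P w / L + 2 * m2 w) / 2"
    using E1 L by (intro divide_right_mono sum_mono add_right_mono) auto
  also have "\<dots> = sqrt (L * thr) / L / 2 + (\<Sum>w\<in>W. m2 w)"
    using sum_pmf_eq_1[of W P] W
    by (simp add: sum.distrib W_def sum_divide_distrib[symmetric] sum_distrib_left[symmetric] add_divide_distrib)
  also have "sqrt (L * thr) / L = sqrt (thr / L)"
    using L assms by (simp add: real_sqrt_mult real_sqrt_divide field_simps)
  also have "(\<Sum>w\<in>W. m2 w) = pex pu (\<lambda>u. \<Sum>w\<in>W. V2 u w)" unfolding m2_def pex_sum ..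
  also have "\<dots> = pex pu (\<lambda>u. pex (V u) (\<lambda>w. of_bool (thr * pmf P w < pmf (V u) w)))"
  proof (rule pex_cong)
    fix u assume "u \<in> set_pmf pu"
    then show "(\<Sum>w\<in>W. V2 u w) = pex (V u) (\<lambda>w. of_bool (thr * pmf P w < pmf (V u) w))"
    proof (subst pex_superset[of W])
      show "(\<Sum>w\<in>W. V2 u w) = (\<Sum>w\<in>W. pmf (V u) w * of_bool (thr * pmf P w < pmf (V u) w))"
      proof (rule sum.cong[OF refl])
        fix w
        show "V2 u w = pmf (V u) w * of_bool (thr * pmf P w < pmf (V u) w)"
          by (cases "thr * pmf P w < pmf (V u) w") (simp_all add: V2_def not_less not_le)
      qed
    qed (use W in auto)
  qed
  finally show ?thesis .
qed

text \<open>Union bound: a wrong answer means that the true codeword is atypical or that one of at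
  most K - 1 others in its bin is typical. \<open>dec\<close> may be any rule that returns a typical
  member of the bin whenever there is one.\<close>

lemma packing:
  fixes pu :: "'u pmf" and V :: "'u \<Rightarrow> 'w pmf" and bin :: "nat \<Rightarrow> nat"
  assumes "fins pu" "\<And>u. u \<in> set_pmf pu \<Longrightarrow> fins (V u)" "0 < thr" "0 < L"
    and bins: "\<And>i. i < L \<Longrightarrow> card {j. j < L \<and> bin j = bin i} \<le> K"
  defines "P \<equiv> bind_pmf pu V"
  defines "typ \<equiv> (\<lambda>u w. thr * pmf P w < pmf (V u) w)"
  assumes dec: "\<And>C m w. \<exists>j<L. bin j = m \<and> typ (C ! j) w \<Longrightarrow> dec C m w < L \<and> bin (dec C m w) = m \<and> typ (C ! dec C m w) w"
  shows "pex (iid L pu) (\<lambda>C. (\<Sum>i<L. pex (V (C ! i)) (\<lambda>w. of_bool (dec C (bin i) w \<noteq> i))) / L)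
     \<le> pex pu (\<lambda>u. pex (V u) (\<lambda>w. of_bool (\<not> typ u w))) + (real K - 1) / thr"
proof -
  let ?S = "iid L pu"
  let ?E = "\<lambda>i j. pex ?S (\<lambda>C. pex (V (C ! i)) (\<lambda>w. of_bool (typ (C ! j) w)))"
  define B where "B i = {j. j < L \<and> bin j = bin i} - {i}" for i
  have finP: "fins P" using assms by (simp add: P_def)
  have cardB: "real (card (B i)) \<le> real K - 1" if "i < L" for i
  proof -
    have "card (B i) = card {j. j < L \<and> bin j = bin i} - 1" unfolding B_def using that by (subst card_Diff_singleton) auto
    moreover have "0 < card {j. j < L \<and> bin j = bin i}" using that by (subst card_gt_0_iff) auto
    ultimately show ?thesis using bins[OF that] by linarith
  qed
  \<comment> \<open>Change of measure: where \<open>typ u w\<close> holds, P(w) is below V(u)(w) /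
    thr, and \<open>V u\<close> has mass 1.\<close>
  have false_alarm: "pex P (\<lambda>w. of_bool (typ u w)) \<le> 1 / thr" if u: "u \<in> set_pmf pu" for u
  proof -
    have "pex P (\<lambda>w. of_bool (typ u w)) = (\<Sum>w\<in>set_pmf P. pmf P w * of_bool (typ u w))" by (simp add: pex_def)
    also have "\<dots> \<le> (\<Sum>w\<in>set_pmf P. pmf (V u) w / thr)"
      using assms(3) by (intro sum_mono) (auto simp: typ_def of_bool_def field_simps)
    also have "\<dots> = 1 / thr"
      using u finP by (simp add: sum_divide_distrib[symmetric]) (subst sum_pmf_eq_1, auto simp: P_def)
    finally show ?thesis .
  qed
  have "pex ?S (\<lambda>C. (\<Sum>i<L. pex (V (C ! i)) (\<lambda>w. of_bool (dec C (bin i) w \<noteq> i))) / L)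
    \<le> pex ?S (\<lambda>C. (\<Sum>i<L. pex (V (C ! i)) (\<lambda>w. of_bool (\<not> typ (C ! i) w) + (\<Sum>j\<in>B i. of_bool (typ (C ! j) w)))) / L)"
  proof (intro pex_mono divide_right_mono sum_mono)
    fix C i w assume i: "i \<in> {..<L}"
    show "of_bool (dec C (bin i) w \<noteq> i) \<le> of_bool (\<not> typ (C ! i) w) + (\<Sum>j\<in>B i. (of_bool (typ (C ! j) w) :: real))"
    proof (cases "typ (C ! i) w \<and> dec C (bin i) w \<noteq> i")
      case True
      then have "dec C (bin i) w \<in> B i" "typ (C ! dec C (bin i) w) w" using dec[of "bin i" C w] i by (auto simp: B_def)
      then have "1 \<le> (\<Sum>j\<in>B i. (of_bool (typ (C ! j) w) :: real))"
        using member_le_sum[of "dec C (bin i) w" "B i" "\<lambda>j. of_bool (typ (C ! j) w) :: real"] by (auto simp: B_def)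
      then show ?thesis using True by simp
    qed (auto intro!: sum_nonneg add_nonneg_nonneg)
  qed simp
  also have "\<dots> = (\<Sum>i<L. pex ?S (\<lambda>C. pex (V (C ! i)) (\<lambda>w. of_bool (\<not> typ (C ! i) w)))
      + (\<Sum>j\<in>B i. ?E i j)) / L"
    by (simp add: pex_divide pex_sum pex_add)
  also have "\<dots> \<le> (\<Sum>i<L. pex pu (\<lambda>u. pex (V u) (\<lambda>w. of_bool (\<not> typ u w))) + (real K - 1) / thr) / L"
  proof (intro divide_right_mono sum_mono add_mono)
    fix i assume i: "i \<in> {..<L}"
    show "pex ?S (\<lambda>C. pex (V (C ! i)) (\<lambda>w. of_bool (\<not> typ (C ! i) w))) \<le> pex pu (\<lambda>u. pex (V u) (\<lambda>w. of_bool (\<not> typ u w)))"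
      using i assms by (subst pex_nth_seq[where f = "\<lambda>u. pex (V u) (\<lambda>w. of_bool (\<not> typ u w))"]) auto
    have "(\<Sum>j\<in>B i. ?E i j) \<le> (\<Sum>j\<in>B i. 1 / thr)"
    proof (rule sum_mono)
      fix j assume j: "j \<in> B i"
      \<comment> \<open>Distinct codewords are independent, so to codeword j the output of codeword
        i looks like a draw from \<open>P\<close>.\<close>
      have "?E i j
        = pex pu (\<lambda>u. pex pu (\<lambda>u'. pex (V u) (\<lambda>w. of_bool (typ u' w))))"
        by (rule pex_nth2_seq[where f = "\<lambda>u u'. pex (V u) (\<lambda>w. of_bool (typ u' w))"])
          (use i j assms in \<open>auto simp: B_def\<close>)
      also have "\<dots> = pex pu (\<lambda>u'. pex P (\<lambda>w. of_bool (typ u' w)))"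
        unfolding P_def by (subst pex_swap, subst pex_bind) (use assms in auto)
      also have "\<dots> \<le> pex pu (\<lambda>u'. 1 / thr)" by (intro pex_mono false_alarm)
      finally show "?E i j \<le> 1 / thr"
        using assms by (simp add: pex_const)
    qed
    also have "\<dots> \<le> (real K - 1) / thr"
      using cardB[of i] i assms(3) by (simp add: divide_right_mono)
    finally show "(\<Sum>j\<in>B i. ?E i j) \<le> (real K - 1) / thr" .
  qed simp
  also have "\<dots> = pex pu (\<lambda>u. pex (V u) (\<lambda>w. of_bool (\<not> typ u w))) + (real K - 1) / thr"
    using assms(4) by simp
  finally show ?thesis .
qed

section \<open>Disintegration and one-shot codes\<close>

text \<open>Outside the support of the first marginal the kernel is a junk point mass.\<close>

definition kernel :: "('s \<times> 't) pmf \<Rightarrow> 's \<Rightarrow> 't pmf" where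
  "kernel J s = (if s \<in> set_pmf (map_pmf fst J) then map_pmf snd (cond_pmf J {p. s = fst p}) else return_pmf undefined)"

lemma bind_kernel: "bind_pmf (map_pmf fst J) (\<lambda>s. map_pmf (Pair s) (kernel J s)) = J"
proof -
  have "bind_pmf (map_pmf fst J) (\<lambda>s. map_pmf (Pair s) (kernel J s))
     = bind_pmf (map_pmf fst J) (\<lambda>x. cond_pmf J {s. x = fst s})"
  proof (rule bind_pmf_cong[OF refl])
    fix s assume s: "s \<in> set_pmf (map_pmf fst J)"
    then have "set_pmf J \<inter> {p. s = fst p} \<noteq> {}" by auto
    then show "map_pmf (Pair s) (kernel J s) = cond_pmf J {p. s = fst p}"
      unfolding kernel_def if_P[OF s] map_pmf_comp by (intro map_pmf_idI) (auto simp: set_cond_pmf)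
  qed
  also have "\<dots> = J"
  proof (rule bind_cond_pmf_cancel)
    fix x y assume "x \<in> set_pmf (map_pmf fst J)" "y \<in> set_pmf J" "x = fst y"
    then show "measure (measure_pmf J) {y. x = fst y} = measure (measure_pmf (map_pmf fst J)) {x. x = fst y}"
      by (auto intro!: arg_cong[where f = "measure _"])
  qed auto
  finally show ?thesis .
qed

abbreviation drop_msg :: "'a \<times> 'b \<times> 'm \<times> 'c \<Rightarrow> 'a \<times> 'b \<times> 'c" where
  "drop_msg \<equiv> \<lambda>(x, y, m, z). (x, y, z)"

abbreviation relabel :: "('m \<Rightarrow> 'k) \<Rightarrow> 'a \<times> 'b \<times> 'm \<times> 'c \<Rightarrow> 'a \<times> 'b \<times> 'k \<times> 'c" where
  "relabel h \<equiv> \<lambda>(x, y, m, z). (x, y, h m, z)"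

text \<open>The idealised law: a uniform index and the channel output of its codeword. The index
  sits where \<open>code_pmf\<close> has the message, so that the two laws can be compared after
  \<open>relabel\<close>.\<close>

definition codebook_pmf :: "nat \<Rightarrow> ('u \<Rightarrow> ('a \<times> 'b \<times> 'c) pmf) \<Rightarrow> (nat \<Rightarrow> 'u) \<Rightarrow> ('a \<times> 'b \<times> nat \<times> 'c) pmf" where
  "codebook_pmf L V C = bind_pmf (pmf_of_set {..<L}) (\<lambda>i. map_pmf (\<lambda>(x, y, z). (x, y, i, z)) (V (C i)))"

definition chan3 :: "('u \<Rightarrow> 'a pmf) \<Rightarrow> ('a \<Rightarrow> 'b pmf) \<Rightarrow> ('u \<Rightarrow> 'b \<Rightarrow> 'c pmf) \<Rightarrow> 'u \<Rightarrow> ('a \<times> 'b \<times> 'c) pmf" where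
  "chan3 a py q u = bind_pmf (a u) (\<lambda>x. bind_pmf (py x) (\<lambda>y. map_pmf (\<lambda>z. (x, y, z)) (q u y)))"

text \<open>Block codes are the case where the letters are lists, see
  \<open>code_pmf_one_shot\<close>.\<close>

definition one_shot_pmf :: "'a pmf \<Rightarrow> ('a \<Rightarrow> 'b pmf) \<Rightarrow> ('a \<Rightarrow> nat pmf) \<Rightarrow> (nat \<Rightarrow> 'b \<Rightarrow> 'c pmf) \<Rightarrow> ('a \<times> 'b \<times> nat \<times> 'c) pmf" where
  "one_shot_pmf px py enc dec = bind_pmf px (\<lambda>x. bind_pmf (py x) (\<lambda>y. bind_pmf (enc x) (\<lambda>m.
     map_pmf (\<lambda>z. (x, y, m, z)) (dec m y))))"

lemma set_kernel: "s \<in> set_pmf (map_pmf fst K) \<Longrightarrow> set_pmf (kernel K s) \<subseteq> snd ` set_pmf K"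
proof -
  assume s: "s \<in> set_pmf (map_pmf fst K)"
  then have "set_pmf K \<inter> {p. s = fst p} \<noteq> {}" by auto
  then show "set_pmf (kernel K s) \<subseteq> snd ` set_pmf K"
    unfolding kernel_def if_P[OF s] by (auto simp: set_cond_pmf)
qed

lemma lessThan_ne: "0 < L \<Longrightarrow> {..<L::nat} \<noteq> {}" by (auto simp: lessThan_empty_iff)

subsection \<open>From a codebook to a code\<close>

text \<open>
  The encoder is the posterior of the codeword index given \<open>x\<close>, relabelled by \<open>bin\<close>: replacing the codebook
  law of \<open>x\<close> by the true one costs \<open>A\<close>, replacing the index by its decoded value costs \<open>B\<close>.
\<close>

lemma codebook_to_one_shot:
  fixes a :: "'u \<Rightarrow> 'a pmf" and py :: "'a \<Rightarrow> 'b pmf" and q :: "'u \<Rightarrow> 'b \<Rightarrow> 'c pmf"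
    and T :: "('a \<times> 'b \<times> 'c) pmf" and C :: "nat \<Rightarrow> 'u" and dec :: "nat \<Rightarrow> 'b \<Rightarrow> nat" and bin :: "nat \<Rightarrow> nat"
  assumes fin: "\<And>u. fins (a u)" "\<And>x. fins (py x)" "\<And>u y. fins (q u y)" "fins T" "0 < L"
  defines "V \<equiv> chan3 a py q"
  defines "Q \<equiv> codebook_pmf L V C"
  defines "A \<equiv> tv_dist (map_pmf drop_msg Q) T"
  defines "B \<equiv> (\<Sum>i<L. pex (map_pmf (\<lambda>(x, y, z). y) (V (C i))) (\<lambda>y. of_bool (dec (bin i) y \<noteq> i))) / L"
  shows "\<exists>enc. (\<forall>x. set_pmf (enc x) \<subseteq> bin ` {..<L}) \<and>
     tv_dist (one_shot_pmf (map_pmf fst T) py enc (\<lambda>m y. q (C (dec m y)) y)) (map_pmf (relabel bin) Q) \<le> A + B"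
proof -
  have finV: "fins (V u)" for u using fin by (auto simp: V_def chan3_def)
  have L: "{..<L} \<noteq> {}" using fin by (simp add: lessThan_ne)
  have finQ: "fins Q" using finV L by (auto simp: Q_def codebook_pmf_def)
  define J where "J = bind_pmf (pmf_of_set {..<L}) (\<lambda>i. map_pmf (\<lambda>x. (x, i)) (a (C i)))"
  define Qx where "Qx = map_pmf fst J"
  \<comment> \<open>Index 0 off the support keeps every message in the range of
    \<open>bin\<close>.\<close>
  define post where "post x = (if x \<in> set_pmf Qx then kernel J x else return_pmf 0)" for x
  have finJ: "fins J" using fin L by (auto simp: J_def)
  have finQx: "fins Qx" using finJ by (simp add: Qx_def)
  have setJ: "set_pmf J \<subseteq> UNIV \<times> {..<L}" using L by (auto simp: J_def)
  have post: "set_pmf (post x) \<subseteq> {..<L}" for x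
  proof (cases "x \<in> set_pmf Qx")
    case True
    then have "set_pmf (kernel J x) \<subseteq> snd ` set_pmf J" by (intro set_kernel) (simp only: Qx_def)
    also have "\<dots> \<subseteq> {..<L}" using setJ by auto
    finally show ?thesis using True by (simp add: post_def)
  qed (use fin in \<open>auto simp: post_def\<close>)
  have finpost: "fins (post x)" for x using post[of x] finite_subset by blast
  have J: "J = bind_pmf Qx (\<lambda>x. map_pmf (Pair x) (post x))"
    by (subst bind_kernel[of J, symmetric], unfold Qx_def[symmetric], rule bind_pmf_cong) (auto simp: post_def)
  define F where "F = (\<lambda>x i. bind_pmf (py x) (\<lambda>y. map_pmf (\<lambda>z. (x, y, i, z)) (q (C i) y)))"
  define F' where "F' = (\<lambda>x i. bind_pmf (py x) (\<lambda>y. map_pmf (\<lambda>z. (x, y, i, z)) (q (C (dec (bin i) y)) y)))"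
  have QJ: "Q = bind_pmf J (\<lambda>(x, i). F x i)"
    by (simp add: Q_def codebook_pmf_def V_def chan3_def J_def F_def bind_assoc_pmf bind_map_pmf map_bind_pmf map_pmf_comp)
  define R where "R = bind_pmf J (\<lambda>(x, i). map_pmf (\<lambda>y. (x, y, i)) (py x))"
  have finR: "fins R" using finJ fin by (auto simp: R_def)
  have QR: "Q = bind_pmf R (\<lambda>(x, y, i). map_pmf (\<lambda>z. (x, y, i, z)) (q (C i) y))"
    by (simp add: QJ R_def F_def bind_assoc_pmf bind_map_pmf split_def)
  \<comment> \<open>A hybrid: x, y and the index follow the codebook law, but the output already
    uses the decoded index.\<close>
  define P'' where "P'' = bind_pmf R (\<lambda>(x, y, i). map_pmf (\<lambda>z. (x, y, i, z)) (q (C (dec (bin i) y)) y))"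
  have P'': "P'' = bind_pmf Qx (\<lambda>x. bind_pmf (post x) (F' x))"
    by (simp add: P''_def R_def J F'_def bind_assoc_pmf bind_map_pmf split_def)
  have finP'': "fins P''" using finR fin by (auto simp: P''_def)
  define enc where "enc x = map_pmf bin (post x)" for x
  define px where "px = map_pmf fst T"
  have finpx: "fins px" using fin by (simp add: px_def)
  define P where "P = one_shot_pmf px py enc (\<lambda>m y. q (C (dec m y)) y)"
  have P: "P = map_pmf (relabel bin) (bind_pmf px (\<lambda>x. bind_pmf (post x) (F' x)))"
    unfolding P_def one_shot_pmf_def enc_def F'_def
    by (simp add: bind_map_pmf map_bind_pmf map_pmf_comp) (subst bind_commute_pmf, rule refl)
  have Qx: "Qx = map_pmf fst (map_pmf drop_msg Q)"
    by (simp add: Qx_def QJ F_def map_bind_pmf map_pmf_comp split_def map_pmf_const) (simp add: map_pmf_def)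
  have finF': "fins (bind_pmf (post x) (F' x))" for x using finpost fin by (auto simp: F'_def)
  have 1: "tv_dist P (map_pmf (relabel bin) P'') \<le> A"
  proof -
    have "tv_dist P (map_pmf (relabel bin) P'') \<le> tv_dist (bind_pmf px (\<lambda>x. bind_pmf (post x) (F' x))) P''"
      unfolding P by (rule tv_dist_map_le) (use finP'' finpx finF' in auto)
    also have "\<dots> \<le> tv_dist px Qx" unfolding P'' by (rule tv_dist_bind_le) (use finQx finpx finF' in auto)
    also have "\<dots> \<le> A" unfolding px_def Qx A_def
      by (subst tv_dist_sym, rule tv_dist_map_le) (use finQ fin in auto)
    finally show ?thesis .
  qed
  have 2: "tv_dist (map_pmf (relabel bin) P'') (map_pmf (relabel bin) Q) \<le> B"
  proof -
    have "tv_dist (map_pmf (relabel bin) P'') (map_pmf (relabel bin) Q) \<le> tv_dist P'' Q"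
      by (rule tv_dist_map_le[OF finP'' finQ])
    also have "\<dots> \<le> pex R (\<lambda>s. of_bool ((case s of (x, y, i) \<Rightarrow> map_pmf (\<lambda>z. (x, y, i, z)) (q (C (dec (bin i) y)) y)) \<noteq>
        (case s of (x, y, i) \<Rightarrow> map_pmf (\<lambda>z. (x, y, i, z)) (q (C i) y))))"
      unfolding P''_def QR by (rule tv_dist_bind_same) (use finR fin in auto)
    also have "\<dots> \<le> pex R (\<lambda>(x, y, i). of_bool (dec (bin i) y \<noteq> i))"
      by (rule pex_mono) auto
    also have "\<dots> = B"
    proof -
      have *: "map_pmf (\<lambda>(x, y, z). y) (V u) = bind_pmf (a u) py" for u
        by (simp add: V_def chan3_def map_bind_pmf map_pmf_comp bind_return_pmf' map_pmf_const)
      show ?thesis unfolding B_def *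
        using fin L finJ by (simp add: R_def J_def pex_bind pex_map pex_pmf_of_set bind_assoc_pmf bind_map_pmf)
    qed
    finally show ?thesis .
  qed
  have "tv_dist P (map_pmf (relabel bin) Q) \<le> A + B"
    using tv_dist_triangle[of P "map_pmf (relabel bin) P''" "map_pmf (relabel bin) Q"]
      1 2 finP'' finQ finpx finF' by (auto simp: P)
  moreover have "\<forall>x. set_pmf (enc x) \<subseteq> bin ` {..<L}" using post by (auto simp: enc_def)
  ultimately show ?thesis unfolding P_def px_def by blast
qed

text \<open>The expected covering distance, decoding error and average of \<open>G\<close> over
  random codebooks add up to at most \<open>c\<close>, so some codebook has their sum at most
  \<open>c\<close>; being nonnegative, each is then at most \<open>c\<close>. \<open>G\<close> is a
  free cost that later controls leakage.\<close>

lemma one_shot: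
  fixes pu :: "'u pmf" and a :: "'u \<Rightarrow> 'a pmf" and py :: "'a \<Rightarrow> 'b pmf" and q :: "'u \<Rightarrow> 'b \<Rightarrow> 'c pmf"
    and G :: "'u \<Rightarrow> real" and bin :: "nat \<Rightarrow> nat"
  assumes fin: "fins pu" "\<And>u. fins (a u)" "\<And>x. fins (py x)" "\<And>u y. fins (q u y)" "0 < L" "0 < thr" "0 < thr'"
    and G: "\<And>u. 0 \<le> G u"
    and bins: "\<And>i. i < L \<Longrightarrow> card {j. j < L \<and> bin j = bin i} \<le> K"
  defines "V \<equiv> chan3 a py q"
  defines "T \<equiv> bind_pmf pu V"
  defines "VY \<equiv> (\<lambda>u. map_pmf (\<lambda>(x, y, z). y) (V u))"
  defines "PY \<equiv> bind_pmf pu VY"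
  assumes c: "sqrt (thr / L) / 2 + pex pu (\<lambda>u. pex (V u) (\<lambda>w. of_bool (thr * pmf T w < pmf (V u) w)))
     + (pex pu (\<lambda>u. pex (VY u) (\<lambda>w. of_bool (\<not> thr' * pmf PY w < pmf (VY u) w))) + (real K - 1) / thr') + pex pu G \<le> c"
  shows "\<exists>C enc dec. (\<forall>i. C i \<in> set_pmf pu) \<and> (\<forall>x. set_pmf (enc x) \<subseteq> bin ` {..<L}) \<and>
     tv_dist (one_shot_pmf (map_pmf fst T) py enc (\<lambda>m y. q (C (dec m y)) y))
        (map_pmf (relabel bin) (codebook_pmf L V C)) \<le> c \<and>
     tv_dist (map_pmf drop_msg (codebook_pmf L V C)) T \<le> c \<and>
     (\<Sum>i<L. G (C i)) / L \<le> c"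
proof -
  have finV: "fins (V u)" "fins (VY u)" for u using fin by (auto simp: V_def VY_def chan3_def)
  have finT: "fins T" using fin finV by (simp add: T_def)
  let ?S = "iid L pu"
  define tp where "tp u y \<longleftrightarrow> thr' * pmf PY y < pmf (VY u) y" for u y
  define dec where "dec C m y = (if \<exists>j<L. bin j = m \<and> tp (C ! j) y then SOME j. j < L \<and> bin j = m \<and> tp (C ! j) y else 0)"
    for C m y
  have dec: "dec C m w < L \<and> bin (dec C m w) = m \<and> tp (C ! dec C m w) w" if "\<exists>j<L. bin j = m \<and> tp (C ! j) w" for C m w
    using someI_ex[of "\<lambda>j. j < L \<and> bin j = m \<and> tp (C ! j) w"] that by (simp add: dec_def)
  define A where "A C = tv_dist (bind_pmf (pmf_of_set {..<L}) (\<lambda>i. V (C ! i))) T" for C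
  define B where "B C = (\<Sum>i<L. pex (VY (C ! i)) (\<lambda>w. of_bool (dec C (bin i) w \<noteq> i))) / L" for C
  define D where "D C = (\<Sum>i<L. G (C ! i)) / L" for C
  have eA: "pex ?S A \<le> sqrt (thr / L) / 2 + pex pu (\<lambda>u. pex (V u) (\<lambda>w. of_bool (thr * pmf T w < pmf (V u) w)))"
    unfolding A_def T_def by (rule soft_covering) (use fin finV in auto)
  have eB: "pex ?S B \<le> pex pu (\<lambda>u. pex (VY u) (\<lambda>w. of_bool (\<not> thr' * pmf PY w < pmf (VY u) w))) + (real K - 1) / thr'"
    unfolding B_def PY_def
    by (rule packing[OF fin(1) finV(2) fin(7) fin(5) bins]) (use dec in \<open>auto simp: tp_def PY_def\<close>)
  have eD: "pex ?S D = pex pu G"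
    unfolding D_def using fin by (simp add: pex_divide pex_sum pex_nth_seq)
  have "pex ?S (\<lambda>C. A C + B C + D C) \<le> c"
    unfolding pex_add using eA eB eD c by simp
  then obtain C where C: "C \<in> set_pmf ?S" "A C + B C + D C \<le> c"
    using pex_exists_le[of ?S] fin fins_seq_replicate by blast
  have "length C = L" using C length_seq_pmf by fastforce
  then have Cs: "C ! i \<in> set_pmf pu" if "i < L" for i using set_seq_replicate[OF C(1), of "C!i"] that by simp
  \<comment> \<open>Indices beyond \<open>L\<close> repeat codeword 0, so every \<open>C' i\<close>
    lies in the support; for block codewords this fixes all lengths.\<close>
  define C' where "C' i = (if i < L then C ! i else C ! 0)" for i
  have ne: "{..<L} \<noteq> {}" using fin by (simp add: lessThan_ne)
  have "fins (bind_pmf (pmf_of_set {..<L}) (\<lambda>i. V (C ! i)))" using ne finV by simp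
  then have nn: "0 \<le> A C" unfolding A_def by (rule tv_dist_nonneg[OF _ finT])
  have nn2: "0 \<le> B C" "0 \<le> D C"
    unfolding B_def D_def using G by (auto intro!: divide_nonneg_nonneg sum_nonneg pex_nonneg)
  have A': "tv_dist (map_pmf drop_msg (codebook_pmf L V C')) T = A C"
  proof -
    have "map_pmf drop_msg (codebook_pmf L V C') = bind_pmf (pmf_of_set {..<L}) (\<lambda>i. V (C ! i))"
      unfolding codebook_pmf_def map_bind_pmf map_pmf_comp
      by (rule bind_pmf_cong[OF refl]) (use ne in \<open>auto simp: C'_def split_def\<close>)
    then show ?thesis by (simp add: A_def)
  qed
  define dec' where "dec' m y = (if dec C m y < L then dec C m y else 0)" for m y
  have B': "(\<Sum>i<L. pex (map_pmf (\<lambda>(x, y, z). y) (V (C' i))) (\<lambda>y. of_bool (dec C (bin i) y \<noteq> i))) / L = B C"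
    unfolding B_def VY_def by (intro arg_cong2[where f = "(/)"] sum.cong) (auto simp: C'_def)
  obtain enc where enc: "\<forall>x. set_pmf (enc x) \<subseteq> bin ` {..<L}"
     "tv_dist (one_shot_pmf (map_pmf fst T) py enc (\<lambda>m y. q (C' (dec C m y)) y))
       (map_pmf (relabel bin) (codebook_pmf L V C')) \<le> A C + B C"
    using codebook_to_one_shot[where a = a and py = py and q = q and T = T and L = L and C = C' and dec = "dec C" and bin = bin] fin finT A' B' unfolding V_def by auto
  have D': "(\<Sum>i<L. G (C' i)) / L = D C"
    unfolding D_def by (intro arg_cong2[where f = "(/)"] sum.cong) (auto simp: C'_def)
  show ?thesis
    by (rule exI[of _ C'], rule exI[of _ enc], rule exI[of _ "dec C"])
      (use enc A' D' nn nn2 C(2) Cs fin(5) in \<open>auto simp: C'_def\<close>)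
qed

subsection \<open>Memoryless extensions\<close>

definition unzip3 :: "('a \<times> 'b \<times> 'c) list \<Rightarrow> 'a list \<times> 'b list \<times> 'c list" where
  "unzip3 ws = (map fst ws, map (fst \<circ> snd) ws, map (snd \<circ> snd) ws)"

lemma inj_unzip3: "inj unzip3"
proof (rule injI)
  fix v w :: "('a \<times> 'b \<times> 'c) list" assume "unzip3 v = unzip3 w"
  then show "v = w"
  proof (induction v arbitrary: w)
    case (Cons p v)
    then show ?case by (cases w) (auto simp: unzip3_def prod_eq_iff)
  qed (simp add: unzip3_def)
qed

lemma unzip3_Cons: "unzip3 ((x, y, z) # ws) = (case unzip3 ws of (xs, ys, zs) \<Rightarrow> (x # xs, y # ys, z # zs))"
  by (simp add: unzip3_def)

text \<open>Both sides draw the same letters, once coordinate by coordinate and once position by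
  position; commuting independent draws identifies them.\<close>

lemma chan3_seq:
  "chan3 (\<lambda>us. seq_pmf (map a us)) (\<lambda>xs. seq_pmf (map py xs)) (\<lambda>us ys. seq_pmf (map2 q us ys)) us
    = map_pmf unzip3 (seq_pmf (map (chan3 a py q) us))"
proof (induction us)
  case Nil
  show ?case by (simp add: chan3_def bind_return_pmf unzip3_def)
next
  case (Cons u us)
  let ?S = "seq_pmf (map (chan3 a py q) us)" and ?A = "seq_pmf (map a us)"
  let ?P = "\<lambda>xs. seq_pmf (map py xs)" and ?Q = "\<lambda>ys. seq_pmf (map2 q us ys)"
    and ?r = "\<lambda>x y z xs ys zs. return_pmf (x # xs, y # ys, z # zs)"
  have "map_pmf unzip3 (seq_pmf (map (chan3 a py q) (u # us)))
    = bind_pmf (a u) (\<lambda>x. bind_pmf (py x) (\<lambda>y. bind_pmf (q u y) (\<lambda>z.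
        map_pmf (\<lambda>(xs, ys, zs). (x # xs, y # ys, z # zs)) (map_pmf unzip3 ?S))))"
    by (simp add: chan3_def[of a py q u] map_bind_pmf bind_map_pmf bind_assoc_pmf map_pmf_comp)
      (simp add: unzip3_Cons map_pmf_def split_def)
  also have "\<dots> = bind_pmf (a u) (\<lambda>x. bind_pmf (py x) (\<lambda>y. bind_pmf (q u y) (\<lambda>z.
      bind_pmf ?A (\<lambda>xs. bind_pmf (?P xs) (\<lambda>ys. bind_pmf (?Q ys) (?r x y z xs ys))))))"
    unfolding Cons[symmetric] chan3_def by (simp add: map_bind_pmf map_pmf_def bind_assoc_pmf bind_return_pmf)
  also have "\<dots> = bind_pmf (a u) (\<lambda>x. bind_pmf (py x) (\<lambda>y. bind_pmf ?A (\<lambda>xs.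
      bind_pmf (q u y) (\<lambda>z. bind_pmf (?P xs) (\<lambda>ys. bind_pmf (?Q ys) (?r x y z xs ys))))))"
    by (subst bind_commute_pmf[of "q _ _"]) (rule refl)
  also have "\<dots> = bind_pmf (a u) (\<lambda>x. bind_pmf (py x) (\<lambda>y. bind_pmf ?A (\<lambda>xs.
      bind_pmf (?P xs) (\<lambda>ys. bind_pmf (q u y) (\<lambda>z. bind_pmf (?Q ys) (?r x y z xs ys))))))"
    by (subst bind_commute_pmf[of "q _ _"]) (rule refl)
  also have "\<dots> = bind_pmf (a u) (\<lambda>x. bind_pmf ?A (\<lambda>xs. bind_pmf (py x) (\<lambda>y.
      bind_pmf (?P xs) (\<lambda>ys. bind_pmf (q u y) (\<lambda>z. bind_pmf (?Q ys) (?r x y z xs ys))))))"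
    by (subst bind_commute_pmf[of "py _"]) (rule refl)
  also have "\<dots> = chan3 (\<lambda>us. seq_pmf (map a us)) (\<lambda>xs. seq_pmf (map py xs)) (\<lambda>us ys. seq_pmf (map2 q us ys)) (u # us)"
    by (simp add: chan3_def map_pmf_def bind_assoc_pmf bind_return_pmf)
  finally show ?case ..
qed

lemma seq_replicate_bind:
  "iid n (bind_pmf p f) = bind_pmf (iid n p) (\<lambda>xs. seq_pmf (map f xs))"
proof (induction n)
  case (Suc n)
  show ?case
    by (simp add: Suc bind_assoc_pmf bind_return_pmf) (subst bind_commute_pmf[of "f _"], rule refl)
qed (simp add: bind_return_pmf)

lemma seq_pmf_map_Pair: "seq_pmf (map (\<lambda>x. map_pmf (Pair x) (f x)) xs) = map_pmf (zip xs) (seq_pmf (map f xs))"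
  by (induction xs) (simp_all add: map_bind_pmf bind_map_pmf)

text \<open>Codeword and output together form an i.i.d. list of pairs, to which the law of large
  numbers applies.\<close>

lemma pex_seq_joint:
  assumes "fins p" "\<And>u. fins (V u)"
  shows "pex (iid n p) (\<lambda>us. pex (seq_pmf (map V us)) (\<lambda>ws. f us ws))
    = pex (iid n (bind_pmf p (\<lambda>u. map_pmf (Pair u) (V u)))) (\<lambda>l. f (map fst l) (map snd l))"
proof -
  have fV: "fins (seq_pmf (map V us))" for us by (rule fins_seq_pmf) (use assms in auto)
  show ?thesis
    unfolding seq_replicate_bind seq_pmf_map_Pair
  proof (subst pex_bind)
    show "pex (iid n p) (\<lambda>us. pex (seq_pmf (map V us)) (f us)) =
     pex (iid n p) (\<lambda>a. pex (map_pmf (zip a) (seq_pmf (map V a))) (\<lambda>l. f (map fst l) (map snd l)))"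
    proof (rule pex_cong)
      fix us
      show "pex (seq_pmf (map V us)) (f us) = pex (map_pmf (zip us) (seq_pmf (map V us))) (\<lambda>l. f (map fst l) (map snd l))"
        unfolding pex_map[OF fV] by (rule pex_cong) (use length_seq_pmf in fastforce)
    qed
  qed (use assms fV in \<open>auto simp: fins_seq_replicate\<close>)
qed

lemma density_seq:
  assumes "\<And>u w. (u, w) \<in> set l \<Longrightarrow> w \<in> set_pmf (V u) \<and> w \<in> set_pmf T"
  shows "pmf (seq_pmf (map V (map fst l))) (map snd l)
     = 2 powr (sum_list (map (\<lambda>(u, w). log 2 (pmf (V u) w / pmf T w)) l)) * pmf (iid (length l) T) (map snd l)"
    and "0 < pmf (iid (length l) T) (map snd l)"
proof -
  have "pmf (seq_pmf (map V (map fst l))) (map snd l)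
     = 2 powr (sum_list (map (\<lambda>(u, w). log 2 (pmf (V u) w / pmf T w)) l)) * pmf (iid (length l) T) (map snd l)
     \<and> 0 < pmf (iid (length l) T) (map snd l)"
    using assms
  proof (induction l)
    case (Cons p l)
    obtain u w where p: "p = (u, w)" by (cases p)
    have "0 < pmf (V u) w" "0 < pmf T w" using Cons.prems[of u w] by (auto simp: p pmf_positive)
    moreover note Cons.IH[OF Cons.prems[OF list.set_intros(2)]]
    ultimately show ?case by (simp add: p pmf_seq_pmf_Cons powr_add del: seq_pmf.simps)
  qed auto
  then show "pmf (seq_pmf (map V (map fst l))) (map snd l)
     = 2 powr (sum_list (map (\<lambda>(u, w). log 2 (pmf (V u) w / pmf T w)) l)) * pmf (iid (length l) T) (map snd l)"
    "0 < pmf (iid (length l) T) (map snd l)" by auto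
qed

text \<open>\<open>I\<close> is the mutual information of input and output, see
  \<open>pex_info_density\<close>. Either bad event forces the information density of the block, a
  sum over letters, to miss n * I by at least n * dlt.\<close>

lemma info_density_concentration:
  fixes pu :: "'u pmf" and V :: "'u \<Rightarrow> 'w pmf" and eps dlt :: real
  assumes "fins pu" "\<And>u. fins (V u)" "0 < eps" "0 < dlt"
  defines "T \<equiv> bind_pmf pu V"
  defines "I \<equiv> pex (bind_pmf pu (\<lambda>u. map_pmf (Pair u) (V u))) (\<lambda>(u, w). log 2 (pmf (V u) w / pmf T w))"
  shows "eventually (\<lambda>n. pex (iid n pu) (\<lambda>us. pex (seq_pmf (map V us)) (\<lambda>ws.
      of_bool (2 powr (n * (I + dlt)) * pmf (iid n T) ws < pmf (seq_pmf (map V us)) ws))) \<le> eps) sequentially"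
    and "eventually (\<lambda>n. pex (iid n pu) (\<lambda>us. pex (seq_pmf (map V us)) (\<lambda>ws.
      of_bool (\<not> 2 powr (n * (I - dlt)) * pmf (iid n T) ws < pmf (seq_pmf (map V us)) ws))) \<le> eps) sequentially"
proof -
  define J where "J = bind_pmf pu (\<lambda>u. map_pmf (Pair u) (V u))"
  define f where "f = (\<lambda>(u, w). log 2 (pmf (V u) w / pmf T w))"
  have finJ: "fins J" using assms by (auto simp: J_def)
  have I: "I = pex J f" by (simp add: I_def J_def f_def)
  have dens: "pmf (seq_pmf (map V (map fst l))) (map snd l) = 2 powr (sum_list (map f l)) * pmf (iid n T) (map snd l)"
     "0 < pmf (iid n T) (map snd l)" if l: "l \<in> set_pmf (iid n J)" for l n
  proof -
    have len: "length l = n" using l length_seq_pmf by fastforce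
    have "w \<in> set_pmf (V u) \<and> w \<in> set_pmf T" if "(u, w) \<in> set l" for u w
      using set_seq_replicate[OF l that] by (auto simp: J_def T_def)
    from density_seq[of l V T, OF this] show "pmf (seq_pmf (map V (map fst l))) (map snd l) = 2 powr (sum_list (map f l)) * pmf (iid n T) (map snd l)"
     "0 < pmf (iid n T) (map snd l)" by (auto simp: len f_def)
  qed
  have tail: "eventually (\<lambda>n. pex (iid n pu) (\<lambda>us. pex (seq_pmf (map V us)) (\<lambda>ws. of_bool (B n us ws))) \<le> eps) sequentially"
    if B: "\<And>n l. l \<in> set_pmf (iid n J) \<Longrightarrow> B n (map fst l) (map snd l) \<Longrightarrow> n * dlt \<le> \<bar>sum_list (map f l) - n * pex J f\<bar>" for B
    using lln_prob[OF finJ assms(3,4), of f]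
  proof eventually_elim
    case (elim n)
    show ?case unfolding pex_seq_joint[OF assms(1,2)] J_def[symmetric]
      by (rule order_trans[OF pex_mono elim]) (use B in \<open>auto simp: of_bool_def\<close>)
  qed
  show "eventually (\<lambda>n. pex (iid n pu) (\<lambda>us. pex (seq_pmf (map V us)) (\<lambda>ws.
      of_bool (2 powr (n * (I + dlt)) * pmf (iid n T) ws < pmf (seq_pmf (map V us)) ws))) \<le> eps) sequentially"
    by (rule tail) (use dens in \<open>auto simp: I algebra_simps\<close>)
  show "eventually (\<lambda>n. pex (iid n pu) (\<lambda>us. pex (seq_pmf (map V us)) (\<lambda>ws.
      of_bool (\<not> 2 powr (n * (I - dlt)) * pmf (iid n T) ws < pmf (seq_pmf (map V us)) ws))) \<le> eps) sequentially"
    by (rule tail) (use dens in \<open>auto simp: I algebra_simps\<close>)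
qed

lemma fins_finite_type: "fins (p :: 'a::finite pmf)" by simp

lemma pmf_chan3:
  fixes a :: "'u \<Rightarrow> 'x::finite pmf" and py :: "'x \<Rightarrow> 'y::finite pmf" and q :: "'u \<Rightarrow> 'y \<Rightarrow> 'z pmf"
  shows "pmf (chan3 a py q u) (x, y, z) = pmf (a u) x * (pmf (py x) y * pmf (q u y) z)"
proof -
  have "chan3 a py q u = bind_pmf (a u) (\<lambda>x. map_pmf (Pair x) (bind_pmf (py x) (\<lambda>y. map_pmf (Pair y) (q u y))))"
    by (simp add: chan3_def map_bind_pmf map_pmf_comp)
  then show ?thesis by (simp add: pmf_bind_Pair)
qed

lemma pmf_kernel:
  assumes "fins J"
  shows "pmf J (s, t) = pmf (map_pmf fst J) s * pmf (kernel J s) t"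
proof -
  have "pmf J (s, t) = pmf (bind_pmf (map_pmf fst J) (\<lambda>s. map_pmf (Pair s) (kernel J s))) (s, t)"
    by (simp only: bind_kernel)
  also have "\<dots> = pmf (map_pmf fst J) s * pmf (kernel J s) t"
    using assms by (intro pmf_bind_Pair) auto
  finally show ?thesis .
qed

abbreviation leakage :: "('x list \<times> 'y list \<times> nat \<times> 'z list) pmf \<Rightarrow> real" where
  "leakage P \<equiv> cmi P (\<lambda>(xs,ys,m,zs). m) (\<lambda>(xs,ys,m,zs). xs) (\<lambda>(xs,ys,m,zs). (ys,zs))"

subsection \<open>Leakage of a codebook\<close>

abbreviation len3 :: "nat \<Rightarrow> ('x list \<times> 'y list \<times> 'z list) set" where
  "len3 n \<equiv> {xs. length xs = n} \<times> {ys. length ys = n} \<times> {zs. length zs = n}"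

abbreviation fst2 :: "'x \<times> 'y \<times> 'z \<Rightarrow> 'x \<times> 'y" where
  "fst2 \<equiv> \<lambda>w. (fst w, fst (snd w))"

abbreviation mid3 :: "'x \<times> 'y \<times> 'z \<Rightarrow> 'y" where
  "mid3 \<equiv> \<lambda>(x, y, z). y"

text \<open>The values that a valid code can take. The logarithm of its size grows linearly in the
  block length, which keeps Fannes errors small per letter.\<close>

definition code_space :: "nat \<Rightarrow> nat \<Rightarrow> ('x list \<times> 'y list \<times> nat \<times> 'z list) set" where
  "code_space n M = {xs. length xs = n} \<times> {ys. length ys = n} \<times> {1..M} \<times> {zs. length zs = n}"

lemma lists_length_UNIV: "{xs :: 'a list. length xs = n} = {xs. set xs \<subseteq> UNIV \<and> length xs = n}" by simp

lemma finite_lists_length: "finite {xs :: 'a::finite list. length xs = n}"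
  unfolding lists_length_UNIV by (rule finite_lists_length_eq) simp

lemma card_lists_length: "card {xs :: 'a::finite list. length xs = n} = CARD('a) ^ n"
  unfolding lists_length_UNIV by (rule card_lists_length_eq) simp

lemma finite_code_space: "finite (code_space n M :: ('x::finite list \<times> 'y::finite list \<times> nat \<times> 'z::finite list) set)"
  by (simp add: code_space_def finite_lists_length)

lemma card_code_space:
  "card (code_space n M :: ('x::finite list \<times> 'y::finite list \<times> nat \<times> 'z::finite list) set)
    = CARD('x) ^ n * (CARD('y) ^ n * (M * CARD('z) ^ n))"
  by (simp add: code_space_def card_cartesian_product card_lists_length)

lemma ent_unzip3: "ent (map_pmf unzip3 p) = ent p"
  by (rule ent_map_inj) (use inj_unzip3 in \<open>auto intro: inj_on_subset\<close>)

lemma snd_unzip3: "snd (unzip3 ws) = (map fst (map snd ws), map snd (map snd ws))"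
  by (simp add: unzip3_def)

lemma ent_snd_unzip3: "ent (map_pmf snd (map_pmf unzip3 (seq_pmf (map f us)))) = sum_list (map (\<lambda>u. ent (map_pmf snd (f u))) us)"
  if "\<And>u. fins (f u)"
proof -
  have "map_pmf snd (map_pmf unzip3 (seq_pmf (map f us)))
     = map_pmf (\<lambda>vs. (map fst vs, map snd vs)) (map_pmf (map snd) (seq_pmf (map f us)))"
    by (simp add: map_pmf_comp snd_unzip3)
  also have "ent \<dots> = ent (map_pmf (map snd) (seq_pmf (map f us)))"
    by (rule ent_map_inj, rule inj_on_inverseI[of _ "\<lambda>(as, bs). zip as bs"]) (simp add: zip_map_fst_snd)
  also have "\<dots> = sum_list (map (\<lambda>u. ent (map_pmf snd (f u))) us)"
    unfolding seq_pmf_map[symmetric] by (subst ent_seq_pmf) (auto simp: that comp_def)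
  finally show ?thesis .
qed

text \<open>The factorisation p(u) p(x|u) p(y|x) p(z|u,y), where \<open>py\<close> does not see u.
  Names ending in \<open>n\<close> are block versions.\<close>

locale aux_channel =
  fixes pu :: "'u pmf" and a :: "'u \<Rightarrow> 'x::finite pmf" and py :: "'x \<Rightarrow> 'y::finite pmf"
    and q :: "'u \<Rightarrow> 'y \<Rightarrow> 'z::finite pmf"
  assumes fin_pu: "fins pu"
begin

definition "V = chan3 a py q"
definition "T = bind_pmf pu V"
definition "VY u = map_pmf mid3 (V u)"
definition "VYZ u = map_pmf snd (V u)"
text \<open>The entropy of X given (Y,Z) under \<open>V u\<close>; its mean over \<open>pu\<close>
  is H(X|U,Y,Z).\<close>

definition "g u = ent (V u) - ent (VYZ u)"
definition "an us = seq_pmf (map a us)"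
definition "pyn xs = seq_pmf (map py xs)"
definition "qn us ys = seq_pmf (map2 q us ys)"
definition "Vn = chan3 an pyn qn"
definition "pun n = iid n pu"
definition "Tn n = bind_pmf (pun n) Vn"

lemma Vn: "Vn us = map_pmf unzip3 (seq_pmf (map V us))"
  unfolding Vn_def an_def pyn_def qn_def V_def by (rule chan3_seq)

lemma Tn: "Tn n = map_pmf unzip3 (iid n T)"
  unfolding Tn_def pun_def T_def seq_replicate_bind map_bind_pmf Vn ..

lemma fins_n: "fins (an us)" "fins (pyn xs)" "fins (qn us ys)" "fins (Vn us)" "fins (pun n)" "fins (Tn n)"
  unfolding Tn Vn by (auto simp: an_def pyn_def qn_def pun_def fin_pu intro!: fins_seq_pmf)

lemma ent_Vn: "ent (Vn us) = sum_list (map (\<lambda>u. ent (V u)) us)"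
  unfolding Vn ent_unzip3 by (subst ent_seq_pmf) (auto simp: comp_def)

lemma ent_snd_Vn: "ent (map_pmf snd (Vn us)) = sum_list (map (\<lambda>u. ent (VYZ u)) us)"
  unfolding Vn VYZ_def by (rule ent_snd_unzip3) simp

lemma ent_Tn: "ent (Tn n) = n * ent T"
  unfolding Tn ent_unzip3 by (subst ent_seq_pmf) (auto simp: sum_list_replicate)

lemma ent_snd_Tn: "ent (map_pmf snd (Tn n)) = n * ent (map_pmf snd T)"
  using ent_snd_unzip3[of "\<lambda>_. T" "replicate n ()"] by (simp add: Tn sum_list_replicate)

lemma set_Tn: "set_pmf (Tn n) \<subseteq> len3 n"
  unfolding Tn by (auto simp: unzip3_def dest!: length_seq_pmf)

lemma set_Vn: "length us = n \<Longrightarrow> set_pmf (Vn us) \<subseteq> len3 n"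
  unfolding Vn by (auto simp: unzip3_def dest!: length_seq_pmf)

text \<open>The leakage is a combination of four entropies. All four pass from the code to the
  codebook law and two of them on to the i.i.d. law, which makes six Fannes errors. In the codebook
  law the bin is refined to the index, given which the letters are independent and H(X|YZ) is the
  sum of \<open>g\<close> over the codeword; hypothesis \<open>G\<close> keeps its average near n
  times the mean of \<open>g\<close>.\<close>

lemma leakage_bound:
  fixes P :: "('x list \<times> 'y list \<times> nat \<times> 'z list) pmf"
  assumes L: "0 < L" "1 \<le> M" and bin: "\<And>i. i < L \<Longrightarrow> bin i \<in> {1..M}" and C: "\<And>i. length (C i) = n"
    and P: "set_pmf P \<subseteq> code_space n M" and c: "0 \<le> c"
  defines "Q \<equiv> codebook_pmf L Vn C"
  assumes tv1: "tv_dist P (map_pmf (relabel bin) Q) \<le> c"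
    and tv2: "tv_dist (map_pmf drop_msg Q) (Tn n) \<le> c"
    and G: "(\<Sum>i<L. \<bar>sum_list (map g (C i)) - n * pex pu g\<bar> / n) / L \<le> c"
  shows "leakage P
    \<le> 6 * (c * log 2 (card (code_space n M :: ('x list \<times> 'y list \<times> nat \<times> 'z list) set)) + 2) + n * c
      + n * (ent T - ent (map_pmf snd T) - pex pu g)"
proof -
  let ?A = "code_space n M :: ('x list \<times> 'y list \<times> nat \<times> 'z list) set"
  define B where "B = c * log 2 (card ?A) + 2"
  define Qb where "Qb = map_pmf (relabel bin) Q"
  have ne: "{..<L} \<noteq> {}" using L by (simp add: lessThan_ne)
  have finQ: "fins Q" unfolding Q_def codebook_pmf_def using ne fins_n by auto
  have setQ: "set_pmf Q \<subseteq> {xs. length xs = n} \<times> {ys. length ys = n} \<times> {..<L} \<times> {zs. length zs = n}"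
  proof
    fix s assume "s \<in> set_pmf Q"
    then obtain i x y z where i: "i < L" "(x, y, z) \<in> set_pmf (Vn (C i))" and s: "s = (x, y, i, z)"
      unfolding Q_def codebook_pmf_def using ne by auto
    have "(x, y, z) \<in> len3 n"
      using set_Vn[OF C, of i] i(2) by (rule subsetD)
    then show "s \<in> {xs. length xs = n} \<times> {ys. length ys = n} \<times> {..<L} \<times> {zs. length zs = n}"
      using i s by simp
  qed
  have setQb: "set_pmf Qb \<subseteq> ?A" unfolding Qb_def code_space_def using setQ bin by fastforce
  have finP: "fins P" "fins Qb" by (rule finite_subset[OF _ finite_code_space], rule P setQb)+
  have F1: "entf P f \<le> entf Qb f + B" "entf Qb f \<le> entf P f + B" for f :: "_ \<Rightarrow> 'k"
    unfolding B_def add.assoc[symmetric]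
    by (rule entf_fannes[OF finite_code_space]; use P setQb tv1 c in \<open>simp add: Qb_def tv_dist_sym\<close>)+
  define Q3 where "Q3 = map_pmf drop_msg Q"
  let ?p = "\<lambda>(x :: 'x list, y :: 'y list, m :: nat, z :: 'z list). (x, y, z)"
  \<comment> \<open>Message 1 lifts every triple into \<open>code_space\<close>, so the triple
    alphabet is no larger and the same error \<open>B\<close> covers \<open>Tn\<close>.\<close>
  have A3: "(len3 n :: ('x list \<times> 'y list \<times> 'z list) set) = ?p ` ?A"
  proof (intro equalityI subsetI)
    fix t :: "'x list \<times> 'y list \<times> 'z list" assume "t \<in> len3 n"
    then obtain xs ys zs where "t = ?p (xs, ys, 1, zs)" "length xs = n" "length ys = n" "length zs = n" by auto
    then show "t \<in> ?p ` ?A" using L by (intro image_eqI[of _ _ "(xs, ys, 1, zs)"]) (auto simp: code_space_def)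
  qed (auto simp: code_space_def)
  have F2: "entf Q3 f \<le> entf (Tn n) f + B" "entf (Tn n) f \<le> entf Q3 f + B" for f :: "_ \<Rightarrow> 'k"
  proof -
    have s: "set_pmf Q3 \<subseteq> ?p ` ?A" unfolding A3[symmetric] using setQ by (auto simp: Q3_def)
    have s': "set_pmf (Tn n) \<subseteq> ?p ` ?A" unfolding A3[symmetric] by (rule set_Tn)
    have "?A \<noteq> {}" using P set_pmf_not_empty[of P] by auto
    then have "0 < card (?p ` ?A)" using finite_imageI[OF finite_code_space] by (simp only: card_gt_0_iff image_is_empty simp_thms)
    moreover have "card (?p ` ?A) \<le> card ?A" by (rule card_image_le) (rule finite_code_space)
    ultimately have le: "c * log 2 (card (?p ` ?A)) + 2 \<le> B" unfolding B_def using c by (simp add: mult_left_mono)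
    have "entf Q3 f \<le> entf (Tn n) f + c * log 2 (card (?p ` ?A)) + 2"
      by (rule entf_fannes) (use s s' tv2 c in \<open>auto simp: Q3_def tv_dist_sym finite_code_space\<close>)
    then show "entf Q3 f \<le> entf (Tn n) f + B" using le by simp
    have "entf (Tn n) f \<le> entf Q3 f + c * log 2 (card (?p ` ?A)) + 2"
      by (rule entf_fannes) (use s s' tv2 c in \<open>auto simp: Q3_def tv_dist_sym finite_code_space\<close>)
    then show "entf (Tn n) f \<le> entf Q3 f + B" using le by simp
  qed
  let ?m = "\<lambda>(xs,ys,m,zs). m" and ?x = "\<lambda>(xs,ys,m,zs). xs" and ?yz = "\<lambda>(xs,ys,m,zs). (ys,zs)"
  have "cmi P ?m ?x ?yz \<le> entf Qb (\<lambda>s. (?m s, ?yz s)) + entf Qb (\<lambda>s. (?x s, ?yz s))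
      - entf Qb (\<lambda>s. (?m s, ?x s, ?yz s)) - entf Qb ?yz + 4 * B"
    unfolding cmi_eq_entf[OF finP(1)]
    using F1(1)[of "\<lambda>s. (?m s, ?yz s)"] F1(1)[of "\<lambda>s. (?x s, ?yz s)"] F1(2)[of "\<lambda>s. (?m s, ?x s, ?yz s)"] F1(2)[of ?yz]
    by simp
  also have "entf Qb (\<lambda>s. (?m s, ?yz s)) = entf Q (\<lambda>s. (bin (?m s), ?yz s))"
    unfolding entf_def Qb_def map_pmf_comp by (simp add: split_def)
  also have "entf Qb (\<lambda>s. (?m s, ?x s, ?yz s)) = entf Q (\<lambda>s. (?x s, bin (?m s), ?yz s))"
  proof -
    have "entf Qb (\<lambda>s. (?m s, ?x s, ?yz s)) = entf Q (\<lambda>s. (bin (?m s), ?x s, ?yz s))"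
      unfolding entf_def Qb_def map_pmf_comp by (simp add: split_def)
    also have "\<dots> = entf Q (\<lambda>s. (?x s, bin (?m s), ?yz s))" by (rule entf_cong_iff) auto
    finally show ?thesis .
  qed
  also have "entf Qb (\<lambda>s. (?x s, ?yz s)) = entf Q3 (\<lambda>s. s)"
    unfolding entf_def Qb_def Q3_def map_pmf_comp by (simp add: split_def)
  also have "entf Qb ?yz = entf Q3 snd"
    unfolding entf_def Qb_def Q3_def map_pmf_comp by (simp add: split_def)
  finally have 1: "cmi P ?m ?x ?yz \<le> entf Q (\<lambda>s. (bin (?m s), ?yz s)) + entf Q3 (\<lambda>s. s)
      - entf Q (\<lambda>s. (?x s, bin (?m s), ?yz s)) - entf Q3 snd + 4 * B" .
  have 2: "entf Q3 (\<lambda>s. s) \<le> n * ent T + B" using F2(1)[of "\<lambda>s. s"] by (simp add: entf_def ent_Tn)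
  have 3: "n * ent (map_pmf snd T) \<le> entf Q3 snd + B" using F2(2)[of snd] by (simp add: entf_def ent_snd_Tn)
  \<comment> \<open>Conditioning \<open>x\<close> on the index instead of its bin can only lower its
    entropy.\<close>
  have 4: "entf Q (\<lambda>s. (bin (?m s), ?yz s)) - entf Q (\<lambda>s. (?x s, bin (?m s), ?yz s))
      \<le> entf Q (\<lambda>s. (?m s, ?yz s)) - entf Q (\<lambda>s. (?m s, ?x s, ?yz s))"
  proof -
    have "entf Q (\<lambda>s. (?x s, ?m s, (bin (?m s), ?yz s))) + entf Q (\<lambda>s. (bin (?m s), ?yz s))
      \<le> entf Q (\<lambda>s. (?x s, (bin (?m s), ?yz s))) + entf Q (\<lambda>s. (?m s, (bin (?m s), ?yz s)))"
      by (rule entf_ssa[OF finQ])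
    moreover have "entf Q (\<lambda>s. (?x s, ?m s, (bin (?m s), ?yz s))) = entf Q (\<lambda>s. (?m s, ?x s, ?yz s))"
      by (rule entf_cong_iff) auto
    moreover have "entf Q (\<lambda>s. (?m s, (bin (?m s), ?yz s))) = entf Q (\<lambda>s. (?m s, ?yz s))"
      by (rule entf_cong_iff) auto
    ultimately show ?thesis by simp
  qed
  let ?U = "pmf_of_set {..<L}"
  have finU: "fins ?U" using ne by simp
  have 5: "entf Q (\<lambda>s. (?m s, ?x s, ?yz s)) = ent ?U + pex ?U (\<lambda>i. ent (Vn (C i)))"
  proof -
    have "map_pmf (\<lambda>s. (?m s, ?x s, ?yz s)) Q = bind_pmf ?U (\<lambda>i. map_pmf (Pair i) (Vn (C i)))"
      unfolding Q_def codebook_pmf_def map_bind_pmf map_pmf_comp by (simp add: split_def)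
    then show ?thesis unfolding entf_def using ent_bind_Pair[OF finU, of "\<lambda>i. Vn (C i)"] fins_n by simp
  qed
  have 6: "entf Q (\<lambda>s. (?m s, ?yz s)) = ent ?U + pex ?U (\<lambda>i. ent (map_pmf snd (Vn (C i))))"
  proof -
    have "map_pmf (\<lambda>s. (?m s, ?yz s)) Q = bind_pmf ?U (\<lambda>i. map_pmf (Pair i) (map_pmf snd (Vn (C i))))"
      unfolding Q_def codebook_pmf_def map_bind_pmf map_pmf_comp by (simp add: split_def)
    then show ?thesis unfolding entf_def using ent_bind_Pair[OF finU, of "\<lambda>i. map_pmf snd (Vn (C i))"] fins_n by simp
  qed
  have "pex ?U (\<lambda>i. ent (map_pmf snd (Vn (C i)))) - pex ?U (\<lambda>i. ent (Vn (C i))) = - pex ?U (\<lambda>i. sum_list (map g (C i)))"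
    unfolding pex_diff[symmetric] pex_uminus[symmetric] ent_Vn ent_snd_Vn g_def
    by (simp add: sum_list_subtractf)
  also have "\<dots> \<le> n * c - n * pex pu g"
  proof -
    have "n * pex pu g - pex ?U (\<lambda>i. sum_list (map g (C i))) = pex ?U (\<lambda>i. n * pex pu g - sum_list (map g (C i)))"
      by (simp add: pex_diff pex_const[OF finU])
    also have "\<dots> \<le> pex ?U (\<lambda>i. n * (\<bar>sum_list (map g (C i)) - n * pex pu g\<bar> / n))"
    proof (rule pex_mono)
      fix i
      show "n * pex pu g - sum_list (map g (C i)) \<le> n * (\<bar>sum_list (map g (C i)) - n * pex pu g\<bar> / n)"
        \<comment> \<open>For n = 0 division by n erases the deviation, but then the codeword is
          empty and the deviation is 0 anyway.\<close>
        using C[of i] by (cases "n = 0") auto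
    qed
    also have "\<dots> = n * ((\<Sum>i<L. \<bar>sum_list (map g (C i)) - n * pex pu g\<bar> / n) / L)"
      unfolding pex_cmult using ne by (simp add: pex_pmf_of_set)
    also have "\<dots> \<le> n * c" using G by (intro mult_left_mono) auto
    finally show ?thesis by simp
  qed
  finally have "entf Q (\<lambda>s. (?m s, ?yz s)) - entf Q (\<lambda>s. (?m s, ?x s, ?yz s)) \<le> n * c - n * pex pu g"
    unfolding 5 6 by simp
  then have "cmi P ?m ?x ?yz \<le> 6 * B + n * c + (n * ent T - n * ent (map_pmf snd T) - n * pex pu g)"
    using 1 2 3 4 by linarith
  then show ?thesis unfolding B_def by (simp add: algebra_simps)
qed

end

subsection \<open>Achievability\<close>

lemma pex_info_density:
  assumes "fins pu" "\<And>u. fins (V u)"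
  shows "pex (bind_pmf pu (\<lambda>u. map_pmf (Pair u) (V u))) (\<lambda>(u, w). log 2 (pmf (V u) w / pmf (bind_pmf pu V) w))
    = ent (bind_pmf pu V) - pex pu (\<lambda>u. ent (V u))"
proof -
  have "pex (bind_pmf pu (\<lambda>u. map_pmf (Pair u) (V u))) (\<lambda>(u, w). log 2 (pmf (V u) w / pmf (bind_pmf pu V) w))
    = pex pu (\<lambda>u. pex (V u) (\<lambda>w. log 2 (pmf (V u) w / pmf (bind_pmf pu V) w)))"
    using assms by (simp add: pex_bind pex_map)
  also have "\<dots> = pex pu (\<lambda>u. pex (V u) (\<lambda>w. - log 2 (pmf (bind_pmf pu V) w) - (- log 2 (pmf (V u) w))))"
  proof (intro pex_cong)
    fix u w assume "u \<in> set_pmf pu" "w \<in> set_pmf (V u)"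
    then have "0 < pmf (V u) w" "0 < pmf (bind_pmf pu V) w" by (auto intro!: pmf_positive)
    then show "log 2 (pmf (V u) w / pmf (bind_pmf pu V) w) = - log 2 (pmf (bind_pmf pu V) w) - (- log 2 (pmf (V u) w))"
      by (simp add: log_divide)
  qed
  also have "\<dots> = pex (bind_pmf pu V) (\<lambda>w. - log 2 (pmf (bind_pmf pu V) w)) - pex pu (\<lambda>u. ent (V u))"
    using assms by (simp only: pex_diff pex_bind ent_pex)
  finally show ?thesis by (simp only: ent_pex)
qed

section \<open>Sequences of codes, rounding of rates and block codes\<close>

text \<open>\<open>achievable\<close> asks for one sequence of codes that serves every eps. Choosing
  for each n within 1 / (n + 1) of the infimal cost gives such a sequence; nonnegativity bounds the
  costs below.\<close>

lemma near_optimal_choice: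
  fixes E :: "nat \<Rightarrow> 'c \<Rightarrow> real"
  assumes "\<And>n. \<exists>c. valid n c" "\<And>n c. valid n c \<Longrightarrow> 0 \<le> E n c"
    "\<And>eps. 0 < eps \<Longrightarrow> eventually (\<lambda>n. \<exists>c. valid n c \<and> E n c \<le> eps) sequentially"
  shows "\<exists>c. (\<forall>n. valid n (c n)) \<and> (\<forall>eps>0. eventually (\<lambda>n. E n (c n) \<le> eps) sequentially)"
proof -
  define I where "I n = Inf (E n ` {c. valid n c})" for n
  have bdd: "bdd_below (E n ` {c. valid n c})" for n using assms(2) by (intro bdd_belowI[of _ 0]) auto
  have "\<exists>c. valid n c \<and> E n c < I n + 1 / Suc n" for n
  proof -
    have ne: "E n ` {c. valid n c} \<noteq> {}" using assms(1) by auto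
    have lt: "Inf (E n ` {c. valid n c}) < I n + 1 / Suc n" by (simp add: I_def)
    obtain e where "e \<in> E n ` {c. valid n c}" "e < I n + 1 / Suc n"
      using cInf_lessD[OF ne lt] by blast
    then show ?thesis by auto
  qed
  then obtain c where c: "\<And>n. valid n (c n)" "\<And>n. E n (c n) < I n + 1 / Suc n" by metis
  have "eventually (\<lambda>n. E n (c n) \<le> eps) sequentially" if e: "0 < eps" for eps
  proof -
    have "eventually (\<lambda>n. inverse (real (Suc n)) < eps / 2) sequentially"
      using order_tendstoD(2)[OF LIMSEQ_inverse_real_of_nat, of "eps / 2"] e by simp
    moreover have "eventually (\<lambda>n. \<exists>c. valid n c \<and> E n c \<le> eps / 2) sequentially" using assms(3)[of "eps / 2"] e by simp
    ultimately show ?thesis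
    proof eventually_elim
      case (elim n)
      then obtain c' where c': "valid n c'" "E n c' \<le> eps / 2" by auto
      have "I n \<le> E n c'" unfolding I_def using bdd c' by (intro cInf_lower) auto
      then show ?case using c(2)[of n] c' elim(1) by (simp add: inverse_eq_divide)
    qed
  qed
  then show ?thesis using c(1) by blast
qed

lemma eventually_powr_le:
  fixes eps d :: real
  assumes "0 < d" "0 < eps"
  shows "eventually (\<lambda>n. 2 powr (- (real n * d)) \<le> eps) sequentially"
proof -
  have "(\<lambda>n. (2 powr (- d)) ^ n) \<longlonglongrightarrow> 0"
    by (rule LIMSEQ_realpow_zero) (use assms in \<open>auto simp: powr_less_one\<close>)
  then have "eventually (\<lambda>n. (2 powr (- d)) ^ n < eps) sequentially"
    using assms by (intro order_tendstoD(2)) auto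
  then show ?thesis
  proof eventually_elim
    case (elim n)
    have "(2 powr (- d)) ^ n = 2 powr (- (real n * d))"
      by (subst powr_realpow[symmetric]) (auto simp: powr_powr mult.commute)
    then show ?case using elim by simp
  qed
qed

text \<open>For R \<ge> 0 the ceiling at most doubles 2^(nR), hence one extra bit.\<close>

lemma msg_size_bounds:
  "2 powr (real n * R) \<le> real (msg_size n R)" "0 \<le> R \<Longrightarrow> log 2 (msg_size n R) \<le> n * R + 1" "1 \<le> msg_size n R"
proof -
  have p: "0 < 2 powr (real n * R)" by simp
  then have c: "1 \<le> \<lceil>2 powr (real n * R)\<rceil>" by linarith
  then show m1: "1 \<le> msg_size n R" unfolding msg_size_def by linarith
  have r: "real (msg_size n R) = of_int \<lceil>2 powr (real n * R)\<rceil>" unfolding msg_size_def using c by simp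
  show "2 powr (real n * R) \<le> real (msg_size n R)" unfolding r by linarith
  assume "0 \<le> R"
  then have "1 \<le> 2 powr (real n * R)" by (simp add: ge_one_powr_ge_zero)
  then have "real (msg_size n R) \<le> 2 * 2 powr (real n * R)" unfolding r by linarith
  then have "log 2 (real (msg_size n R)) \<le> log 2 (2 * 2 powr (real n * R))"
    using m1 by simp
  also have "\<dots> = n * R + 1" by (subst log_mult) auto
  finally show "log 2 (msg_size n R) \<le> n * R + 1" .
qed

lemma src_pmf_eq: "src_pmf pXY pZ n = map_pmf unzip3 (iid n (bind_pmf pXY (\<lambda>(x, y). map_pmf (\<lambda>z. (x, y, z)) (pZ x y))))"
proof -
  have 1: "map_pmf unzip3 (seq_pmf (map (\<lambda>(x, y). map_pmf (\<lambda>z. (x, y, z)) (pZ x y)) xys))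
     = bind_pmf (seq_pmf (map (\<lambda>(x, y). pZ x y) xys)) (\<lambda>zs. return_pmf (map fst xys, map snd xys, zs))" for xys
  proof (induction xys)
    case (Cons p xys)
    obtain x y where p: "p = (x, y)" by (cases p)
    let ?S = "seq_pmf (map (\<lambda>(x, y). map_pmf (\<lambda>z. (x, y, z)) (pZ x y)) xys)"
    have "map_pmf unzip3 (seq_pmf (map (\<lambda>(x, y). map_pmf (\<lambda>z. (x, y, z)) (pZ x y)) (p # xys)))
      = bind_pmf (pZ x y) (\<lambda>z. map_pmf (\<lambda>(xs, ys, zs). (x # xs, y # ys, z # zs)) (map_pmf unzip3 ?S))"
      by (simp add: p map_bind_pmf bind_map_pmf map_pmf_comp) (simp add: unzip3_Cons map_pmf_def split_def)
    also have "\<dots> = bind_pmf (seq_pmf (map (\<lambda>(x, y). pZ x y) (p # xys))) (\<lambda>zs. return_pmf (map fst (p # xys), map snd (p # xys), zs))"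
      unfolding Cons by (simp add: p map_bind_pmf bind_assoc_pmf bind_return_pmf)
    finally show ?case .
  qed (simp add: unzip3_def bind_return_pmf)
  show ?thesis unfolding src_pmf_def seq_replicate_bind map_bind_pmf 1 ..
qed

text \<open>The decoders need to agree only on lists of length n, since no others occur.\<close>

lemma code_pmf_one_shot:
  assumes "pXY = bind_pmf px (\<lambda>x. map_pmf (Pair x) (py x))"
    and "\<And>m ys. length ys = n \<Longrightarrow> dec m ys = dec' m ys"
  shows "code_pmf pXY n enc dec = one_shot_pmf (iid n px) (\<lambda>xs. seq_pmf (map py xs)) enc dec'"
proof -
  have "code_pmf pXY n enc dec = bind_pmf (iid n px) (\<lambda>xs. bind_pmf (seq_pmf (map py xs)) (\<lambda>ys.
     bind_pmf (enc (map fst (zip xs ys))) (\<lambda>m. bind_pmf (dec m (map snd (zip xs ys))) (\<lambda>zs.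
     return_pmf (map fst (zip xs ys), map snd (zip xs ys), m, zs)))))"
    unfolding code_pmf_def assms(1) seq_replicate_bind seq_pmf_map_Pair by (simp add: bind_assoc_pmf bind_map_pmf)
  also have "\<dots> = bind_pmf (iid n px) (\<lambda>xs. bind_pmf (seq_pmf (map py xs)) (\<lambda>ys.
     bind_pmf (enc xs) (\<lambda>m. bind_pmf (dec' m ys) (\<lambda>zs. return_pmf (xs, ys, m, zs)))))"
  proof (intro bind_pmf_cong refl)
    fix xs ys m assume "xs \<in> set_pmf (iid n px)" "ys \<in> set_pmf (seq_pmf (map py xs))"
    then have l: "length xs = n" "length ys = n" by (auto dest!: length_seq_pmf)
    then show "enc (map fst (zip xs ys)) = enc xs" by simp
    show "dec m (map snd (zip xs ys)) = dec' m ys" using l assms(2) by simp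
    fix zs
    show "return_pmf (map fst (zip xs ys), map snd (zip xs ys), m, zs) = return_pmf (xs, ys, m, zs)" using l by simp
  qed
  finally show ?thesis unfolding one_shot_pmf_def map_pmf_def .
qed

lemma set_code_pmf:
  assumes "\<And>xs. set_pmf (enc xs) \<subseteq> {1..M}" "\<And>m ys. set_pmf (dec m ys) \<subseteq> {zs. length zs = n}"
  shows "set_pmf (code_pmf pXY n enc dec) \<subseteq> code_space n M"
  unfolding code_pmf_def code_space_def using assms by (fastforce dest!: length_seq_pmf)

text \<open>Bins are blocks of K consecutive indices, numbered from 1 because messages start at
  1.\<close>

lemma card_bin_le:
  fixes K L i :: nat
  assumes "0 < K"
  shows "card {j. j < L \<and> j div K + 1 = i div K + 1} \<le> K"
proof -
  have "{j. j < L \<and> j div K + 1 = i div K + 1} \<subseteq> {i div K * K..<i div K * K + K}"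
  proof
    fix j assume "j \<in> {j. j < L \<and> j div K + 1 = i div K + 1}"
    then have e: "j div K = i div K" by simp
    have "j = j div K * K + j mod K" "j mod K < K" using assms by simp_all
    then show "j \<in> {i div K * K..<i div K * K + K}" unfolding e by auto
  qed
  from card_mono[OF _ this] show ?thesis by simp
qed

context aux_channel
begin

definition "PY = bind_pmf pu VY"

lemma VYn: "map_pmf mid3 (Vn us) = seq_pmf (map VY us)"
proof -
  have "map_pmf mid3 (Vn us) = map_pmf (map mid3) (seq_pmf (map V us))"
    unfolding Vn map_pmf_comp by (simp add: unzip3_def split_def comp_def)
  then show ?thesis unfolding seq_pmf_map[symmetric] VY_def by simp
qed

text \<open>With M messages and K codewords per message the codebook has L = M * K entries. K
  slightly below 2^(n I(U;Y)) keeps bins decodable, and the rate hypothesis then makes L exceed 2^(n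
  I(U;XYZ)), as covering requires.\<close>

lemma exists_codebook:
  fixes R eps :: real
  assumes R: "(ent T - pex pu (\<lambda>u. ent (V u))) - (ent PY - pex pu (\<lambda>u. ent (VY u))) < R" and e: "0 < eps"
  shows "eventually (\<lambda>n. \<exists>L bin C enc dec. 0 < L \<and> (\<forall>i<L. bin i \<in> {1..msg_size n R}) \<and> (\<forall>i. length (C i) = n) \<and>
     (\<forall>x. set_pmf (enc x) \<subseteq> {1..msg_size n R}) \<and>
     tv_dist (one_shot_pmf (map_pmf fst (Tn n)) pyn enc (\<lambda>m y. qn (C (dec m y)) y))
        (map_pmf (relabel bin) (codebook_pmf L Vn C)) \<le> eps \<and>
     tv_dist (map_pmf drop_msg (codebook_pmf L Vn C)) (Tn n) \<le> eps \<and>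
     (\<Sum>i<L. \<bar>sum_list (map g (C i)) - n * pex pu g\<bar> / n) / L \<le> eps) sequentially"
proof -
  define IW where "IW = ent T - pex pu (\<lambda>u. ent (V u))"
  define IY where "IY = ent PY - pex pu (\<lambda>u. ent (VY u))"
  \<comment> \<open>A quarter of the rate gap: L is at least 2^(n(IW + 3d)) against the covering
    threshold 2^(n(IW + d)), and K is about 2^(n(IY - d)) against the packing threshold 2^(n(IY -
    d/2)).\<close>
  define d where "d = (R - (IW - IY)) / 4"
  have d: "0 < d" "0 < d / 2" using R by (simp_all add: d_def IW_def IY_def)
  \<comment> \<open>One fifth for each of the five terms in the hypothesis of
    \<open>one_shot\<close>.\<close>
  have e5: "0 < eps / 5" using e by simp
  have IW: "IW = pex (bind_pmf pu (\<lambda>u. map_pmf (Pair u) (V u))) (\<lambda>(u, w). log 2 (pmf (V u) w / pmf (bind_pmf pu V) w))"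
    by (subst pex_info_density) (simp_all add: fin_pu IW_def T_def)
  have IY: "IY = pex (bind_pmf pu (\<lambda>u. map_pmf (Pair u) (VY u))) (\<lambda>(u, w). log 2 (pmf (VY u) w / pmf (bind_pmf pu VY) w))"
    by (subst pex_info_density) (simp_all add: fin_pu IY_def PY_def)
  note ev1 = info_density_concentration(1)[OF fin_pu fins_finite_type e5 d(1), of V, folded IW T_def]
  note ev2 = info_density_concentration(2)[OF fin_pu fins_finite_type e5 d(2), of VY, folded IY PY_def]
  note ev3 = lln_L1[OF fin_pu e5, of g]
  note ev4 = eventually_powr_le[OF d(1) e5]
  note ev5 = eventually_powr_le[OF d(2) e5]
  show ?thesis using ev1 ev2 ev3 ev4 ev5 eventually_gt_at_top[of 0]
  proof eventually_elim
    case (elim n)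
    define K where "K = nat \<lceil>2 powr (real n * (IY - d))\<rceil>"
    define M where "M = msg_size n R"
    define L where "L = M * K"
    define thr where "thr = 2 powr (real n * (IW + d))"
    define thr' where "thr' = 2 powr (real n * (IY - d / 2))"
    define bin where "bin i = i div K + 1" for i
    let ?s2 = "pex (pun n) (\<lambda>us. pex (Vn us) (\<lambda>w. of_bool (thr * pmf (Tn n) w < pmf (Vn us) w)))"
    let ?s3 = "pex (pun n) (\<lambda>us. pex (map_pmf mid3 (Vn us)) (\<lambda>w. of_bool (\<not> thr' *
          pmf (bind_pmf (pun n) (\<lambda>us. map_pmf mid3 (Vn us))) w < pmf (map_pmf mid3 (Vn us)) w)))"
    have pos: "0 < thr" "0 < thr'" by (simp_all add: thr_def thr'_def)
    have Kc: "1 \<le> \<lceil>2 powr (real n * (IY - d))\<rceil>"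
    proof -
      have "0 < 2 powr (real n * (IY - d))" by simp
      then show ?thesis by linarith
    qed
    then have K1: "1 \<le> K" unfolding K_def by linarith
    have Kr: "real K = of_int \<lceil>2 powr (real n * (IY - d))\<rceil>" unfolding K_def using Kc by simp
    \<comment> \<open>Rounding up adds less than 1, which the count K - 1 in \<open>packing\<close>
      absorbs.\<close>
    have K: "2 powr (real n * (IY - d)) \<le> real K" "real K - 1 \<le> 2 powr (real n * (IY - d))" unfolding Kr by linarith+
    have M: "2 powr (real n * R) \<le> real M" "1 \<le> M" unfolding M_def by (rule msg_size_bounds)+
    have L: "0 < L" using K1 M by (simp add: L_def)
    have Lr: "2 powr (real n * R) * 2 powr (real n * (IY - d)) \<le> real L"
      unfolding L_def of_nat_mult using M K by (intro mult_mono) auto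
    have bin: "bin i \<in> {1..M}" if "i < L" for i
    proof -
      have "i div K < M" using that by (simp add: L_def less_mult_imp_div_less)
      then show ?thesis by (simp add: bin_def)
    qed
    have s1: "sqrt (thr / L) / 2 \<le> eps / 5"
    proof -
      have "thr / L \<le> thr / (2 powr (real n * R) * 2 powr (real n * (IY - d)))"
        using Lr pos L by (intro divide_left_mono) auto
      also have "\<dots> = 2 powr (real n * (IW + d) - (real n * R + real n * (IY - d)))"
        unfolding thr_def by (simp add: powr_diff powr_add)
      also have "real n * (IW + d) - (real n * R + real n * (IY - d)) = - (real n * d) + - (real n * d)"
        unfolding d_def by (simp add: field_simps)
      also have "2 powr \<dots> = (2 powr (- (real n * d)))\<^sup>2" by (simp only: powr_add power2_eq_square)
      finally have "sqrt (thr / L) \<le> 2 powr (- (real n * d))" using real_sqrt_le_mono by fastforce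
      moreover have "0 \<le> sqrt (thr / L)" using pos by simp
      ultimately show ?thesis using elim(4) by linarith
    qed
    have s4: "(real K - 1) / thr' \<le> eps / 5"
    proof -
      have "(real K - 1) / thr' \<le> 2 powr (real n * (IY - d)) / thr'" using K pos by (intro divide_right_mono) auto
      also have "\<dots> = 2 powr (real n * (IY - d) - real n * (IY - d / 2))" unfolding thr'_def by (simp add: powr_diff)
      also have "real n * (IY - d) - real n * (IY - d / 2) = - (real n * (d / 2))" by (simp add: field_simps)
      finally show ?thesis using elim(5) by linarith
    qed
    have s2: "?s2 \<le> eps / 5"
    proof -
      have f: "fins (seq_pmf (map V us))" for us by (rule fins_seq_pmf) simp
      show ?thesis using elim(1) unfolding thr_def Vn Tn pex_map[OF f] pun_def by (simp add: pmf_map_inj'[OF inj_unzip3])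
    qed
    have s3: "?s3 \<le> eps / 5"
      using elim(2) unfolding VYn thr'_def pun_def seq_replicate_bind[symmetric] PY_def .
    define G where "G us = \<bar>sum_list (map g us) - n * pex pu g\<bar> / n" for us
    have s5: "pex (pun n) G \<le> eps / 5"
      unfolding G_def pex_divide using elim(3,6) by (simp add: pun_def field_simps)
    have tot: "sqrt (thr / L) / 2 + ?s2
     + (?s3
       + (real K - 1) / thr') + pex (pun n) G \<le> eps"
      using s1 s2 s3 s4 s5 by linarith
    have bins: "card {j. j < L \<and> bin j = bin i} \<le> K" for i unfolding bin_def by (rule card_bin_le) (use K1 in simp)
    have G0: "0 \<le> G us" for us by (simp add: G_def)
    from one_shot[of "pun n" an pyn qn L thr thr' G bin K, OF fins_n(5,1,2,3) L pos G0 bins, folded Vn_def, folded Tn_def, OF tot]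
    obtain C enc dec where *: "\<forall>i. C i \<in> set_pmf (pun n)" "\<forall>x. set_pmf (enc x) \<subseteq> bin ` {..<L}"
      "tv_dist (one_shot_pmf (map_pmf fst (Tn n)) pyn enc (\<lambda>m y. qn (C (dec m y)) y))
        (map_pmf (relabel bin) (codebook_pmf L Vn C)) \<le> eps"
      "tv_dist (map_pmf drop_msg (codebook_pmf L Vn C)) (Tn n) \<le> eps"
      "(\<Sum>i<L. G (C i)) / L \<le> eps" by blast
    have "\<forall>i. length (C i) = n"
    proof
      fix i
      show "length (C i) = n" using length_seq_pmf[of "C i"] *(1) unfolding pun_def by fastforce
    qed
    moreover have "\<forall>x. set_pmf (enc x) \<subseteq> {1..msg_size n R}" using *(2) bin unfolding M_def by blast
    ultimately show ?case using * L bin unfolding G_def M_def by blast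
  qed
qed

text \<open>Assumption \<open>leak\<close> says H(X|U,Y,Z) = H(X|Y,Z). It cancels the main term of
  \<open>leakage_bound\<close>, leaving errors proportional to the codebook accuracy and a
  constant.\<close>

lemma achievable_if_rate_gt:
  fixes R :: real and pXY :: "('x \<times> 'y) pmf"
  assumes R: "(ent T - pex pu (\<lambda>u. ent (V u))) - (ent PY - pex pu (\<lambda>u. ent (VY u))) < R" and R0: "0 \<le> R"
    and pXY: "pXY = bind_pmf (map_pmf fst T) (\<lambda>x. map_pmf (Pair x) (py x))"
    and T: "T = bind_pmf pXY (\<lambda>(x, y). map_pmf (\<lambda>z. (x, y, z)) (pZ x y))"
    and leak: "pex pu g = ent T - ent (map_pmf snd T)"
  shows "achievable pXY pZ R"
proof -
  define b where "b = log 2 (CARD('x)) + log 2 (CARD('y)) + log 2 (CARD('z)) + R"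
  have b0: "0 \<le> b" unfolding b_def using R0 by (intro add_nonneg_nonneg) (auto simp: Suc_le_eq)
  define valid where "valid n c = ((\<forall>xs. set_pmf (fst c xs) \<subseteq> {1..msg_size n R}) \<and> (\<forall>m ys. set_pmf (snd c m ys) \<subseteq> {zs. length zs = n}))"
    for n and c :: "('x list \<Rightarrow> nat pmf) \<times> (nat \<Rightarrow> 'y list \<Rightarrow> 'z list pmf)"
  define tv where "tv n c = tv_dist (map_pmf drop_msg (code_pmf pXY n (fst c) (snd c))) (src_pmf pXY pZ n)"
    for n and c :: "('x list \<Rightarrow> nat pmf) \<times> (nat \<Rightarrow> 'y list \<Rightarrow> 'z list pmf)"
  define lk where "lk n c = leakage (code_pmf pXY n (fst c) (snd c))"
    for n and c :: "('x list \<Rightarrow> nat pmf) \<times> (nat \<Rightarrow> 'y list \<Rightarrow> 'z list pmf)"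
  \<comment> \<open>Both requirements are merged into the single cost that
    \<open>near_optimal_choice\<close> handles.\<close>
  define E where "E n c = max (tv n c) (lk n c / n)" for n c
  have src: "src_pmf pXY pZ n = Tn n" for n unfolding src_pmf_eq Tn T[symmetric] ..
  have space: "set_pmf (code_pmf pXY n (fst c) (snd c)) \<subseteq> code_space n (msg_size n R)" if "valid n c" for n c
    using that by (intro set_code_pmf) (auto simp: valid_def)
  have fin: "fins (code_pmf pXY n (fst c) (snd c))" if "valid n c" for n c
    using space[OF that] finite_code_space finite_subset by blast
  have "\<exists>c. (\<forall>n. valid n (c n)) \<and> (\<forall>eps>0. eventually (\<lambda>n. E n (c n) \<le> eps) sequentially)"
  proof (rule near_optimal_choice)
    fix n
    show "\<exists>c. valid n c"
      using msg_size_bounds(3)[of n R]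
      by (intro exI[of _ "(\<lambda>_. return_pmf 1, \<lambda>_ _. return_pmf (replicate n undefined))"]) (auto simp: valid_def)
  next
    fix n c assume "valid n c"
    then show "0 \<le> E n c" unfolding E_def tv_def src using fin fins_n by (simp add: le_max_iff_disj tv_dist_nonneg)
  next
    fix eps :: real assume e: "0 < eps"
    \<comment> \<open>The leakage is at most 6c(nb + 1) + nc + 12, and 6c + nc \<le> 9nc for n \<ge>
      1. With this \<open>c\<close> the linear part is n * eps / 2, and n \<ge> 24 / eps absorbs the
      12, which is six times the constant 2 of \<open>fannes\<close>.\<close>
    define c where "c = eps / (2 * (6 * b + 9))"
    have c: "0 < c" "c * (6 * b + 9) = eps / 2" using e b0 by (simp_all add: c_def field_simps)
    have "eventually (\<lambda>n. 24 / eps \<le> real n) sequentially"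
      by (rule eventually_sequentiallyI[of "nat \<lceil>24 / eps\<rceil>"]) linarith
    then show "eventually (\<lambda>n. \<exists>c. valid n c \<and> E n c \<le> eps) sequentially"
      using exists_codebook[OF R c(1)] eventually_gt_at_top[of 0]
    proof eventually_elim
      case (elim n)
      from elim(2) obtain L bin C enc dec where *: "0 < L" "\<And>i. i < L \<Longrightarrow> bin i \<in> {1..msg_size n R}" "\<And>i. length (C i) = n"
        "\<And>x. set_pmf (enc x) \<subseteq> {1..msg_size n R}"
        "tv_dist (one_shot_pmf (map_pmf fst (Tn n)) pyn enc (\<lambda>m y. qn (C (dec m y)) y))
          (map_pmf (relabel bin) (codebook_pmf L Vn C)) \<le> c"
        "tv_dist (map_pmf drop_msg (codebook_pmf L Vn C)) (Tn n) \<le> c"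
        "(\<Sum>i<L. \<bar>sum_list (map g (C i)) - n * pex pu g\<bar> / n) / L \<le> c" by blast
      define dec' where "dec' m ys = (if length ys = n then qn (C (dec m ys)) ys else return_pmf (replicate n undefined))" for m ys
      have v: "valid n (enc, dec')"
        using *(3,4) by (auto simp: valid_def dec'_def qn_def dest!: length_seq_pmf)
      define P where "P = code_pmf pXY n enc dec'"
      have px: "map_pmf fst (Tn n) = iid n (map_pmf fst T)"
        using seq_pmf_map[of fst "\<lambda>_. T" "replicate n ()"] by (simp add: Tn map_pmf_comp unzip3_def)
      have P: "P = one_shot_pmf (map_pmf fst (Tn n)) pyn enc (\<lambda>m y. qn (C (dec m y)) y)"
        unfolding P_def px pyn_def[abs_def] by (rule code_pmf_one_shot[OF pXY]) (simp add: dec'_def)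
      let ?Q = "codebook_pmf L Vn C"
      let ?Qb = "map_pmf (relabel bin) ?Q"
      have finP: "fins P" using fin[OF v] by (simp add: P_def)
      have finQ: "fins ?Q" unfolding codebook_pmf_def using *(1) fins_n by (auto simp: lessThan_ne)
      have t: "tv n (enc, dec') \<le> 2 * c"
      proof -
        have "tv_dist (map_pmf drop_msg P) (map_pmf drop_msg ?Qb) \<le> tv_dist P ?Qb"
          by (rule tv_dist_map_le) (use finP finQ in auto)
        also have "\<dots> \<le> c" using *(5) by (simp add: P)
        also have "map_pmf drop_msg ?Qb = map_pmf drop_msg ?Q"
          by (simp add: map_pmf_comp split_def)
        finally have "tv_dist (map_pmf drop_msg P) (map_pmf drop_msg ?Q) \<le> c" .
        moreover have "tv_dist (map_pmf drop_msg P) (Tn n)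
           \<le> tv_dist (map_pmf drop_msg P) (map_pmf drop_msg ?Q)
             + tv_dist (map_pmf drop_msg ?Q) (Tn n)"
          by (rule tv_dist_triangle) (use finP finQ fins_n in auto)
        ultimately show ?thesis using *(6) unfolding tv_def src P_def by simp
      qed
      have l: "lk n (enc, dec') / n \<le> eps"
      proof -
        let ?N = "real (card (code_space n (msg_size n R) :: ('x list \<times> 'y list \<times> nat \<times> 'z list) set))"
        have "lk n (enc, dec') \<le> 6 * (c * log 2 ?N + 2) + n * c + n * (ent T - ent (map_pmf snd T) - pex pu g)"
          unfolding lk_def fst_conv snd_conv P_def[symmetric]
          by (rule leakage_bound[OF *(1) msg_size_bounds(3) *(2) *(3)])
            (use * c space[OF v] in \<open>auto simp: P[symmetric] P_def[symmetric]\<close>)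
        also have "\<dots> = 6 * c * log 2 ?N + 12 + n * c" by (simp add: leak)
        also have "log 2 ?N = n * log 2 CARD('x) + (n * log 2 CARD('y) + (log 2 (msg_size n R) + n * log 2 CARD('z)))"
          unfolding card_code_space using msg_size_bounds(3)[of n R]
          by (simp add: log_mult log_nat_power)
        also have "\<dots> \<le> n * b + 1" unfolding b_def using msg_size_bounds(2)[OF R0, of n] by (simp add: algebra_simps)
        finally have "lk n (enc, dec') \<le> 6 * c * (n * b + 1) + 12 + n * c" using c by (simp add: mult_left_mono)
        also have "\<dots> \<le> n * (c * (6 * b + 9)) + 12"
        proof -
          have "c * 1 \<le> c * real n" using c elim(3) by (intro mult_left_mono) auto
          then have "6 * c \<le> 8 * (c * real n)" using c(1) by linarith
          then show ?thesis by (simp add: algebra_simps)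
        qed
        also have "\<dots> = n * (eps / 2) + 12" unfolding c(2) ..
        also have "\<dots> \<le> n * eps" using elim(1) e by (simp add: field_simps)
        finally show ?thesis using elim(3) by (simp add: field_simps)
      qed
      have "2 * c \<le> eps"
      proof -
        have "c * 9 \<le> c * (6 * b + 9)" using c b0 by (intro mult_left_mono) auto
        then show ?thesis using c by simp
      qed
      then show ?case using v t l unfolding E_def by (intro exI[of _ "(enc, dec')"]) auto
    qed
  qed
  then obtain c where c: "\<And>n. valid n (c n)" "\<And>eps. 0 < eps \<Longrightarrow> eventually (\<lambda>n. E n (c n) \<le> eps) sequentially" by blast
  show ?thesis unfolding achievable_def
  proof (intro conjI R0 exI[of _ "\<lambda>n. fst (c n)"] exI[of _ "\<lambda>n. snd (c n)"] allI impI)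
    show "set_pmf (fst (c n) xs) \<subseteq> {1..msg_size n R}" for n xs using c(1) by (simp add: valid_def)
    show "set_pmf (snd (c n) m ys) \<subseteq> {zs. length zs = n}" for n m ys using c(1) by (simp add: valid_def)
    fix eps :: real assume "0 < eps"
    from c(2)[OF this] eventually_gt_at_top[of 0]
    show "eventually (\<lambda>n. tv_dist (map_pmf drop_msg (code_pmf pXY n (fst (c n)) (snd (c n))))
                  (src_pmf pXY pZ n) \<le> eps \<and>
          leakage (code_pmf pXY n (fst (c n)) (snd (c n))) \<le> real n * eps) sequentially"
    proof eventually_elim
      case (elim n)
      then have "tv n (c n) \<le> eps" "lk n (c n) / n \<le> eps" by (auto simp: E_def)
      then show ?case using elim(2) by (simp add: tv_def lk_def field_simps)
    qed
  qed
qed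

end

section \<open>Codes from admissible auxiliary variables\<close>

lemma pmf_map_eq_0:
  assumes "pmf (map_pmf f p) v = 0" "\<And>s. g s = w \<Longrightarrow> f s = v"
  shows "pmf (map_pmf g p) w = 0"
  using assms by (auto simp: pmf_eq_0_set_pmf)

definition src1 :: "('x \<times> 'y) pmf \<Rightarrow> ('x \<Rightarrow> 'y \<Rightarrow> 'z pmf) \<Rightarrow> ('x \<times> 'y \<times> 'z) pmf" where
  "src1 pXY pZ = bind_pmf pXY (\<lambda>(x, y). map_pmf (\<lambda>z. (x, y, z)) (pZ x y))"

lemma joint_U_src1: "joint_U pXY pZ pU = bind_pmf (src1 pXY pZ) (\<lambda>w. map_pmf (\<lambda>u. (u, w)) (case w of (x, y, z) \<Rightarrow> pU x y z))"
  unfolding joint_U_def src1_def by (simp add: bind_assoc_pmf bind_map_pmf split_def map_pmf_def bind_return_pmf)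

lemma snd_joint_U: "map_pmf snd (joint_U pXY pZ pU) = src1 pXY pZ"
  unfolding joint_U_src1 by (simp add: map_bind_pmf map_pmf_comp bind_return_pmf')

lemma src1_XY: "map_pmf fst2 (src1 pXY pZ) = pXY"
  unfolding src1_def by (simp add: map_bind_pmf map_pmf_comp split_def bind_return_pmf')

text \<open>The first two Markov conditions make the joint law an \<open>aux_channel\<close>. The
  third, I(U;X|YZ) = 0, yields both I(U;XYZ) - I(U;Y) = I(Z;U|Y), the rate, and H(X|U,Y,Z) =
  H(X|Y,Z), which removes the main leakage term.\<close>

lemma achievable_if_admissible:
  fixes pXY :: "('x::finite \<times> 'y::finite) pmf" and pZ :: "'x \<Rightarrow> 'y \<Rightarrow> 'z::finite pmf"
    and pU :: "'x \<Rightarrow> 'y \<Rightarrow> 'z \<Rightarrow> 'u pmf"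
  assumes fin: "\<And>x y z. fins (pU x y z)" and adm: "admissible_U pXY pZ pU" and R: "info_ZU_Y pXY pZ pU < R"
  shows "achievable pXY pZ R"
proof -
  define Q where "Q = joint_U pXY pZ pU"
  have finQ: "fins Q" unfolding Q_def joint_U_src1 using fin by (auto split: prod.split)
  define u x y z where "u = (\<lambda>s :: 'u \<times> 'x \<times> 'y \<times> 'z. fst s)" and "x = (\<lambda>s :: 'u \<times> 'x \<times> 'y \<times> 'z. fst (snd s))"
    and "y = (\<lambda>s :: 'u \<times> 'x \<times> 'y \<times> 'z. fst (snd (snd s)))" and "z = (\<lambda>s :: 'u \<times> 'x \<times> 'y \<times> 'z. snd (snd (snd s)))"
  note p = u_def x_def y_def z_def
  have m1: "markov Q u x y" and m2: "markov Q z (\<lambda>s. (u s, y s)) x" and m3: "markov Q u (\<lambda>s. (y s, z s)) x"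
    using adm unfolding admissible_U_def Let_def Q_def[symmetric] p by (simp_all add: split_def)
  define pu where "pu = map_pmf u Q"
  define a where "a = kernel (map_pmf (\<lambda>s. (u s, x s)) Q)"
  define py where "py = kernel pXY"
  define q where "q v w = kernel (map_pmf (\<lambda>s. ((u s, y s), z s)) Q) (v, w)" for v w
  interpret aux_channel pu a py q by unfold_locales (simp add: pu_def finQ)
  have XY: "map_pmf (\<lambda>s. (x s, y s)) Q = pXY"
    using arg_cong[OF snd_joint_U[of pXY pZ pU], of "map_pmf fst2"]
    unfolding src1_XY map_pmf_comp Q_def[symmetric] p by simp
  have X: "map_pmf x Q = map_pmf fst pXY" unfolding XY[symmetric] map_pmf_comp by simp
  have J: "bind_pmf pu (\<lambda>v. map_pmf (Pair v) (V v)) = Q"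
  proof (rule pmf_eqI)
    fix s :: "'u \<times> 'x \<times> 'y \<times> 'z"
    obtain s1 s2 s3 s4 where s: "s = (s1, s2, s3, s4)" by (cases s)
    have "pmf (bind_pmf pu (\<lambda>v. map_pmf (Pair v) (V v))) s
       = pmf pu s1 * (pmf (a s1) s2 * (pmf (py s2) s3 * pmf (q s1 s3) s4))"
      unfolding s using finQ by (subst pmf_bind_Pair) (simp_all add: pu_def V_def pmf_chan3)
    also have "pmf pu s1 * (pmf (a s1) s2 * (pmf (py s2) s3 * pmf (q s1 s3) s4))
       = (pmf pu s1 * pmf (a s1) s2) * pmf (py s2) s3 * pmf (q s1 s3) s4" by simp
    also have "pmf pu s1 * pmf (a s1) s2 = pmf (map_pmf (\<lambda>s. (u s, x s)) Q) (s1, s2)"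
      unfolding a_def by (subst pmf_kernel) (simp_all add: finQ pu_def map_pmf_comp)
    also have "pmf (map_pmf (\<lambda>s. (u s, x s)) Q) (s1, s2) * pmf (py s2) s3 = pmf (map_pmf (\<lambda>s. (u s, x s, y s)) Q) (s1, s2, s3)"
    \<comment> \<open>The Markov identity carries a factor p(x), so p(x) = 0 is treated apart; there
      both sides vanish. The same split recurs for p(u,y).\<close>
    proof (cases "pmf (map_pmf x Q) s2 = 0")
      case True
      have "pmf (map_pmf (\<lambda>s. (u s, x s)) Q) (s1, s2) = 0" "pmf (map_pmf (\<lambda>s. (u s, x s, y s)) Q) (s1, s2, s3) = 0"
        by (rule pmf_map_eq_0[OF True]; simp)+
      then show ?thesis by simp
    next
      case False
      have "pmf (map_pmf (\<lambda>s. (u s, x s, y s)) Q) (s1, s2, s3) * pmf (map_pmf x Q) s2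
        = pmf (map_pmf (\<lambda>s. (u s, x s)) Q) (s1, s2) * pmf pXY (s2, s3)"
        using m1 unfolding markov_def XY by blast
      also have "pmf pXY (s2, s3) = pmf (map_pmf x Q) s2 * pmf (py s2) s3"
        unfolding py_def X by (rule pmf_kernel) simp
      finally show ?thesis using False by simp
    qed
    also have "pmf (map_pmf (\<lambda>s. (u s, x s, y s)) Q) (s1, s2, s3) * pmf (q s1 s3) s4 = pmf Q s"
    proof -
      have "pmf (map_pmf (\<lambda>s. (z s, (u s, y s), x s)) Q) (s4, (s1, s3), s2) = pmf (map_pmf (\<lambda>s. s) Q) s"
        by (rule pmf_map_cong_iff) (auto simp: s p)
      then have i1: "pmf (map_pmf (\<lambda>s. (z s, (u s, y s), x s)) Q) (s4, (s1, s3), s2) = pmf Q s" by simp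
      have i2: "pmf (map_pmf (\<lambda>s. ((u s, y s), x s)) Q) ((s1, s3), s2) = pmf (map_pmf (\<lambda>s. (u s, x s, y s)) Q) (s1, s2, s3)"
        by (rule pmf_map_cong_iff) auto
      have i3: "pmf (map_pmf (\<lambda>s. (z s, (u s, y s))) Q) (s4, (s1, s3)) = pmf (map_pmf (\<lambda>s. ((u s, y s), z s)) Q) ((s1, s3), s4)"
        by (rule pmf_map_cong_iff) auto
      show ?thesis
      proof (cases "pmf (map_pmf (\<lambda>s. (u s, y s)) Q) (s1, s3) = 0")
        case True
        have "pmf (map_pmf (\<lambda>s. (u s, x s, y s)) Q) (s1, s2, s3) = 0"
          by (rule pmf_map_eq_0[OF True]) simp
        moreover have "pmf (map_pmf (\<lambda>s. s) Q) s = 0"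
          by (rule pmf_map_eq_0[OF True]) (simp add: s p)
        ultimately show ?thesis by simp
      next
        case False
        have "pmf Q s * pmf (map_pmf (\<lambda>s. (u s, y s)) Q) (s1, s3)
          = pmf (map_pmf (\<lambda>s. (z s, (u s, y s))) Q) (s4, (s1, s3)) * pmf (map_pmf (\<lambda>s. ((u s, y s), x s)) Q) ((s1, s3), s2)"
          using m2 unfolding markov_def i1[symmetric] by blast
        also have "pmf (map_pmf (\<lambda>s. (z s, (u s, y s))) Q) (s4, (s1, s3)) = pmf (map_pmf (\<lambda>s. (u s, y s)) Q) (s1, s3) * pmf (q s1 s3) s4"
          unfolding i3 q_def by (subst pmf_kernel) (simp_all add: finQ map_pmf_comp)
        finally show ?thesis using False unfolding i2 by simp
      qed
    qed
    finally show "pmf (bind_pmf pu (\<lambda>v. map_pmf (Pair v) (V v))) s = pmf Q s" .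
  qed
  have finpu: "fins pu" by (rule fin_pu)
  have T: "T = map_pmf snd Q" unfolding J[symmetric] T_def by (simp add: map_bind_pmf map_pmf_comp)
  have Tsrc: "T = src1 pXY pZ" unfolding T Q_def by (rule snd_joint_U)
  have eV: "entf Q (\<lambda>s. s) = ent pu + pex pu (\<lambda>v. ent (V v))"
    unfolding entf_def using ent_bind_Pair[OF finpu, of V] by (simp add: J)
  have eVY: "entf Q (\<lambda>s. (u s, y s)) = ent pu + pex pu (\<lambda>v. ent (VY v))"
  proof -
    have "map_pmf (\<lambda>s. (u s, y s)) Q = bind_pmf pu (\<lambda>v. map_pmf (Pair v) (VY v))"
      unfolding J[symmetric] VY_def p by (simp add: map_bind_pmf map_pmf_comp split_def)
    then show ?thesis unfolding entf_def using ent_bind_Pair[OF finpu, of VY] by simp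
  qed
  have eVYZ: "entf Q (\<lambda>s. (u s, (y s, z s))) = ent pu + pex pu (\<lambda>v. ent (VYZ v))"
  proof -
    have "map_pmf (\<lambda>s. (u s, (y s, z s))) Q = bind_pmf pu (\<lambda>v. map_pmf (Pair v) (VYZ v))"
      unfolding J[symmetric] VYZ_def p by (simp add: map_bind_pmf map_pmf_comp)
    then show ?thesis unfolding entf_def using ent_bind_Pair[OF finpu, of VYZ] by simp
  qed
  have PY: "ent PY = entf Q y"
  proof -
    have "PY = map_pmf y Q"
      unfolding J[symmetric] PY_def VY_def p by (simp add: map_bind_pmf map_pmf_comp split_def)
    then show ?thesis by (simp add: entf_def)
  qed
  have eT: "ent T = entf Q (\<lambda>s. (x s, (y s, z s)))" unfolding T entf_def p by simp
  have eTs: "ent (map_pmf snd T) = entf Q (\<lambda>s. (y s, z s))" unfolding T entf_def p by (simp add: map_pmf_comp)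
  have c3: "entf Q (\<lambda>s. (u s, (y s, z s))) + entf Q (\<lambda>s. (x s, (y s, z s))) - entf Q (\<lambda>s. s) - entf Q (\<lambda>s. (y s, z s)) = 0"
  proof -
    have "entf Q (\<lambda>s. (u s, x s, (y s, z s))) = entf Q (\<lambda>s. s)" by (rule entf_cong_iff) (auto simp: p prod_eq_iff)
    then show ?thesis using cmi_eq_0_if_markov[OF m3] unfolding cmi_eq_entf[OF finQ] by simp
  qed
  have info: "info_ZU_Y pXY pZ pU = entf Q (\<lambda>s. (y s, z s)) + entf Q (\<lambda>s. (u s, y s)) - entf Q (\<lambda>s. (u s, (y s, z s))) - entf Q y"
  proof -
    have "info_ZU_Y pXY pZ pU = cmi Q z u y" unfolding info_ZU_Y_def Q_def p by (simp add: split_def)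
    moreover have "entf Q (\<lambda>s. (z s, y s)) = entf Q (\<lambda>s. (y s, z s))" "entf Q (\<lambda>s. (z s, u s, y s)) = entf Q (\<lambda>s. (u s, (y s, z s)))"
      by (rule entf_cong_iff; auto)+
    ultimately show ?thesis unfolding cmi_eq_entf[OF finQ] by simp
  qed
  have "0 \<le> info_ZU_Y pXY pZ pU" unfolding info_ZU_Y_def Q_def[symmetric] by (rule cmi_nonneg[OF finQ])
  then have R0: "0 \<le> R" using R by simp
  have fT: "map_pmf fst T = map_pmf fst pXY"
    unfolding Tsrc arg_cong[OF src1_XY[of pXY pZ], of "map_pmf fst", symmetric] map_pmf_comp by simp
  show ?thesis
  proof (rule achievable_if_rate_gt)
    show "(ent T - pex pu (\<lambda>u. ent (V u))) - (ent PY - pex pu (\<lambda>u. ent (VY u))) < R"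
      using R c3 unfolding info eT PY using eV eVY eVYZ by linarith
    show "pXY = bind_pmf (map_pmf fst T) (\<lambda>x. map_pmf (Pair x) (py x))"
      unfolding fT unfolding py_def by (rule bind_kernel[symmetric])
    show "T = bind_pmf pXY (\<lambda>(x, y). map_pmf (\<lambda>z. (x, y, z)) (pZ x y))" using Tsrc unfolding src1_def .
    show "pex pu g = ent T - ent (map_pmf snd T)"
      unfolding g_def pex_diff eT eTs using eV eVYZ c3 by linarith
  qed (rule R0)
qed

subsection \<open>The convex set of attainable entropy vectors\<close>

definition vec_pmf :: "'w::finite pmf \<Rightarrow> real ^ 'w" where "vec_pmf p = (\<chi> w. pmf p w)"

text \<open>Marginals and entropies are extended from laws to all vectors, so that closedness and
  continuity are statements about Euclidean space.\<close>

definition vmarg :: "real ^ 'w::finite \<Rightarrow> ('w \<Rightarrow> 'a) \<Rightarrow> 'a \<Rightarrow> real" where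
  "vmarg r f b = (\<Sum>w | f w = b. r $ w)"

definition vent :: "real ^ 'w::finite \<Rightarrow> ('w \<Rightarrow> 'a) \<Rightarrow> real" where
  "vent r f = (\<Sum>b\<in>range f. eta (vmarg r f b))"

lemma vmarg_vec_pmf: "vmarg (vec_pmf p) f b = pmf (map_pmf f p) b"
  unfolding vmarg_def vec_pmf_def pmf_map by (subst measure_measure_pmf_finite) (simp_all add: vimage_def)

lemma vent_vec_pmf: "vent (vec_pmf p) f = entf p f"
  unfolding vent_def entf_def vmarg_vec_pmf by (rule ent_superset[symmetric]) auto

text \<open>Laws \<open>p(xyz|u)\<close> with \<open>p(y|x,u) = p(y|x)\<close> and \<open>Z - Y - X\<close> given \<open>u\<close>, stated without division.\<close>

definition aux_laws :: "('x::finite \<times> 'y::finite) pmf \<Rightarrow> (real ^ ('x \<times> 'y \<times> 'z::finite)) set" where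
  "aux_laws pXY = {r. (\<forall>w. 0 \<le> r $ w) \<and> (\<Sum>w\<in>UNIV. r $ w) = 1 \<and>
     (\<forall>x y. vmarg r fst2 (x, y) * pmf (map_pmf fst pXY) x = vmarg r fst x * pmf pXY (x, y)) \<and>
     (\<forall>x y z. r $ (x, y, z) * vmarg r (\<lambda>w. fst (snd w)) y = vmarg r fst2 (x, y) * vmarg r snd (y, z))}"

text \<open>Averaged over u, the last two coordinates become H(X|U,Y,Z) and H(Z|U,Y).\<close>

definition aux_point :: "real ^ ('x::finite \<times> 'y::finite \<times> 'z::finite) \<Rightarrow> (real ^ ('x \<times> 'y \<times> 'z)) \<times> real \<times> real" where
  "aux_point r = (r, vent r (\<lambda>w. w) - vent r snd, vent r snd - vent r (\<lambda>w. fst (snd w)))"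

text \<open>Obtained from ln s \<le> s - 1 at s = 1 / sqrt t; it gives continuity of
  \<open>eta\<close> at 0.\<close>

lemma abs_eta_le:
  assumes "0 \<le> t" "t \<le> 1"
  shows "\<bar>eta t\<bar> \<le> 2 * sqrt t / ln 2"
proof (cases "t = 0")
  case False
  then have t: "0 < t" using assms by simp
  have l: "ln t \<le> 0" using assms t by simp
  have "ln (1 / sqrt t) \<le> 1 / sqrt t - 1" using t by (intro ln_le_minus_one) auto
  also have "ln (1 / sqrt t) = - (ln t / 2)" using t by (simp add: ln_div ln_sqrt)
  finally have "- ln t \<le> 2 / sqrt t" by simp
  then have "t * (- ln t) \<le> t * (2 / sqrt t)" using t by (intro mult_left_mono) auto
  also have "\<dots> = 2 * sqrt t" using t by (simp add: field_simps)
  finally have "t * (- ln t) / ln 2 \<le> 2 * sqrt t / ln 2" by (intro divide_right_mono) auto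
  moreover have "eta t = t * (- ln t) / ln 2" by (simp add: eta_def log_def)
  moreover have "0 \<le> t * (- ln t) / ln 2" using t l by (intro divide_nonneg_nonneg mult_nonneg_nonneg) auto
  ultimately show ?thesis by simp
qed simp

lemma continuous_on_eta: "continuous_on {0..} eta"
proof (rule continuous_on_eq_continuous_within[THEN iffD2], rule ballI)
  fix t :: real assume "t \<in> {0..}"
  show "continuous (at t within {0..}) eta"
  proof (cases "t = 0")
    case False
    then have "0 < t" using \<open>t \<in> {0..}\<close> by simp
    then have "isCont eta t" unfolding eta_def[abs_def] by (intro continuous_intros) auto
    then show ?thesis by (rule continuous_at_imp_continuous_at_within)
  next
    case True
    have "((\<lambda>t. 2 * sqrt t / ln 2) \<longlongrightarrow> 2 * sqrt 0 / ln 2) (at 0 within {0..})"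
      by (intro tendsto_intros) auto
    then have "((\<lambda>t. 2 * sqrt t / ln 2) \<longlongrightarrow> 0) (at (0::real) within {0..})" by simp
    moreover have "eventually (\<lambda>t. norm (eta t) \<le> 2 * sqrt t / ln 2) (at (0::real) within {0..})"
      unfolding eventually_at by (rule exI[of _ 1]) (auto intro!: abs_eta_le simp: dist_real_def)
    ultimately have "(eta \<longlongrightarrow> 0) (at (0::real) within {0..})" by (rule Lim_null_comparison[rotated])
    then show ?thesis using True by (simp add: continuous_within)
  qed
qed

lemma continuous_on_vmarg: "continuous_on A (\<lambda>r. vmarg r f b)"
  unfolding vmarg_def by (intro continuous_intros)

lemma vmarg_nonneg: "(\<And>w. 0 \<le> r $ w) \<Longrightarrow> 0 \<le> vmarg r f b"
  unfolding vmarg_def by (intro sum_nonneg) auto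

lemma continuous_on_vent:
  assumes "\<And>r w. r \<in> A \<Longrightarrow> 0 \<le> r $ w"
  shows "continuous_on A (\<lambda>r. vent r f)"
  unfolding vent_def
  by (intro continuous_on_sum continuous_on_compose2[OF continuous_on_eta continuous_on_vmarg])
    (auto intro!: vmarg_nonneg assms)

text \<open>Written without division the conditions are closed, and vectors with nonnegative entries
  of sum 1 are bounded.\<close>

lemma compact_aux_laws:
  "compact (aux_laws (pXY :: ('x::finite \<times> 'y::finite) pmf) :: (real ^ ('x \<times> 'y \<times> 'z::finite)) set)"
proof -
  let ?S = "aux_laws pXY :: (real ^ ('x \<times> 'y \<times> 'z)) set"
  have "closed ?S"
    unfolding aux_laws_def
    by (intro closed_Collect_conj closed_Collect_all closed_Collect_le closed_Collect_eq
        continuous_intros continuous_on_vmarg)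
  moreover have "bounded ?S"
    unfolding bounded_iff
  proof (intro exI[of _ 1] ballI)
    fix r assume "r \<in> ?S"
    then have "\<And>w. \<bar>r $ w\<bar> = r $ w" "(\<Sum>w\<in>UNIV. r $ w) = 1" by (auto simp: aux_laws_def)
    then show "norm r \<le> 1" using norm_le_l1_cart[of r] by simp
  qed
  ultimately show ?thesis by (simp add: compact_eq_bounded_closed)
qed

lemma compact_aux_point_aux_laws: "compact (aux_point ` aux_laws pXY)"
  unfolding aux_point_def
  by (intro compact_continuous_image compact_aux_laws continuous_on_Pair continuous_on_diff continuous_on_vent continuous_on_id)
    (auto simp: aux_laws_def)

text \<open>Total mass 1 is an affine constraint, which removes one of the |X||Y||Z| + 2
  dimensions.\<close>

lemma aff_dim_aux_point_aux_laws:
  "aff_dim (aux_point ` aux_laws (pXY :: ('x::finite \<times> 'y::finite) pmf) :: ((real ^ ('x \<times> 'y \<times> 'z::finite)) \<times> real \<times> real) set)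
     \<le> int (CARD('x) * CARD('y) * CARD('z)) + 1"
proof -
  let ?a = "((\<chi> w. 1), 0, 0) :: (real ^ ('x \<times> 'y \<times> 'z)) \<times> real \<times> real"
  let ?S = "aux_point ` aux_laws pXY :: ((real ^ ('x \<times> 'y \<times> 'z)) \<times> real \<times> real) set"
  have "?S \<subseteq> {v. ?a \<bullet> v = 1}"
    by (auto simp: aux_point_def aux_laws_def inner_vec_def)
  then have "aff_dim ?S \<le> aff_dim {v. ?a \<bullet> v = 1}" by (rule aff_dim_subset)
  also have "?a \<noteq> 0" by (simp add: prod_eq_iff vec_eq_iff)
  then have "aff_dim {v. ?a \<bullet> v = 1} = DIM((real ^ ('x \<times> 'y \<times> 'z)) \<times> real \<times> real) - 1"
    by (rule aff_dim_hyperplane)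
  finally show ?thesis by (simp add: mult.assoc add.commute)
qed

section \<open>Mixtures of conditional laws and Caratheodory's theorem\<close>

lemma entf_fst_decomp:
  assumes "fins J"
  shows "entf J (\<lambda>s. (fst s, f (snd s))) = ent (map_pmf fst J) + pex (map_pmf fst J) (\<lambda>t. entf (kernel J t :: 'w::finite pmf) f)"
proof -
  have "map_pmf (\<lambda>s. (fst s, f (snd s))) J
    = bind_pmf (map_pmf fst J) (\<lambda>t. map_pmf (Pair t) (map_pmf f (kernel J t)))"
    by (subst bind_kernel[of J, symmetric], unfold map_bind_pmf map_pmf_comp) simp
  then show ?thesis unfolding entf_def
    by (simp only:) (rule ent_bind_Pair, use assms in auto)
qed

definition cond_point :: "('t \<times> ('x::finite \<times> 'y::finite \<times> 'z::finite)) pmf \<Rightarrow> (real ^ ('x \<times> 'y \<times> 'z)) \<times> real \<times> real" where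
  "cond_point J = (vec_pmf (map_pmf snd J),
     entf J (\<lambda>s. (fst s, snd s)) - entf J (\<lambda>s. (fst s, snd (snd s))),
     entf J (\<lambda>s. (fst s, snd (snd s))) - entf J (\<lambda>s. (fst s, fst (snd (snd s)))))"

text \<open>The entropy of the first component cancels in each difference; what remains is an
  average over its values.\<close>

lemma cond_point_eq:
  assumes "fins J"
  shows "cond_point J = (\<Sum>t\<in>set_pmf (map_pmf fst J). pmf (map_pmf fst J) t *\<^sub>R aux_point (vec_pmf (kernel J t)))"
proof -
  let ?p = "map_pmf fst J"
  have v: "vec_pmf (map_pmf snd J) = (\<Sum>t\<in>set_pmf ?p. pmf ?p t *\<^sub>R vec_pmf (kernel J t))"
  proof -
    have "map_pmf snd J = bind_pmf ?p (kernel J)"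
      by (subst bind_kernel[of J, symmetric], unfold map_bind_pmf map_pmf_comp) simp
    then show ?thesis
      using assms by (simp add: vec_eq_iff vec_pmf_def pmf_bind_pex pex_def)
  qed
  have p: "pex ?p f = (\<Sum>t\<in>set_pmf ?p. pmf ?p t * f t)" for f by (simp add: pex_def)
  show ?thesis
    unfolding cond_point_def entf_fst_decomp[OF assms, of "\<lambda>w. w"] entf_fst_decomp[OF assms, of snd]
      entf_fst_decomp[OF assms, of "\<lambda>w. fst (snd w)"] v p aux_point_def vent_vec_pmf
    by (simp add: prod_eq_iff fst_sum snd_sum sum_subtractf right_diff_distrib)
qed

lemma cond_point_in_hull:
  assumes "fins J" "\<And>t. t \<in> set_pmf (map_pmf fst J) \<Longrightarrow> vec_pmf (kernel J t) \<in> aux_laws pXY"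
  shows "cond_point J \<in> convex hull (aux_point ` aux_laws pXY)"
  unfolding cond_point_eq[OF assms(1)]
  by (intro convex_sum convex_convex_hull) (use assms in \<open>auto intro!: hull_inc simp: sum_pmf_eq_1\<close>)

lemma ex_pmf_of_weights:
  assumes "finite A" "\<And>a. a \<in> A \<Longrightarrow> 0 \<le> f a" "sum f A = 1"
  shows "\<exists>p. \<forall>a. pmf p a = (if a \<in> A then f a else 0)"
proof -
  let ?g = "\<lambda>a. if a \<in> A then f a else 0"
  have "(\<integral>\<^sup>+ a. ennreal (?g a) \<partial>count_space UNIV) = (\<integral>\<^sup>+ a. ennreal (f a) \<partial>count_space A)"
    by (subst nn_integral_count_space_indicator) (auto intro!: nn_integral_cong simp: indicator_def)
  also have "\<dots> = (\<Sum>a\<in>A. ennreal (f a))" using assms by (simp add: nn_integral_count_space_finite)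
  also have "\<dots> = ennreal (sum f A)" using assms by (simp add: sum_ennreal)
  finally have "(\<integral>\<^sup>+ a. ennreal (?g a) \<partial>count_space UNIV) = 1" using assms by simp
  then have "pmf (embed_pmf ?g) a = ?g a" for a by (intro pmf_embed_pmf) (use assms in auto)
  then show ?thesis by blast
qed

lemma ex_vec_pmf:
  assumes "r \<in> aux_laws pXY"
  shows "\<exists>p. vec_pmf p = r"
proof -
  obtain p where "\<forall>a. pmf p a = (if a \<in> UNIV then r $ a else 0)"
    using ex_pmf_of_weights[of UNIV "\<lambda>w. r $ w"] assms by (auto simp: aux_laws_def)
  then show ?thesis by (intro exI[of _ p]) (simp add: vec_pmf_def vec_eq_iff)
qed

abbreviation H_X_YZ :: "('x \<times> 'y \<times> 'z) pmf \<Rightarrow> real" where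
  "H_X_YZ p \<equiv> ent p - ent (map_pmf snd p)"

abbreviation H_Z_Y :: "('x \<times> 'y \<times> 'z) pmf \<Rightarrow> real" where
  "H_Z_Y p \<equiv> ent (map_pmf snd p) - ent (map_pmf (\<lambda>w. fst (snd w)) p)"

lemma ent_src_pmf:
  fixes pXY :: "('x::finite \<times> 'y::finite) pmf" and pZ :: "'x \<Rightarrow> 'y \<Rightarrow> 'z::finite pmf"
  shows "ent (src_pmf pXY pZ n) = n * ent (src1 pXY pZ)"
    "ent (map_pmf snd (src_pmf pXY pZ n)) = n * ent (map_pmf snd (src1 pXY pZ))"
    "ent (map_pmf (\<lambda>s. fst (snd s)) (src_pmf pXY pZ n)) = n * ent (map_pmf (\<lambda>w. fst (snd w)) (src1 pXY pZ))"
proof -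
  have src: "src_pmf pXY pZ n = map_pmf unzip3 (iid n (src1 pXY pZ))"
    unfolding src_pmf_eq src1_def ..
  show "ent (src_pmf pXY pZ n) = n * ent (src1 pXY pZ)"
    unfolding src ent_unzip3 by (subst ent_seq_pmf) (auto simp: sum_list_replicate)
  show "ent (map_pmf snd (src_pmf pXY pZ n)) = n * ent (map_pmf snd (src1 pXY pZ))"
    using ent_snd_unzip3[of "\<lambda>_. src1 pXY pZ" "replicate n ()"] by (simp add: src sum_list_replicate)
  have "map_pmf (\<lambda>s. fst (snd s)) (src_pmf pXY pZ n) = map_pmf (map (\<lambda>w. fst (snd w))) (seq_pmf (map (\<lambda>_. src1 pXY pZ) (replicate n ())))"
    unfolding src map_pmf_comp by (simp add: unzip3_def comp_def)
  then show "ent (map_pmf (\<lambda>s. fst (snd s)) (src_pmf pXY pZ n)) = n * ent (map_pmf (\<lambda>w. fst (snd w)) (src1 pXY pZ))"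
    unfolding seq_pmf_map[symmetric] by (simp add: ent_seq_pmf sum_list_replicate)
qed

lemma kernel_bind_Pair:
  assumes "fins p" "t \<in> set_pmf p" "\<And>t. fins (k t)"
  shows "kernel (bind_pmf p (\<lambda>t. map_pmf (Pair t) (k t))) t = k t"
proof (rule pmf_eqI)
  fix a
  let ?J = "bind_pmf p (\<lambda>t. map_pmf (Pair t) (k t))"
  have f: "map_pmf fst ?J = p" by (simp add: map_bind_pmf map_pmf_comp bind_return_pmf')
  have "fins ?J" using assms by auto
  from pmf_kernel[OF this, of t a] have "pmf p t * pmf (k t) a = pmf p t * pmf (kernel ?J t) a"
    unfolding f pmf_bind_Pair[OF assms(1)] .
  moreover have "pmf p t \<noteq> 0" using assms(2) by (simp add: set_pmf_iff)
  ultimately show "pmf (kernel ?J t) a = pmf (k t) a" by simp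
qed

text \<open>The points of a convex combination serve as conditional laws given U, the weights as the
  law of U. Membership in \<open>aux_laws\<close> gives the first two Markov conditions.
  \<open>h1\<close> equals H(X|U,Y,Z), so the hypothesis on it gives I(U;X|Y,Z) \<le> 0 and hence
  the third.\<close>

lemma admissible_of_hull_point:
  fixes pXY :: "('x::finite \<times> 'y::finite) pmf" and pZ :: "'x \<Rightarrow> 'y \<Rightarrow> 'z::finite pmf"
  assumes hull: "(vec_pmf (src1 pXY pZ), h1, h2) \<in> convex hull (aux_point ` aux_laws pXY)"
    and h1: "H_X_YZ (src1 pXY pZ) \<le> h1"
  shows "\<exists>pU :: 'x \<Rightarrow> 'y \<Rightarrow> 'z \<Rightarrow> nat pmf.
     (\<forall>x y z. set_pmf (pU x y z) \<subseteq> {..<CARD('x) * CARD('y) * CARD('z) + 2}) \<and>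
     admissible_U pXY pZ pU \<and>
     info_ZU_Y pXY pZ pU = H_Z_Y (src1 pXY pZ) - h2"
proof -
  let ?S = "aux_point ` aux_laws pXY :: ((real ^ ('x \<times> 'y \<times> 'z)) \<times> real \<times> real) set"
  let ?N = "CARD('x) * CARD('y) * CARD('z) + 2"
  let ?src = "src1 pXY pZ"
  obtain s where s: "finite s" "s \<subseteq> ?S" "int (card s) \<le> aff_dim ?S + 1" "(vec_pmf ?src, h1, h2) \<in> convex hull s"
    using hull unfolding caratheodory_aff_dim[of ?S] by auto
  define k where "k = card s"
  \<comment> \<open>Caratheodory needs one point more than the affine dimension, which is at most
    |X||Y||Z| + 1.\<close>
  have kN: "k \<le> ?N" using s(3) aff_dim_aux_point_aux_laws[of pXY, where 'z = 'z] unfolding k_def by linarith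
  obtain w where w: "\<And>v. v \<in> s \<Longrightarrow> 0 \<le> w v" "sum w s = 1" "(\<Sum>v\<in>s. w v *\<^sub>R v) = (vec_pmf ?src, h1, h2)"
    using s(4) unfolding convex_hull_finite[OF s(1)] by auto
  obtain e where e: "bij_betw e {0..<k} s" using ex_bij_betw_nat_finite[OF s(1)] unfolding k_def by blast
  have es: "e j \<in> s" if "j < k" for j using e that by (auto simp: bij_betw_def)
  have "\<exists>p. vec_pmf p \<in> aux_laws pXY \<and> e j = aux_point (vec_pmf p)" if "j < k" for j
  proof -
    have "e j \<in> ?S" using es[OF that] s(2) by auto
    then obtain r where r: "r \<in> aux_laws pXY" "e j = aux_point r" by auto
    then show ?thesis using ex_vec_pmf[OF r(1)] by auto
  qed
  then obtain pm where pm: "\<And>j. j < k \<Longrightarrow> vec_pmf (pm j) \<in> aux_laws pXY" "\<And>j. j < k \<Longrightarrow> e j = aux_point (vec_pmf (pm j))" by metis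
  have sw: "(\<Sum>j\<in>{0..<k}. w (e j)) = 1" using sum.reindex_bij_betw[OF e, of w] w(2) by simp
  obtain wp where wp: "\<And>j. pmf wp j = (if j \<in> {0..<k} then w (e j) else 0)"
    using ex_pmf_of_weights[of "{0..<k}" "\<lambda>j. w (e j)"] sw w(1) es by auto
  have setwp: "set_pmf wp \<subseteq> {0..<k}" by (auto simp: set_pmf_iff wp split: if_splits)
  have finwp: "fins wp" using setwp finite_subset by blast
  define J where "J = bind_pmf wp (\<lambda>j. map_pmf (Pair j) (pm j))"
  have finJ: "fins J" unfolding J_def using finwp by auto
  have fJ: "map_pmf fst J = wp" unfolding J_def by (simp add: map_bind_pmf map_pmf_comp bind_return_pmf')
  have "cond_point J = (\<Sum>j\<in>set_pmf wp. pmf wp j *\<^sub>R aux_point (vec_pmf (kernel J j)))"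
    using cond_point_eq[OF finJ] unfolding fJ .
  also have "\<dots> = (\<Sum>j\<in>set_pmf wp. pmf wp j *\<^sub>R e j)"
    by (rule sum.cong[OF refl]) (use setwp pm kernel_bind_Pair[OF finwp, of _ pm] in \<open>auto simp: J_def\<close>)
  also have "\<dots> = (\<Sum>j\<in>{0..<k}. w (e j) *\<^sub>R e j)"
    by (rule sum.mono_neutral_cong_left) (use setwp in \<open>auto simp: wp set_pmf_iff\<close>)
  also have "\<dots> = (vec_pmf ?src, h1, h2)" using sum.reindex_bij_betw[OF e, of "\<lambda>v. w v *\<^sub>R v"] w(3) by simp
  finally have cp: "cond_point J = (vec_pmf ?src, h1, h2)" .
  have sJ: "map_pmf snd J = ?src"
    using cp by (auto simp: cond_point_def vec_pmf_def vec_eq_iff intro!: pmf_eqI)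
  have H1: "h1 = entf J (\<lambda>s. s) - entf J (\<lambda>s. (fst s, snd (snd s)))"
    and H2: "h2 = entf J (\<lambda>s. (fst s, snd (snd s))) - entf J (\<lambda>s. (fst s, fst (snd (snd s))))"
    using cp by (auto simp: cond_point_def)
  \<comment> \<open>\<open>kernel\<close> conditions on the first component, so the pair is swapped
    to obtain the law of u given (x,y,z).\<close>
  define K where "K = map_pmf (\<lambda>s. (snd s, fst s)) J"
  have fK: "map_pmf fst K = ?src" unfolding K_def map_pmf_comp by (simp add: sJ)
  \<comment> \<open>Off the support of the source the value 0 respects the alphabet bound and leaves
    the joint law unchanged.\<close>
  define pU where "pU x y z = (if (x, y, z) \<in> set_pmf ?src then kernel K (x, y, z) else return_pmf 0)" for x y z
  have "joint_U pXY pZ pU = bind_pmf (map_pmf fst K) (\<lambda>w. map_pmf (\<lambda>s. (snd s, fst s)) (map_pmf (Pair w) (kernel K w)))"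
    unfolding joint_U_src1 fK by (rule bind_pmf_cong[OF refl]) (auto simp: pU_def map_pmf_comp)
  also have "\<dots> = map_pmf (\<lambda>s. (snd s, fst s)) K" unfolding map_bind_pmf[symmetric] bind_kernel ..
  also have "\<dots> = J" unfolding K_def map_pmf_comp by simp
  finally have joint: "joint_U pXY pZ pU = J" .
  have bnd: "set_pmf (pU x y z) \<subseteq> {..<?N}" for x y z
  proof (cases "(x, y, z) \<in> set_pmf ?src")
    case True
    have "set_pmf (kernel K (x, y, z)) \<subseteq> snd ` set_pmf K" by (rule set_kernel) (use True in \<open>simp only: fK\<close>)
    also have "\<dots> = set_pmf wp" unfolding fJ[symmetric] K_def by (auto simp: image_image)
    finally show ?thesis using setwp kN True unfolding pU_def by fastforce
  qed (simp add: pU_def)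
  define u x y z where "u = (\<lambda>s :: nat \<times> 'x \<times> 'y \<times> 'z. fst s)" and "x = (\<lambda>s :: nat \<times> 'x \<times> 'y \<times> 'z. fst (snd s))"
    and "y = (\<lambda>s :: nat \<times> 'x \<times> 'y \<times> 'z. fst (snd (snd s)))" and "z = (\<lambda>s :: nat \<times> 'x \<times> 'y \<times> 'z. snd (snd (snd s)))"
  note p = u_def x_def y_def z_def
  have mg: "pmf (map_pmf (\<lambda>s. (fst s, f (snd s))) J) (j, b) = pmf wp j * vmarg (vec_pmf (pm j)) f b" for f :: "_ \<Rightarrow> 'k" and j b
  proof -
    have "map_pmf (\<lambda>s. (fst s, f (snd s))) J = bind_pmf wp (\<lambda>j. map_pmf (Pair j) (map_pmf f (pm j)))"
      unfolding J_def by (simp add: map_bind_pmf map_pmf_comp)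
    then show ?thesis by (simp add: pmf_bind_Pair[OF finwp] vmarg_vec_pmf)
  qed
  have XY: "map_pmf (\<lambda>s. (x s, y s)) J = pXY"
    using arg_cong[OF sJ, of "map_pmf fst2"] unfolding src1_XY map_pmf_comp p .
  have X: "map_pmf x J = map_pmf fst pXY" unfolding XY[symmetric] map_pmf_comp by simp
  have K: "vec_pmf (pm j) \<in> aux_laws pXY" if "pmf wp j \<noteq> 0" for j using that pm(1) by (auto simp: wp split: if_splits)
  have m1: "markov J u x y"
    unfolding markov_def X XY
  proof (intro allI)
    fix j a b
    have 1: "pmf (map_pmf (\<lambda>s. (u s, x s, y s)) J) (j, a, b) = pmf wp j * vmarg (vec_pmf (pm j)) fst2 (a, b)"
      using mg[of fst2 j "(a, b)"] by (simp add: p)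
    have 2: "pmf (map_pmf (\<lambda>s. (u s, x s)) J) (j, a) = pmf wp j * vmarg (vec_pmf (pm j)) fst a"
      using mg[of fst j a] by (simp add: p)
    show "pmf (map_pmf (\<lambda>s. (u s, x s, y s)) J) (j, a, b) * pmf (map_pmf fst pXY) a
       = pmf (map_pmf (\<lambda>s. (u s, x s)) J) (j, a) * pmf pXY (a, b)"
      unfolding 1 2 using K[of j] by (cases "pmf wp j = 0") (auto simp: aux_laws_def)
  qed
  have m2: "markov J z (\<lambda>s. (u s, y s)) x"
    unfolding markov_def
  proof (intro allI)
    fix c :: 'z and jb :: "nat \<times> 'y" and a :: 'x
    obtain j b where jb: "jb = (j, b)" by (cases jb)
    have 1: "pmf (map_pmf (\<lambda>s. (z s, (u s, y s), x s)) J) (c, jb, a) = pmf wp j * vec_pmf (pm j) $ (a, b, c)"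
    proof -
      have "pmf (map_pmf (\<lambda>s. (z s, (u s, y s), x s)) J) (c, jb, a) = pmf (map_pmf (\<lambda>s. (fst s, (\<lambda>w. w) (snd s))) J) (j, (a, b, c))"
        by (rule pmf_map_cong_iff) (auto simp: jb p)
      then show ?thesis using mg[of "\<lambda>w. w" j "(a, b, c)"] by (simp add: vmarg_vec_pmf) (simp add: vec_pmf_def)
    qed
    have 2: "pmf (map_pmf (\<lambda>s. (u s, y s)) J) jb = pmf wp j * vmarg (vec_pmf (pm j)) (\<lambda>w. fst (snd w)) b"
      using mg[of "\<lambda>w. fst (snd w)" j b] by (simp add: p jb)
    have 3: "pmf (map_pmf (\<lambda>s. (z s, (u s, y s))) J) (c, jb) = pmf wp j * vmarg (vec_pmf (pm j)) snd (b, c)"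
      unfolding mg[symmetric] by (rule pmf_map_cong_iff) (auto simp: jb p)
    have 4: "pmf (map_pmf (\<lambda>s. ((u s, y s), x s)) J) (jb, a) = pmf wp j * vmarg (vec_pmf (pm j)) fst2 (a, b)"
      unfolding mg[symmetric] by (rule pmf_map_cong_iff) (auto simp: jb p)
    show "pmf (map_pmf (\<lambda>s. (z s, (u s, y s), x s)) J) (c, jb, a) * pmf (map_pmf (\<lambda>s. (u s, y s)) J) jb
      = pmf (map_pmf (\<lambda>s. (z s, (u s, y s))) J) (c, jb) * pmf (map_pmf (\<lambda>s. ((u s, y s), x s)) J) (jb, a)"
      unfolding 1 2 3 4 using K[of j] by (cases "pmf wp j = 0") (auto simp: aux_laws_def)
  qed
  have eS: "entf J (\<lambda>s. (x s, y s, z s)) = ent ?src" "entf J (\<lambda>s. (y s, z s)) = ent (map_pmf snd ?src)"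
    "entf J y = ent (map_pmf (\<lambda>w. fst (snd w)) ?src)"
    unfolding entf_def sJ[symmetric] map_pmf_comp p by simp_all
  have eJ: "entf J (\<lambda>s. (u s, x s, (y s, z s))) = entf J (\<lambda>s. s)"
    "entf J (\<lambda>s. (u s, (y s, z s))) = entf J (\<lambda>s. (fst s, snd (snd s)))"
    "entf J (\<lambda>s. (z s, u s, y s)) = entf J (\<lambda>s. (fst s, snd (snd s)))"
    "entf J (\<lambda>s. (u s, y s)) = entf J (\<lambda>s. (fst s, fst (snd (snd s))))"
    "entf J (\<lambda>s. (z s, y s)) = entf J (\<lambda>s. (y s, z s))"
    by (rule entf_cong_iff; auto simp: p prod_eq_iff)+
  \<comment> \<open>The left side equals H(X|Y,Z) - h1.\<close>
  have "cmi J u x (\<lambda>s. (y s, z s)) \<le> 0"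
    unfolding cmi_eq_entf[OF finJ] eJ(1,2) eS(1,2) using h1 H1 by simp
  then have m3: "markov J u (\<lambda>s. (y s, z s)) x" by (rule markov_if_cmi_le_0[OF finJ])
  have adm: "admissible_U pXY pZ pU"
    using m1 m2 m3 unfolding admissible_U_def Let_def joint p by (simp add: split_def)
  have "info_ZU_Y pXY pZ pU = cmi J z u y"
    unfolding info_ZU_Y_def joint p by (simp add: split_def)
  also have "\<dots> = H_Z_Y ?src - h2"
    unfolding cmi_eq_entf[OF finJ] eJ eS H2 by simp
  finally show ?thesis using bnd adm by blast
qed

subsection \<open>Converse\<close>

lemma vmarg_simps:
  fixes r :: "real ^ ('x::finite \<times> 'y::finite \<times> 'z::finite)"
  shows "vmarg r fst2 (x, y) = (\<Sum>z\<in>UNIV. r $ (x, y, z))"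
    "vmarg r snd (y, z) = (\<Sum>x\<in>UNIV. r $ (x, y, z))"
    "vmarg r fst x = (\<Sum>y\<in>UNIV. \<Sum>z\<in>UNIV. r $ (x, y, z))"
    "vmarg r (\<lambda>w. fst (snd w)) y = (\<Sum>x\<in>UNIV. \<Sum>z\<in>UNIV. r $ (x, y, z))"
  unfolding vmarg_def sum.cartesian_product
  by (rule sum.reindex_bij_witness[of _ "\<lambda>z. (x, y, z)" "\<lambda>w. snd (snd w)"]; auto)
    (rule sum.reindex_bij_witness[of _ "\<lambda>x. (x, y, z)" fst]; auto
    | rule sum.reindex_bij_witness[of _ "\<lambda>p. (x, fst p, snd p)" snd]; auto
    | rule sum.reindex_bij_witness[of _ "\<lambda>p. (fst p, y, snd p)" "\<lambda>w. (fst w, snd (snd w))"]; auto)+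

text \<open>Given t, the law is proportional to p(x,y) R(x)(t) D(t,y)(z). The factor from
  \<open>R\<close> depends on x only, so p(y|x) is unchanged; the factor from \<open>D\<close> does
  not involve x, so X and Z are independent given y.\<close>

lemma kernel_in_aux_laws:
  fixes pXY :: "('x::finite \<times> 'y::finite) pmf" and D :: "'t \<Rightarrow> 'y \<Rightarrow> 'z::finite pmf"
  assumes fin: "\<And>x. fins (R x)"
  defines "J \<equiv> bind_pmf pXY (\<lambda>(x, y). bind_pmf (R x) (\<lambda>t. map_pmf (\<lambda>z. (t, (x, y, z))) (D t y)))"
  assumes t: "t \<in> set_pmf (map_pmf fst J)"
  shows "vec_pmf (kernel J t) \<in> aux_laws pXY"
proof -
  have finJ: "fins J" unfolding J_def using fin by auto
  define J' where "J' = bind_pmf pXY (\<lambda>p. map_pmf (Pair p) (bind_pmf (R (fst p)) (\<lambda>t. map_pmf (Pair t) (D t (snd p)))))"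
  let ?f = "\<lambda>(p, (t, z)). (t, (fst p, snd p, z))"
  have JJ: "J = map_pmf ?f J'"
    unfolding J_def J'_def by (simp add: map_bind_pmf map_pmf_comp split_def)
  have pJ: "pmf J (t, (x, y, z)) = pmf pXY (x, y) * pmf (R x) t * pmf (D t y) z" for x y z
  proof -
    have "inj ?f" by (auto simp: inj_def)
    then have "pmf J (?f ((x, y), (t, z))) = pmf J' ((x, y), (t, z))" unfolding JJ by (rule pmf_map_inj')
    then show ?thesis unfolding J'_def using fin by (simp add: pmf_bind_Pair)
  qed
  define c where "c = 1 / pmf (map_pmf fst J) t"
  have t0: "pmf (map_pmf fst J) t \<noteq> 0" using t unfolding set_pmf_iff .
  have k: "vec_pmf (kernel J t) $ (x, y, z) = c * pmf pXY (x, y) * pmf (R x) t * pmf (D t y) z" for x y z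
    using pmf_kernel[OF finJ, of t "(x, y, z)"] t0 unfolding pJ c_def by (simp add: vec_pmf_def field_simps)
  have D1: "(\<Sum>z\<in>UNIV. pmf (D t y) z) = 1" for y by (rule sum_pmf_eq_1) auto
  have sz: "(\<Sum>z\<in>UNIV. vec_pmf (kernel J t) $ (x, y, z)) = c * pmf pXY (x, y) * pmf (R x) t" for x y
    unfolding k sum_distrib_left[symmetric] D1 by simp
  have px: "(\<Sum>y\<in>UNIV. pmf pXY (x, y)) = pmf (map_pmf fst pXY) x" for x
    by (rule pmf_map_sum[symmetric]) (auto simp: inj_on_def)
  define gy where "gy y = (\<Sum>x\<in>UNIV. c * pmf pXY (x, y) * pmf (R x) t)" for y
  have vX: "vmarg (vec_pmf (kernel J t)) fst x = c * pmf (map_pmf fst pXY) x * pmf (R x) t" for x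
    unfolding vmarg_simps sz px[symmetric] by (simp add: sum_distrib_left sum_distrib_right)
  have vYZ: "vmarg (vec_pmf (kernel J t)) snd (y, z) = gy y * pmf (D t y) z" for y z
    unfolding vmarg_simps k gy_def by (simp add: sum_distrib_right)
  have vXY: "vmarg (vec_pmf (kernel J t)) fst2 (x, y) = c * pmf pXY (x, y) * pmf (R x) t" for x y
    unfolding vmarg_simps sz ..
  have vY: "vmarg (vec_pmf (kernel J t)) (\<lambda>w. fst (snd w)) y = gy y" for y
    unfolding vmarg_simps sz gy_def ..
  have "(\<Sum>w\<in>UNIV. vec_pmf (kernel J t) $ w) = 1" "\<forall>w. 0 \<le> vec_pmf (kernel J t) $ w"
    unfolding vec_pmf_def by (simp_all add: sum_pmf_eq_1)
  then show ?thesis unfolding aux_laws_def vX vY vXY vYZ mem_Collect_eq k by simp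
qed

text \<open>Chain rule over prefixes; dropping the earlier entries from the condition only increases
  each term.\<close>

lemma entf_chain_le:
  assumes "fins P" "\<And>s. s \<in> set_pmf P \<Longrightarrow> length (l s) = n"
  shows "entf P (\<lambda>s. (l s, W s)) - entf P W \<le> (\<Sum>i<n. entf P (\<lambda>s. (l s ! i, W s)) - entf P W)"
proof -
  have "entf P (\<lambda>s. (take k (l s), W s)) - entf P W \<le> (\<Sum>i<k. entf P (\<lambda>s. (l s ! i, W s)) - entf P W)" if "k \<le> n" for k
    using that
  proof (induction k)
    case 0
    have "entf P (\<lambda>s. (take 0 (l s), W s)) = entf P W" by (rule entf_cong_iff) auto
    then show ?case by simp
  next
    case (Suc k)
    have "entf P (\<lambda>s. (take (Suc k) (l s), W s)) = entf P (\<lambda>s. (take k (l s), l s ! k, W s))"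
      by (rule entf_cong_iff) (use assms(2) Suc.prems in \<open>auto simp: take_Suc_conv_app_nth\<close>)
    moreover have "entf P (\<lambda>s. (take k (l s), l s ! k, W s)) + entf P W
        \<le> entf P (\<lambda>s. (take k (l s), W s)) + entf P (\<lambda>s. (l s ! k, W s))"
      by (rule entf_ssa[OF assms(1)])
    ultimately show ?case using Suc by simp
  qed
  from this[of n] have "entf P (\<lambda>s. (take n (l s), W s)) - entf P W \<le> (\<Sum>i<n. entf P (\<lambda>s. (l s ! i, W s)) - entf P W)" by simp
  moreover have "entf P (\<lambda>s. (take n (l s), W s)) = entf P (\<lambda>s. (l s, W s))"
    by (rule entf_cong_iff) (use assms(2) in auto)
  ultimately show ?thesis by simp
qed

text \<open>
  The first component is the auxiliary variable \<open>U\<^sub>i\<close>: the message together with all of \<open>y\<^sup>n\<close> but its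
  \<open>i\<close>th entry, which is overwritten so that the pair with \<open>y\<^sub>i\<close> still determines \<open>y\<^sup>n\<close>.
\<close>

definition letter :: "nat \<Rightarrow> ('x list \<times> 'y list \<times> nat \<times> 'z list) \<Rightarrow> ((nat \<times> 'y list) \<times> ('x \<times> 'y \<times> 'z))" where
  "letter i = (\<lambda>(xs, ys, m, zs). ((m, ys[i := undefined]), (xs ! i, ys ! i, zs ! i)))"

text \<open>After redrawing letter i the pair (x_i, y_i) is fresh. The encoder sees it only through
  x_i and the overwritten list hides y_i, so the auxiliary variable depends on x_i alone; the
  decoder rebuilds all of \<open>y\<^sup>n\<close> from that variable and y_i. This is the shape
  that \<open>kernel_in_aux_laws\<close> expects.\<close>

lemma letter_code_pmf:
  fixes pXY :: "('x::finite \<times> 'y::finite) pmf" and dec :: "nat \<Rightarrow> 'y list \<Rightarrow> 'z::finite list pmf"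
  assumes i: "i < n"
  shows "map_pmf (letter i) (code_pmf pXY n enc dec) = bind_pmf pXY (\<lambda>(x, y).
     bind_pmf (bind_pmf (iid n pXY) (\<lambda>as. map_pmf (\<lambda>m. (m, (map snd as)[i := undefined])) (enc ((map fst as)[i := x]))))
     (\<lambda>t. map_pmf (\<lambda>z. (t, (x, y, z))) (map_pmf (\<lambda>zs. zs ! i) (dec (fst t) ((snd t)[i := y])))))"
proof -
  let ?S = "iid n pXY"
  have "map_pmf (letter i) (code_pmf pXY n enc dec) = bind_pmf ?S (\<lambda>as. bind_pmf pXY (\<lambda>a.
     bind_pmf (enc (map fst (as[i := a]))) (\<lambda>m. map_pmf (\<lambda>zs. letter i (map fst (as[i := a]), map snd (as[i := a]), m, zs))
        (dec m (map snd (as[i := a]))))))"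
    unfolding code_pmf_def
    by (subst seq_pmf_resample[OF i]) (simp add: map_bind_pmf bind_assoc_pmf bind_map_pmf map_pmf_def[symmetric] map_pmf_comp)
  also have "\<dots> = bind_pmf ?S (\<lambda>as. bind_pmf pXY (\<lambda>a.
     bind_pmf (enc ((map fst as)[i := fst a])) (\<lambda>m. map_pmf (\<lambda>zs. ((m, (map snd as)[i := undefined]), (fst a, snd a, zs ! i)))
        (dec m ((map snd as)[i := snd a])))))"
  proof (intro bind_pmf_cong refl)
    fix as a m assume "as \<in> set_pmf ?S"
    then have l: "length as = n" using length_seq_pmf by fastforce
    show "enc (map fst (as[i := a])) = enc ((map fst as)[i := fst a])" by (simp add: map_update)
    show "map_pmf (\<lambda>zs. letter i (map fst (as[i := a]), map snd (as[i := a]), m, zs)) (dec m (map snd (as[i := a])))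
      = map_pmf (\<lambda>zs. ((m, (map snd as)[i := undefined]), (fst a, snd a, zs ! i))) (dec m ((map snd as)[i := snd a]))"
      using l i by (simp add: map_update letter_def)
  qed
  also have "\<dots> = bind_pmf pXY (\<lambda>a. bind_pmf ?S (\<lambda>as.
     bind_pmf (enc ((map fst as)[i := fst a])) (\<lambda>m. map_pmf (\<lambda>zs. ((m, (map snd as)[i := undefined]), (fst a, snd a, zs ! i)))
        (dec m ((map snd as)[i := snd a])))))"
    by (rule bind_commute_pmf)
  also have "\<dots> = bind_pmf pXY (\<lambda>(x, y).
     bind_pmf (bind_pmf ?S (\<lambda>as. map_pmf (\<lambda>m. (m, (map snd as)[i := undefined])) (enc ((map fst as)[i := x]))))
     (\<lambda>t. map_pmf (\<lambda>z. (t, (x, y, z))) (map_pmf (\<lambda>zs. zs ! i) (dec (fst t) ((snd t)[i := y])))))"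
    by (simp add: split_def bind_assoc_pmf bind_map_pmf map_pmf_comp)
  finally show ?thesis .
qed

text \<open>The point is the average over letters of their \<open>cond_point\<close>. Small leakage
  bounds H(X^n|M,Y^n,Z^n) from below and the message rate bounds H(Z^n|M,Y^n) from below; both split
  over letters. Each comparison with the i.i.d. source uses two Fannes bounds, costing 2 * eps * b +
  4 / n per letter; rounding the message set adds 1 / n.\<close>

lemma code_hull_point:
  fixes pXY :: "('x::finite \<times> 'y::finite) pmf" and pZ :: "'x \<Rightarrow> 'y \<Rightarrow> 'z::finite pmf"
    and enc :: "'x list \<Rightarrow> nat pmf" and dec :: "nat \<Rightarrow> 'y list \<Rightarrow> 'z list pmf" and eps :: real
  assumes n: "0 < n" and R: "0 \<le> R"
    and enc: "\<And>xs. set_pmf (enc xs) \<subseteq> {1..msg_size n R}" and dec: "\<And>m ys. set_pmf (dec m ys) \<subseteq> {zs. length zs = n}"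
    and tv: "tv_dist (map_pmf drop_msg (code_pmf pXY n enc dec)) (src_pmf pXY pZ n) \<le> eps"
    and lk: "leakage (code_pmf pXY n enc dec) \<le> real n * eps"
  defines "b \<equiv> log 2 (real (CARD('x) * CARD('y) * CARD('z)))"
  shows "\<exists>r h1 h2. (r, h1, h2) \<in> convex hull (aux_point ` aux_laws pXY) \<and>
    (\<forall>w. \<bar>r $ w - pmf (src1 pXY pZ) w\<bar> \<le> 2 * eps) \<and>
    H_X_YZ (src1 pXY pZ) - (eps + 2 * eps * b + 4 / n) \<le> h1 \<and>
    H_Z_Y (src1 pXY pZ) - R - (2 * eps * b + 5 / n) \<le> h2"
proof -
  define P where "P = code_pmf pXY n enc dec"
  let ?src = "src_pmf pXY pZ n"
  have setP: "set_pmf P \<subseteq> code_space n (msg_size n R)" unfolding P_def by (rule set_code_pmf) (use enc dec in auto)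
  have finP: "fins P" using setP finite_code_space finite_subset by blast
  define X where "X = (\<lambda>(xs :: 'x list, ys :: 'y list, m :: nat, zs :: 'z list). xs)"
  define Y where "Y = (\<lambda>(xs :: 'x list, ys :: 'y list, m :: nat, zs :: 'z list). ys)"
  define M where "M = (\<lambda>(xs :: 'x list, ys :: 'y list, m :: nat, zs :: 'z list). m)"
  define Z where "Z = (\<lambda>(xs :: 'x list, ys :: 'y list, m :: nat, zs :: 'z list). zs)"
  note p = X_def Y_def M_def Z_def
  have len: "length (X s) = n" "length (Y s) = n" "length (Z s) = n" "M s \<in> {1..msg_size n R}" if "s \<in> set_pmf P" for s
    using that setP by (auto simp: code_space_def p)
  define J where "J i = map_pmf (letter i) P" for i
  have finJ: "fins (J i)" for i by (simp add: J_def finP)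
  have J: "cond_point (J i) \<in> convex hull (aux_point ` aux_laws pXY)" if i: "i < n" for i
  proof -
    define R' where "R' x = bind_pmf (iid n pXY) (\<lambda>as. map_pmf (\<lambda>m. (m, (map snd as)[i := undefined])) (enc ((map fst as)[i := x])))" for x
    define D where "D t y = map_pmf (\<lambda>zs. zs ! i) (dec (fst t) ((snd t)[i := y]))" for t y
    have e: "J i = bind_pmf pXY (\<lambda>(x, y). bind_pmf (R' x) (\<lambda>t. map_pmf (\<lambda>z. (t, (x, y, z))) (D t y)))"
      unfolding J_def P_def letter_code_pmf[OF i] R'_def D_def ..
    have fe: "fins (enc xs)" for xs using enc[of xs] finite_subset by blast
    have "fins (R' x)" for x unfolding R'_def using fe by (auto intro!: fins_seq_replicate)
    from kernel_in_aux_laws[of R' _ pXY D, OF this] show ?thesis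
      by (intro cond_point_in_hull finJ) (simp only: e)
  qed
  define v where "v = (\<Sum>i<n. (1 / real n) *\<^sub>R cond_point (J i))"
  have vh: "v \<in> convex hull (aux_point ` aux_laws pXY)"
    unfolding v_def by (rule convex_sum) (use n J in auto)
  obtain r h1 h2 where v: "v = (r, h1, h2)" by (cases v)
  have r: "r = (\<Sum>i<n. (1 / real n) *\<^sub>R vec_pmf (map_pmf snd (J i)))"
    using arg_cong[OF v_def, of fst] unfolding v by (simp add: fst_sum cond_point_def)
  have h1: "h1 = (\<Sum>i<n. entf (J i) (\<lambda>s. (fst s, snd s)) - entf (J i) (\<lambda>s. (fst s, snd (snd s)))) / n"
    using arg_cong[OF v_def, of "\<lambda>v. fst (snd v)"] unfolding v
    by (simp add: fst_sum snd_sum cond_point_def sum_divide_distrib)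
  have h2: "h2 = (\<Sum>i<n. entf (J i) (\<lambda>s. (fst s, snd (snd s))) - entf (J i) (\<lambda>s. (fst s, fst (snd (snd s))))) / n"
    using arg_cong[OF v_def, of "\<lambda>v. snd (snd v)"] unfolding v
    by (simp add: snd_sum cond_point_def sum_divide_distrib)
  have eJ: "entf (J i) f = entf P (\<lambda>s. f (letter i s))" for i and f :: "_ \<Rightarrow> 'k" unfolding entf_def J_def map_pmf_comp ..
  \<comment> \<open>Entry i and the overwritten list together determine the whole list.\<close>
  have upd: "ys = ys'" if "ys[i := undefined] = ys'[i := undefined]" "ys ! i = ys' ! i" for ys ys' :: "'y list" and i
    using that by (metis list_update_id list_update_overwrite)
  have l1: "entf (J i) (\<lambda>s. (fst s, snd s)) = entf P (\<lambda>s. (X s ! i, (M s, Y s, Z s ! i)))"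
    "entf (J i) (\<lambda>s. (fst s, snd (snd s))) = entf P (\<lambda>s. (M s, Y s, Z s ! i))"
    "entf (J i) (\<lambda>s. (fst s, snd (snd s))) = entf P (\<lambda>s. (Z s ! i, (M s, Y s)))"
    "entf (J i) (\<lambda>s. (fst s, fst (snd (snd s)))) = entf P (\<lambda>s. (M s, Y s))" for i
    unfolding eJ by (rule entf_cong_iff; auto simp: p letter_def intro: upd)+
  define A where "A = (len3 n :: ('x list \<times> 'y list \<times> 'z list) set)"
  define B where "B = eps * (n * b) + 2"
  have finA: "finite A" by (simp add: A_def finite_lists_length)
  define P3 where "P3 = map_pmf drop_msg P"
  have P3A: "set_pmf P3 \<subseteq> A" using setP by (auto simp: P3_def A_def code_space_def)
  have srcA: "set_pmf ?src \<subseteq> A" unfolding src_pmf_eq A_def by (auto simp: unzip3_def dest!: length_seq_pmf)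
  have fin3: "fins P3" "fins ?src" using P3A srcA finA finite_subset by auto
  have tv': "tv_dist P3 ?src \<le> eps" using tv unfolding P3_def P_def .
  have e0: "0 \<le> eps" using tv' tv_dist_nonneg[OF fin3] by linarith
  have cA: "log 2 (card A) = n * b"
  proof -
    have "card A = (CARD('x) * CARD('y) * CARD('z)) ^ n"
      unfolding A_def by (simp add: card_cartesian_product card_lists_length power_mult_distrib)
    then show ?thesis unfolding b_def by (simp add: log_nat_power)
  qed
  have F: "entf P3 f \<le> entf ?src f + B" "entf ?src f \<le> entf P3 f + B" for f :: "_ \<Rightarrow> 'k"
    unfolding B_def cA[symmetric] add.assoc[symmetric]
    by (rule entf_fannes[OF finA]; use P3A srcA tv' e0 in \<open>simp add: tv_dist_sym\<close>)+
  have e3: "entf P (\<lambda>s. (X s, (Y s, Z s))) = entf P3 (\<lambda>s. s)" "entf P (\<lambda>s. (Y s, Z s)) = entf P3 snd"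
    "entf P Y = entf P3 (\<lambda>s. fst (snd s))"
    unfolding entf_def P3_def map_pmf_comp p by (simp_all add: split_def)
  let ?s = "src1 pXY pZ"
  have es: "entf ?src (\<lambda>s. s) = n * ent ?s" "entf ?src snd = n * ent (map_pmf snd ?s)"
    "entf ?src (\<lambda>s. fst (snd s)) = n * ent (map_pmf (\<lambda>w. fst (snd w)) ?s)"
    unfolding entf_def by (simp_all add: ent_src_pmf)
  \<comment> \<open>For blocks the leakage is H(X|Y,Z) - H(X|M,Y,Z), so H(X|M,Y,Z) falls short of
    H(X|Y,Z) by at most n * eps.\<close>
  have b1: "n * ent ?s - n * ent (map_pmf snd ?s) - 2 * B - n * eps \<le> n * h1"
  proof -
    have "cmi P M X (\<lambda>s. (Y s, Z s)) \<le> n * eps" using lk unfolding P_def p by (simp add: split_def)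
    then have 1: "entf P (\<lambda>s. (X s, (Y s, Z s))) - entf P (\<lambda>s. (Y s, Z s)) - n * eps
        \<le> entf P (\<lambda>s. (M s, X s, (Y s, Z s))) - entf P (\<lambda>s. (M s, (Y s, Z s)))"
      unfolding cmi_eq_entf[OF finP] by simp
    have "entf P (\<lambda>s. (M s, X s, (Y s, Z s))) = entf P (\<lambda>s. (X s, (M s, Y s, Z s)))" by (rule entf_cong_iff) auto
    then have "entf P (\<lambda>s. (M s, X s, (Y s, Z s))) - entf P (\<lambda>s. (M s, (Y s, Z s)))
       \<le> (\<Sum>i<n. entf P (\<lambda>s. (X s ! i, (M s, Y s, Z s))) - entf P (\<lambda>s. (M s, Y s, Z s)))"
      using entf_chain_le[OF finP len(1), where W = "\<lambda>s. (M s, Y s, Z s)"] by simp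
    also have "\<dots> \<le> (\<Sum>i<n. entf (J i) (\<lambda>s. (fst s, snd s)) - entf (J i) (\<lambda>s. (fst s, snd (snd s))))"
    proof (rule sum_mono)
      fix i
      \<comment> \<open>Reducing \<open>Z\<^sup>n\<close> to its ith entry in the condition can only
        increase the entropy of X_i.\<close>
      have "entf P (\<lambda>s. (X s ! i, Z s, (M s, Y s, Z s ! i))) + entf P (\<lambda>s. (M s, Y s, Z s ! i))
        \<le> entf P (\<lambda>s. (X s ! i, (M s, Y s, Z s ! i))) + entf P (\<lambda>s. (Z s, (M s, Y s, Z s ! i)))"
        by (rule entf_ssa[OF finP])
      moreover have "entf P (\<lambda>s. (X s ! i, Z s, (M s, Y s, Z s ! i))) = entf P (\<lambda>s. (X s ! i, (M s, Y s, Z s)))"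
        "entf P (\<lambda>s. (Z s, (M s, Y s, Z s ! i))) = entf P (\<lambda>s. (M s, Y s, Z s))" by (rule entf_cong_iff; auto)+
      ultimately show "entf P (\<lambda>s. (X s ! i, (M s, Y s, Z s))) - entf P (\<lambda>s. (M s, Y s, Z s))
        \<le> entf (J i) (\<lambda>s. (fst s, snd s)) - entf (J i) (\<lambda>s. (fst s, snd (snd s)))"
        unfolding l1(1,2) by simp
    qed
    also have "\<dots> = n * h1" unfolding h1 using n by simp
    finally show ?thesis using 1 F(2)[of "\<lambda>s. s"] F(1)[of snd] unfolding e3 es by linarith
  qed
  \<comment> \<open>For blocks H(Z|M,Y) \<ge> H(Y,Z) - H(Y) - H(M), and H(M) \<le> n * R +
    1.\<close>
  have b2: "n * ent (map_pmf snd ?s) - n * ent (map_pmf (\<lambda>w. fst (snd w)) ?s) - 2 * B - (n * R + 1) \<le> n * h2"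
  proof -
    have "entf P M \<le> log 2 (card {1..msg_size n R})"
      unfolding entf_def by (rule ent_le_log_card) (use len(4) in auto)
    also have "\<dots> \<le> n * R + 1" using msg_size_bounds(2)[OF R, of n] by simp
    finally have 1: "entf P (\<lambda>s. (M s, Y s)) \<le> n * R + 1 + entf P Y" using entf_subadd[OF finP, of M Y] by simp
    have 2: "entf P (\<lambda>s. (Y s, Z s)) \<le> entf P (\<lambda>s. (Z s, (M s, Y s)))" by (rule entf_mono[OF finP]) auto
    have "entf P (\<lambda>s. (Z s, (M s, Y s))) - entf P (\<lambda>s. (M s, Y s))
       \<le> (\<Sum>i<n. entf P (\<lambda>s. (Z s ! i, (M s, Y s))) - entf P (\<lambda>s. (M s, Y s)))"
      by (rule entf_chain_le[OF finP len(3)])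
    also have "\<dots> = (\<Sum>i<n. entf (J i) (\<lambda>s. (fst s, snd (snd s))) - entf (J i) (\<lambda>s. (fst s, fst (snd (snd s)))))"
      by (intro sum.cong refl) (simp only: l1(3,4))
    also have "\<dots> = n * h2" unfolding h2 using n by simp
    finally show ?thesis using 1 2 F(2)[of snd] F(1)[of "\<lambda>s. fst (snd s)"] unfolding e3 es by linarith
  qed
  have c1: "\<bar>r $ w - pmf ?s w\<bar> \<le> 2 * eps" for w
  proof -
    have Ji: "\<bar>pmf (map_pmf snd (J i)) w - pmf ?s w\<bar> \<le> 2 * eps" if i: "i < n" for i
    proof -
      let ?g = "\<lambda>s. (fst s ! i, fst (snd s) ! i, snd (snd s) ! i)"
      have 1: "map_pmf snd (J i) = map_pmf ?g P3" unfolding J_def P3_def map_pmf_comp by (simp add: letter_def split_def)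
      have 2: "map_pmf ?g ?src = ?s"
      proof -
        have "map_pmf ?g ?src = map_pmf (\<lambda>ws. ?g (unzip3 ws)) (iid n ?s)"
          unfolding src_pmf_eq map_pmf_comp src1_def ..
        also have "\<dots> = map_pmf (\<lambda>ws. ws ! i) (iid n ?s)"
        proof (rule map_pmf_cong[OF refl])
          fix ws assume "ws \<in> set_pmf (iid n ?s)"
          then have "length ws = n" using length_seq_pmf by fastforce
          then show "?g (unzip3 ws) = ws ! i" using i by (simp add: unzip3_def)
        qed
        also have "\<dots> = ?s" by (rule map_nth_seq_pmf[OF i])
        finally show ?thesis .
      qed
      have "\<bar>pmf (map_pmf ?g P3) w - pmf (map_pmf ?g ?src) w\<bar> \<le> 2 * tv_dist (map_pmf ?g P3) (map_pmf ?g ?src)"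
        by (rule pmf_diff_le_tv_dist) (use fin3 in auto)
      also have "\<dots> \<le> 2 * tv_dist P3 ?src" using tv_dist_map_le[OF fin3, of ?g] by simp
      finally show ?thesis unfolding 1 2 using tv' by simp
    qed
    have "r $ w - pmf ?s w = (\<Sum>i<n. (pmf (map_pmf snd (J i)) w - pmf ?s w)) / n"
      unfolding r using n by (simp add: vec_pmf_def sum_divide_distrib[symmetric] sum_subtractf field_simps)
    also have "\<bar>\<dots>\<bar> = \<bar>\<Sum>i<n. (pmf (map_pmf snd (J i)) w - pmf ?s w)\<bar> / n" by simp
    also have "\<dots> \<le> (\<Sum>i<n. 2 * eps) / n"
      by (intro divide_right_mono order_trans[OF sum_abs] sum_mono) (use Ji in auto)
    also have "\<dots> = 2 * eps" using n by simp
    finally show ?thesis .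
  qed
  have c2: "H_X_YZ ?s - (eps + 2 * eps * b + 4 / n) \<le> h1"
  proof -
    have "n * (H_X_YZ ?s - (eps + 2 * eps * b + 4 / n)) \<le> n * h1"
      using b1 n unfolding B_def by (simp add: algebra_simps)
    then show ?thesis using n by simp
  qed
  have c3: "H_Z_Y ?s - R - (2 * eps * b + 5 / n) \<le> h2"
  proof -
    have "n * (H_Z_Y ?s - R - (2 * eps * b + 5 / n)) \<le> n * h2"
      using b2 n unfolding B_def by (simp add: algebra_simps)
    then show ?thesis using n by simp
  qed
  show ?thesis using vh c1 c2 c3 unfolding v by blast
qed

text \<open>Codes give hull points that violate the three requirements by arbitrarily little.
  \<open>F\<close> adds up the violations; it is continuous and attains its minimum on the compact
  hull, so the minimum is 0 and the requirements hold exactly.\<close>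

lemma converse:
  fixes pXY :: "('x::finite \<times> 'y::finite) pmf" and pZ :: "'x \<Rightarrow> 'y \<Rightarrow> 'z::finite pmf"
  assumes "achievable pXY pZ R"
  shows "\<exists>h1 h2. (vec_pmf (src1 pXY pZ), h1, h2) \<in> convex hull (aux_point ` aux_laws pXY) \<and>
    H_X_YZ (src1 pXY pZ) \<le> h1 \<and>
    H_Z_Y (src1 pXY pZ) - R \<le> h2"
proof -
  let ?C = "convex hull (aux_point ` aux_laws pXY) :: ((real ^ ('x \<times> 'y \<times> 'z)) \<times> real \<times> real) set"
  define b where "b = log 2 (real (CARD('x) * CARD('y) * CARD('z)))"
  have "1 \<le> CARD('x) * CARD('y) * CARD('z)" by (simp add: Suc_le_eq)
  then have "1 \<le> real (CARD('x) * CARD('y) * CARD('z))" by linarith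
  then have b0: "0 \<le> b" unfolding b_def by (intro zero_le_log_cancel_iff[THEN iffD2]) auto
  define H1 where "H1 = H_X_YZ (src1 pXY pZ)"
  define H2 where "H2 = H_Z_Y (src1 pXY pZ) - R"
  define N where "N = real CARD('x \<times> 'y \<times> 'z)"
  define F where "F v = (\<Sum>w\<in>UNIV. \<bar>fst v $ w - pmf (src1 pXY pZ) w\<bar>) + max 0 (H1 - fst (snd v)) + max 0 (H2 - snd (snd v))"
    for v :: "(real ^ ('x \<times> 'y \<times> 'z)) \<times> real \<times> real"
  from assms obtain enc dec where R: "0 \<le> R" and enc: "\<And>n xs. set_pmf (enc n xs) \<subseteq> {1..msg_size n R}"
    and dec: "\<And>n m ys. set_pmf (dec n m ys) \<subseteq> {zs. length zs = n}"
    and ev: "\<And>eps. 0 < eps \<Longrightarrow> eventually (\<lambda>n.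
          tv_dist (map_pmf drop_msg (code_pmf pXY n (enc n) (dec n)))
                  (src_pmf pXY pZ n) \<le> eps \<and>
          leakage (code_pmf pXY n (enc n) (dec n)) \<le> real n * eps) sequentially"
    unfolding achievable_def by blast
  \<comment> \<open>2 * N comes from 2 * \<eta> per coordinate of the law, and 5 + 2 * b from each
    of the two entropy bounds with 1 / n \<le> \<eta>.\<close>
  have near: "\<exists>v\<in>?C. F v \<le> \<eta> * (2 * N + 4 * b + 10)" if e: "0 < \<eta>" for \<eta>
  proof -
    have "eventually (\<lambda>n. 1 / \<eta> \<le> real n) sequentially"
      by (rule eventually_sequentiallyI[of "nat \<lceil>1 / \<eta>\<rceil>"]) linarith
    with ev[OF e] eventually_gt_at_top[of 0]
    have "eventually (\<lambda>n. (\<exists>v\<in>?C. F v \<le> \<eta> * (2 * N + 4 * b + 10))) sequentially"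
    proof eventually_elim
      case (elim n)
      then have inv: "1 / real n \<le> \<eta>" using e by (simp add: field_simps)
      obtain r h1 h2 where v: "(r, h1, h2) \<in> ?C" "\<And>w. \<bar>r $ w - pmf (src1 pXY pZ) w\<bar> \<le> 2 * \<eta>"
        "H1 - (\<eta> + 2 * \<eta> * b + 4 / n) \<le> h1" "H2 - (2 * \<eta> * b + 5 / n) \<le> h2"
        using code_hull_point[OF elim(2) R enc dec conjunct1[OF elim(1)] conjunct2[OF elim(1)]]
        unfolding H1_def H2_def b_def by blast
      have "(\<Sum>w\<in>UNIV. \<bar>r $ w - pmf (src1 pXY pZ) w\<bar>) \<le> (\<Sum>w\<in>(UNIV :: ('x \<times> 'y \<times> 'z) set). 2 * \<eta>)"
        by (intro sum_mono v)
      also have "\<dots> = 2 * N * \<eta>" by (simp add: N_def)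
      finally have 1: "(\<Sum>w\<in>UNIV. \<bar>r $ w - pmf (src1 pXY pZ) w\<bar>) \<le> 2 * N * \<eta>" .
      have nn: "0 \<le> \<eta> * b" using e b0 by simp
      have "4 / real n = 4 * (1 / real n)" "5 / real n = 5 * (1 / real n)" by simp_all
      then have 2: "max 0 (H1 - h1) \<le> 5 * \<eta> + 2 * (\<eta> * b)" "max 0 (H2 - h2) \<le> 5 * \<eta> + 2 * (\<eta> * b)"
        using v(3,4) inv e nn by (auto simp: algebra_simps)
      have "F (r, h1, h2) \<le> \<eta> * (2 * N + 4 * b + 10)"
      proof -
        have "F (r, h1, h2) \<le> 2 * N * \<eta> + (5 * \<eta> + 2 * (\<eta> * b)) + (5 * \<eta> + 2 * (\<eta> * b))"
          unfolding F_def fst_conv snd_conv by (intro add_mono 1 2)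
        also have "\<dots> = \<eta> * (2 * N + 4 * b + 10)" by (simp add: algebra_simps)
        finally show ?thesis .
      qed
      then show ?case using v(1) by blast
    qed
    then show ?thesis by (auto dest: eventually_happens)
  qed
  have cC: "compact ?C" by (intro compact_convex_hull compact_aux_point_aux_laws)
  have neC: "?C \<noteq> {}" using near[of 1] by auto
  have "continuous_on ?C F" unfolding F_def by (intro continuous_intros)
  from continuous_attains_inf[OF cC neC this] obtain v where v: "v \<in> ?C" "\<And>v'. v' \<in> ?C \<Longrightarrow> F v \<le> F v'" by blast
  have "F v \<le> 0"
  proof (rule field_le_epsilon)
    fix e :: real assume e: "0 < e"
    have pos: "0 < 2 * N + 4 * b + 10" using b0 by (simp add: N_def add_nonneg_pos)
    obtain v' where v': "v' \<in> ?C" "F v' \<le> (e / (2 * N + 4 * b + 10)) * (2 * N + 4 * b + 10)"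
      using near[of "e / (2 * N + 4 * b + 10)"] e pos by auto
    then have "F v' \<le> e" using pos by simp
    then show "F v \<le> 0 + e" using v(2)[OF v'(1)] by simp
  qed
  moreover have "0 \<le> (\<Sum>w\<in>UNIV. \<bar>fst v $ w - pmf (src1 pXY pZ) w\<bar>)" by (simp add: sum_nonneg)
  ultimately have z: "(\<Sum>w\<in>UNIV. \<bar>fst v $ w - pmf (src1 pXY pZ) w\<bar>) = 0" "H1 \<le> fst (snd v)" "H2 \<le> snd (snd v)"
    unfolding F_def by linarith+
  have "fst v = vec_pmf (src1 pXY pZ)"
    using z(1) by (simp add: sum_nonneg_eq_0_iff vec_eq_iff vec_pmf_def)
  then show ?thesis using v(1) z unfolding H1_def H2_def by (intro exI[of _ "fst (snd v)"] exI[of _ "snd (snd v)"]) (cases v, auto)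
qed

section \<open>The rate formula\<close>

text \<open>Rates strictly above the information are achievable, which suffices for an infimum. Any
  type with finite supports is allowed for U, which covers both alphabets in the theorem.\<close>

lemma secure_rate_le_info:
  fixes pXY :: "('x::finite \<times> 'y::finite) pmf" and pZ :: "'x \<Rightarrow> 'y \<Rightarrow> 'z::finite pmf"
    and pU :: "'x \<Rightarrow> 'y \<Rightarrow> 'z \<Rightarrow> 'u pmf"
  assumes "\<And>x y z. fins (pU x y z)" "admissible_U pXY pZ pU"
  shows "secure_rate pXY pZ \<le> info_ZU_Y pXY pZ pU"
proof (rule dense_ge)
  fix R assume "info_ZU_Y pXY pZ pU < R"
  then have "achievable pXY pZ R" using achievable_if_admissible assms by blast
  moreover have "bdd_below {R. achievable pXY pZ R}" by (rule bdd_belowI[of _ 0]) (auto simp: achievable_def)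
  ultimately show "secure_rate pXY pZ \<le> R" unfolding secure_rate_def by (intro cInf_lower) auto
qed

text \<open>The minimiser comes from maximising H(Z|U,Y) over the compact part of the hull where the
  law is the source law and H(X|U,Y,Z) \<ge> H(X|Y,Z). By the converse every achievable rate is at
  least H(Z|Y) minus this maximum, and the maximiser yields an admissible U attaining that
  value.\<close>

theorem theorem1:
  fixes pXY :: "('x::finite \<times> 'y::finite) pmf"
    and pZ :: "'x \<Rightarrow> 'y \<Rightarrow> 'z::finite pmf"
  assumes "computable_asym_secure pXY pZ"
  shows "(\<exists>pU :: 'x \<Rightarrow> 'y \<Rightarrow> 'z \<Rightarrow> nat pmf.
            (\<forall>x y z. set_pmf (pU x y z) \<subseteq> {..<CARD('x) * CARD('y) * CARD('z) + 2}) \<and>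
            admissible_U pXY pZ pU \<and>
            secure_rate pXY pZ = info_ZU_Y pXY pZ pU) \<and>
         (\<forall>pU :: 'x \<Rightarrow> 'y \<Rightarrow> 'z \<Rightarrow> 'u::finite pmf.
            admissible_U pXY pZ pU \<longrightarrow> secure_rate pXY pZ \<le> info_ZU_Y pXY pZ pU)"
proof (rule conjI)
  let ?s = "src1 pXY pZ"
  define H1 where "H1 = H_X_YZ ?s"
  define H2 where "H2 = H_Z_Y ?s"
  define C where "C = convex hull (aux_point ` aux_laws pXY) \<inter> {v :: (real ^ ('x \<times> 'y \<times> 'z)) \<times> real \<times> real. fst v = vec_pmf ?s \<and> H1 \<le> fst (snd v)}"
  have conv: "\<exists>v\<in>C. H2 - R \<le> snd (snd v)" if "achievable pXY pZ R" for R
    using converse[OF that] unfolding C_def H1_def H2_def by force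
  have "compact C"
    unfolding C_def
    by (intro compact_Int_closed compact_convex_hull compact_aux_point_aux_laws closed_Collect_conj closed_Collect_eq closed_Collect_le continuous_intros)
  \<comment> \<open>Computability supplies an achievable rate, which the converse turns into a point
    of \<open>C\<close>.\<close>
  moreover have "C \<noteq> {}" using conv assms unfolding computable_asym_secure_def by blast
  moreover have "continuous_on C (\<lambda>v. snd (snd v))" by (intro continuous_intros)
  ultimately obtain v where v: "v \<in> C" "\<And>v'. v' \<in> C \<Longrightarrow> snd (snd v') \<le> snd (snd v)"
    using continuous_attains_sup[of C "\<lambda>v. snd (snd v)"] by blast
  have "(vec_pmf ?s, fst (snd v), snd (snd v)) \<in> convex hull (aux_point ` aux_laws pXY)" "H1 \<le> fst (snd v)"
    using v(1) unfolding C_def by (cases v; auto)+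
  from admissible_of_hull_point[OF this[unfolded H1_def]]
  obtain pU :: "'x \<Rightarrow> 'y \<Rightarrow> 'z \<Rightarrow> nat pmf"
    where pU: "\<forall>x y z. set_pmf (pU x y z) \<subseteq> {..<CARD('x) * CARD('y) * CARD('z) + 2}" "admissible_U pXY pZ pU"
      "info_ZU_Y pXY pZ pU = H2 - snd (snd v)" unfolding H2_def by blast
  have "secure_rate pXY pZ \<le> info_ZU_Y pXY pZ pU"
    by (rule secure_rate_le_info[OF finite_subset[OF pU(1)[rule_format] finite_lessThan] pU(2)])
  moreover have "info_ZU_Y pXY pZ pU \<le> secure_rate pXY pZ"
    unfolding secure_rate_def
  proof (rule cInf_greatest)
    show "{R. achievable pXY pZ R} \<noteq> {}" using assms unfolding computable_asym_secure_def by blast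
    fix R assume "R \<in> {R. achievable pXY pZ R}"
    then obtain v' where "v' \<in> C" "H2 - R \<le> snd (snd v')" using conv by blast
    then show "info_ZU_Y pXY pZ pU \<le> R" using v(2)[of v'] pU(3) by simp
  qed
  ultimately show "\<exists>pU :: 'x \<Rightarrow> 'y \<Rightarrow> 'z \<Rightarrow> nat pmf.
            (\<forall>x y z. set_pmf (pU x y z) \<subseteq> {..<CARD('x) * CARD('y) * CARD('z) + 2}) \<and>
            admissible_U pXY pZ pU \<and>
            secure_rate pXY pZ = info_ZU_Y pXY pZ pU"
    using pU by (intro exI[of _ pU]) auto
qed (auto intro!: secure_rate_le_info)

end
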